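(* In the setting described in the context, let $\kappa:[-1,1]\to\mathbb{R}$ be given by $\mathbb{E}[T_1(x)T_1(y)]=\kappa(\langle x,y\rangle)$ and assume $\kappa\in C^1$. Let $\mathrm{N}=(0,\dots,0,1)\in\mathbb{S}^d$ be the north pole, and consider the property (P) for all $x\in\mathbb{S}^d$: $\displaystyle\lim_{L\to\infty}\big(T_L(x)-T_L(\mathrm{N})\big)=0$ in $L^2(\mathbb{P})$. **Low-disorder.** If $\kappa'(1)<1$, then (P) holds. Moreover, if $\kappa$ is $s$ times differentiable in a neighborhood of $1$, then for every $r=1,\dots,s$ and all $x\in\mathbb{S}^d$, $$\mathrm{Var}\big(T_L^{(r)}(x)\big)=O(\kappa'(1)^L)\quad\text{as }L\to\infty,$$ and in particular $T_L^{(r)}(x)\to0$ in $L^2(\mathbb{P})$. **Sparse.** If $\kappa'(1)=1$, then (P) holds. Moreover, if $\kappa$ is $s$ times differentiable in a neighborhood of $1$, then for every $r=1,\dots,s$ there exists a constant $c_r>0$ such that for all $x\in\mathbb{S}^d$, $$\mathrm{Var}\big(T_L^{(r)}(x)\big)=L^{r-1}(c_r+o(1))\quad\text{as }L\to\infty,$$ and in particular $T_L^{(r)}(x)\not\to0$ in $L^2(\mathbb{P})$. **High-disorder.** If $\kappa'(1)>1$, then (P) does not hold. Moreover, if $\kappa$ is $s$ times differentiable in a neighborhood of $1$, then for every $r=1,\dots,s$ there exists a constant $c_r>0$ such that for all $x\in\mathbb{S}^d$, $$\mathrm{Var}\big(T_L^{(r)}(x)\big)=\kappa'(1)^{rL}(c_r+o(1))\quad\text{as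 }L\to\infty,$$ and in particular $T_L^{(r)}(x)\not\to0$ in $L^2(\mathbb{P})$.
   Context: Let $d\ge2$ be an integer, $\mathbb{S}^d\subset\mathbb{R}^{d+1}$ the unit sphere, and $\sigma:\mathbb{R}\to\mathbb{R}$ a function with $0<\Gamma_\sigma:=\mathbb{E}[\sigma(Z)^2]<\infty$, $Z\sim\mathcal{N}(0,1)$. Let $\Gamma_b,\Gamma_{W_0}>0$ with $\Gamma_b+\Gamma_{W_0}=1$, and $\Gamma_W=(1-\Gamma_b)\Gamma_\sigma^{-1}$. A random neural network is $x\in\mathbb{S}^d\mapsto W^{(0)}x+b^{(1)}$ for layer $0$, and at layer $s\ge1$ it is $W^{(s)}\sigma(\,\cdot\,)+b^{(s+1)}$ applied (with $\sigma$ acting componentwise) to the output of layer $s-1$. All entries are independent centered Gaussians: biases have variance $\Gamma_b$, entries of $W^{(0)}$ have variance $\Gamma_{W_0}$, and entries of $W^{(s)}$ have variance $\Gamma_W/n_s$, where $n_s$ is the width of layer $s$. $T_L:\mathbb{S}^d\to\mathbb{R}$ denotes a component of the infinite-width Gaussian limit at layer $L$. Concretely: - $\kappa_1=\kappa$, where $\kappa(u)=\Gamma_b+\Gamma_W\,\mathbb{E}[\sigma(Z_1)\sigma(Z_2)]$ with $(Z_1,Z_2)$ centered Gaussian, unit variances and covariance $\Gamma_b+\Gamma_{W_0}u$; in particular $\kappa(1)=1$. - $\kappa_L=\kappa\circ\kappa_{L-1}$ for $L\ge2$ (so $\kappa_L$ is the composition of $L$ copies of $\kappa$). - $T_L$ is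 a centered Gaussian field on $\mathbb{S}^d$ with covariance $\mathbb{E}[T_L(x)T_L(y)]=\kappa_L(\langle x,y\rangle)$. Derivatives: $T_L^{(r)}(x)=(-\Delta_{\mathbb{S}^d})^{r/2}T_L(x)$, where $\Delta_{\mathbb{S}^d}$ is the Laplace–Beltrami operator. It is defined spectrally: writing the expansion $T_L=\sum_{\ell\ge0}\sum_m a_{\ell m}Y_{\ell m}$ in an $L^2$-orthonormal basis of real spherical harmonics, where $\Delta_{\mathbb{S}^d}Y_{\ell m}=-\ell(\ell+d-1)Y_{\ell m}$, one sets $T_L^{(r)}=\sum_{\ell,m}(\ell(\ell+d-1))^{r/2}a_{\ell m}Y_{\ell m}$. Neighborhoods of $1$ are relative to $[-1,1]$ (one-sided derivatives at $1$). *)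

theory Defs
  imports "HOL-Probability.Probability"
begin

section \<open>Gaussian expectations and the kernel of the network\<close>

abbreviation std_gaussian :: "real measure" where
  "std_gaussian \<equiv> density lborel (\<lambda>z. ennreal (std_normal_density z))"

text \<open>
  The centered Gaussian law on the plane with unit variances and covariance \<open>c\<close>, for
  \<open>-1 \<le> c \<le> 1\<close>: the law of \<open>(Z, c Z + sqrt (1 - c\<^sup>2) W)\<close> with \<open>Z\<close>, \<open>W\<close> independent standard
  normal variables. The degenerate cases \<open>c = 1\<close> and \<open>c = -1\<close> are included, so a density
  would not do.
\<close>

definition gaussian_pair :: "real \<Rightarrow> (real \<times> real) measure" where
  "gaussian_pair c =
     distr (std_gaussian \<Otimes>\<^sub>M std_gaussian) (borel \<Otimes>\<^sub>M borel)
       (\<lambda>(z, w). (z, c * z + sqrt (1 - c\<^sup>2) * w))"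

definition Gamma_sigma :: "(real \<Rightarrow> real) \<Rightarrow> real" where
  "Gamma_sigma \<sigma> = (\<integral>z. (\<sigma> z)\<^sup>2 \<partial>std_gaussian)"

definition Gamma_W :: "(real \<Rightarrow> real) \<Rightarrow> real \<Rightarrow> real" where
  "Gamma_W \<sigma> \<Gamma>b = (1 - \<Gamma>b) / Gamma_sigma \<sigma>"

text \<open>Only the values for \<open>u\<close> in \<open>[-1, 1]\<close> are meaningful.\<close>

definition nn_kernel :: "(real \<Rightarrow> real) \<Rightarrow> real \<Rightarrow> real \<Rightarrow> real \<Rightarrow> real" where
  "nn_kernel \<sigma> \<Gamma>b \<Gamma>W0 u =
     \<Gamma>b + Gamma_W \<sigma> \<Gamma>b *
       (\<integral>z. \<sigma> (fst z) * \<sigma> (snd z) \<partial>gaussian_pair (\<Gamma>b + \<Gamma>W0 * u))"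

definition times_differentiable_on :: "nat \<Rightarrow> (real \<Rightarrow> real) \<Rightarrow> real set \<Rightarrow> bool" where
  "times_differentiable_on s f S \<longleftrightarrow>
     (\<exists>D. (\<forall>u\<in>S. D 0 u = f u) \<and>
          (\<forall>k<s. \<forall>u\<in>S. (D k has_real_derivative D (Suc k) u) (at u within S)))"

text \<open>Neighbourhoods of \<open>1\<close> are relative to \<open>[-1, 1]\<close>; derivatives at \<open>1\<close> are one-sided.\<close>

definition times_differentiable_near_1 :: "nat \<Rightarrow> (real \<Rightarrow> real) \<Rightarrow> bool" where
  "times_differentiable_near_1 s f \<longleftrightarrow>
     (\<exists>\<epsilon>>0. times_differentiable_on s f ({-1..1} \<inter> ball 1 \<epsilon>))"


section \<open>Gaussian fields and mean-square convergence\<close>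

text \<open>Degenerate (almost surely zero) variables count as normal.\<close>

definition centered_normal :: "'w measure \<Rightarrow> ('w \<Rightarrow> real) \<Rightarrow> bool" where
  "centered_normal M X \<longleftrightarrow>
     X \<in> borel_measurable M \<and>
     (distr M borel X = return borel 0 \<or>
      (\<exists>s>0. distr M borel X = density lborel (\<lambda>z. ennreal (normal_density 0 s z))))"

definition centered_gaussian_field ::
  "'w measure \<Rightarrow> 'i set \<Rightarrow> ('i \<Rightarrow> 'w \<Rightarrow> real) \<Rightarrow> bool" where
  "centered_gaussian_field M I X \<longleftrightarrow>
     (\<forall>A c. finite A \<and> A \<subseteq> I \<longrightarrow> centered_normal M (\<lambda>\<omega>. \<Sum>i\<in>A. c i * X i \<omega>))"

definition square_integrable :: "'w measure \<Rightarrow> ('w \<Rightarrow> real) \<Rightarrow> bool" where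
  "square_integrable M X \<longleftrightarrow> X \<in> borel_measurable M \<and> integrable M (\<lambda>\<omega>. (X \<omega>)\<^sup>2)"

definition L2_tendsto :: "'w measure \<Rightarrow> (nat \<Rightarrow> 'w \<Rightarrow> real) \<Rightarrow> ('w \<Rightarrow> real) \<Rightarrow> bool" where
  "L2_tendsto M X U \<longleftrightarrow>
     (\<forall>\<^sub>F n in sequentially. square_integrable M (X n)) \<and> square_integrable M U \<and>
     (\<lambda>n. \<integral>\<omega>. (X n \<omega> - U \<omega>)\<^sup>2 \<partial>M) \<longlonglongrightarrow> 0"


section \<open>Spherical harmonics and the spectral derivative\<close>

text \<open>
  Surface measure of the unit sphere, as the cone measure: the measure of \<open>A\<close> is the dimension
  of the ambient space times the volume of the points \<open>x\<close> of the unit ball with \<open>x / norm x\<close>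
  in \<open>A\<close>. The underlying space of the measure is the sphere.
\<close>

definition sphere_measure :: "'a::euclidean_space measure" where
  "sphere_measure =
     restrict_space
       (distr (density lborel (\<lambda>x. of_nat DIM('a) * indicator (ball 0 1) x)) borel sgn)
       (sphere 0 1)"

definition laplacian :: "('a::euclidean_space \<Rightarrow> real) \<Rightarrow> 'a \<Rightarrow> real" where
  "laplacian p x = (\<Sum>b\<in>Basis. (deriv ^^ 2) (\<lambda>t. p (x + t *\<^sub>R b)) 0)"

definition spherical_harmonic :: "nat \<Rightarrow> ('a::euclidean_space \<Rightarrow> real) \<Rightarrow> bool" where
  "spherical_harmonic l Y \<longleftrightarrow>
     (\<exists>p. real_polynomial_function p \<and>
          (\<forall>c x. p (c *\<^sub>R x) = c ^ l * p x) \<and>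
          (\<forall>x. laplacian p x = 0) \<and>
          (\<forall>x\<in>sphere 0 1. Y x = p x))"

text \<open>
  \<open>Y l m\<close>, for \<open>m < N l\<close>, runs through a basis of the spherical harmonics of degree \<open>l\<close>, and the
  whole family is orthonormal for the surface measure.
\<close>

definition spherical_harmonic_basis ::
  "(nat \<Rightarrow> nat) \<Rightarrow> (nat \<Rightarrow> nat \<Rightarrow> 'a::euclidean_space \<Rightarrow> real) \<Rightarrow> bool" where
  "spherical_harmonic_basis N Y \<longleftrightarrow>
     (\<forall>l. \<forall>m<N l. spherical_harmonic l (Y l m)) \<and>
     (\<forall>l. \<forall>m<N l. \<forall>l'. \<forall>m'<N l'.
        (\<integral>x. Y l m x * Y l' m' x \<partial>sphere_measure) = (if l = l' \<and> m = m' then 1 else 0)) \<and>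
     (\<forall>l h. spherical_harmonic l h \<longrightarrow>
        (\<exists>c. \<forall>x\<in>sphere 0 1. h x = (\<Sum>m<N l. c m * Y l m x)))"

definition harmonic_coeff :: "('a::euclidean_space \<Rightarrow> real) \<Rightarrow> ('a \<Rightarrow> real) \<Rightarrow> real" where
  "harmonic_coeff y f = (\<integral>x. f x * y x \<partial>sphere_measure)"

text \<open>
  On the unit sphere of a space of dimension \<open>d + 1\<close>, the eigenvalue \<open>l (l + d - 1)\<close> is
  \<open>l (l + DIM - 2)\<close>, and its power \<open>r / 2\<close> is the \<open>r\<close>-th power of its square root.
\<close>

definition spectral_partial_sum ::
  "(nat \<Rightarrow> nat) \<Rightarrow> (nat \<Rightarrow> nat \<Rightarrow> 'a::euclidean_space \<Rightarrow> real) \<Rightarrow> nat \<Rightarrow>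
   ('a \<Rightarrow> real) \<Rightarrow> nat \<Rightarrow> 'a \<Rightarrow> real" where
  "spectral_partial_sum N Y r f n x =
     (\<Sum>l<n. \<Sum>m<N l.
        sqrt (real l * (real l + real DIM('a) - 2)) ^ r * harmonic_coeff (Y l m) f * Y l m x)"

text \<open>
  The spectral series at a point \<open>x\<close> is summed in mean square, so the derivative at \<open>x\<close> is a
  random variable determined up to almost sure equality. When the series does not converge the
  value is arbitrary.
\<close>

definition is_spectral_deriv ::
  "'w measure \<Rightarrow> (nat \<Rightarrow> nat) \<Rightarrow> (nat \<Rightarrow> nat \<Rightarrow> 'a::euclidean_space \<Rightarrow> real) \<Rightarrow> nat \<Rightarrow>
   ('a \<Rightarrow> 'w \<Rightarrow> real) \<Rightarrow> 'a \<Rightarrow> ('w \<Rightarrow> real) \<Rightarrow> bool" where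
  "is_spectral_deriv M N Y r X x U \<longleftrightarrow>
     L2_tendsto M (\<lambda>n \<omega>. spectral_partial_sum N Y r (\<lambda>y. X y \<omega>) n x) U"

definition spectral_deriv ::
  "'w measure \<Rightarrow> (nat \<Rightarrow> nat) \<Rightarrow> (nat \<Rightarrow> nat \<Rightarrow> 'a::euclidean_space \<Rightarrow> real) \<Rightarrow> nat \<Rightarrow>
   ('a \<Rightarrow> 'w \<Rightarrow> real) \<Rightarrow> 'a \<Rightarrow> 'w \<Rightarrow> real" where
  "spectral_deriv M N Y r X x = (SOME U. is_spectral_deriv M N Y r X x U)"

end

theory Submission
  imports Defs "HOL-Complex_Analysis.Complex_Analysis" "HOL-Real_Asymp.Real_Asymp"
begin

text \<open>
  Mehler's formula shows that \<open>\<kappa>\<close> is a power series in the correlation with nonnegative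
  coefficients, hence the generating function of a probability distribution \<open>p\<close> on the natural
  numbers with \<open>p(0) > 0\<close>; its value and differentiability at 1 only involve monotone limits. The
  iterate \<open>\<kappa>\<^sub>L\<close> is then the generating function of the \<open>L\<close>-th generation of a branching process with
  mean offspring \<open>\<kappa>'(1)\<close>, and the three regimes are the subcritical, critical and supercritical
  ones. The factorial moments of the generations are the coefficients of an iterated formal power
  series, whose asymptotics follow from a Stolz-Cesaro argument.

  On the sphere, \<open>u\<^sup>k\<close> is a convex combination of Legendre polynomials \<open>P\<^sub>l(u)\<close>, and
  \<open>y \<mapsto> P\<^sub>l(\<langle>x, y\<rangle>)\<close> is a spherical harmonic of degree \<open>l\<close>. Orthogonality alone then gives the variance of
  the spectral derivative as the \<open>r\<close>-th power of \<open>-\<Delta>\<close> applied to the covariance and evaluated at 1,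
  which is a nonnegative combination of the first \<open>r\<close> factorial moments.
\<close>


section \<open>Iterates of formal power series\<close>

unbundle no vec_syntax
unbundle fps_syntax

text \<open>Three obstacles shape the development. Differentiability is given only finitely often
  and only from the left at 1, and \<kappa> need not be analytic there; so moments are taken in
  \<open>ennreal\<close>, composed as Taylor coefficients of \<open>pgf p (1 + t) - 1\<close> in a
  formal variable, and turned into reals once differentiability has bounded them. Mehler's series is
  available only for correlations strictly between -1 and 1; that its nonnegative coefficients have
  total mass \<open>Gamma_sigma \<sigma>\<close> is drawn from the continuity of \<kappa> at 1. The
  spherical Laplacian has order two, so \<open>r\<close> applications seem to cost
  \<open>2 * r\<close> derivatives, but its second-order part carries the factor u^2 - 1 and
  vanishes at 1: each application costs a single derivative there, which is why \<open>s\<close>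
  derivatives of \<kappa> serve all \<open>r\<close> up to \<open>s\<close>. The condition
  \<open>\<Gamma>b > 0\<close> enters as \<open>pmf p 0 > 0\<close>. It excludes the identity map in
  the critical regime, and with mean at least 1 it forces offspring numbers of at least 2, whose
  second factorial moment makes the leading constants positive.\<close>

lemma stolz_cesaro:
  fixes x b :: "nat \<Rightarrow> real"
  assumes b: "\<And>n. b n < b (Suc n)" "filterlim b at_top sequentially"
    and lim: "(\<lambda>n. (x (Suc n) - x n) / (b (Suc n) - b n)) \<longlonglongrightarrow> c"
  shows "(\<lambda>n. x n / b n) \<longlonglongrightarrow> c"
proof -
  \<comment> \<open>Subtracting \<open>c * b\<close> reduces the claim to limit 0. Late increments
    of \<open>y\<close> are then at most \<open>e / 2\<close> times those of \<open>b\<close>, and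
    telescoping carries this over to \<open>y\<close> itself.\<close>
  define y where "y n = x n - c * b n" for n
  have "(\<lambda>n. y n / b n) \<longlonglongrightarrow> 0"
  proof (rule LIMSEQ_I)
    fix e :: real assume "e > 0"
    then have "\<forall>\<^sub>F n in sequentially. norm ((x (Suc n) - x n) / (b (Suc n) - b n) - c) < e / 2"
      using LIMSEQ_D[OF lim, of "e/2"] by (auto simp: eventually_at_top_linorder)
    then obtain n0 where n0: "\<And>n. n \<ge> n0 \<Longrightarrow> \<bar>(x (Suc n) - x n) / (b (Suc n) - b n) - c\<bar> < e / 2"
      by (auto simp: eventually_at_top_linorder)
    have diff_bound: "\<bar>y (Suc n) - y n\<bar> \<le> e / 2 * (b (Suc n) - b n)" if "n \<ge> n0" for n
    proof -
      have pos: "b (Suc n) - b n > 0" using b(1)[of n] by simp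
      have "y (Suc n) - y n = ((x (Suc n) - x n) / (b (Suc n) - b n) - c) * (b (Suc n) - b n)"
        using pos by (simp add: y_def field_simps)
      then show ?thesis
        using n0[OF that] pos by (simp add: abs_mult mult_right_mono)
    qed
    have bound: "\<bar>y n\<bar> \<le> \<bar>y n0\<bar> + e / 2 * (b n - b n0)" if "n \<ge> n0" for n
      using that
    proof (induction n rule: dec_induct)
      case (step n)
      have "\<bar>y (Suc n)\<bar> \<le> \<bar>y n\<bar> + \<bar>y (Suc n) - y n\<bar>" by linarith
      also have "\<dots> \<le> (\<bar>y n0\<bar> + e / 2 * (b n - b n0)) + e / 2 * (b (Suc n) - b n)"
        using step.IH diff_bound[OF step.hyps(1)] by (rule add_mono)
      finally show ?case by (simp add: algebra_simps diff_divide_distrib)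
    qed simp
    have "\<forall>\<^sub>F n in sequentially. b n > max 0 (2 * (\<bar>y n0\<bar> + e / 2 * \<bar>b n0\<bar>) / e)"
      using b(2) unfolding filterlim_at_top_dense by blast
    then have "\<forall>\<^sub>F n in sequentially. norm (y n / b n - 0) < e"
      using eventually_ge_at_top[of n0]
    proof eventually_elim
      case (elim n)
      then have pos: "b n > 0" by simp
      have "2 * (\<bar>y n0\<bar> + e / 2 * \<bar>b n0\<bar>) < e * b n"
        using elim \<open>e > 0\<close> by (simp add: field_simps)
      moreover have "\<bar>y n\<bar> \<le> \<bar>y n0\<bar> + e / 2 * b n + e / 2 * \<bar>b n0\<bar>"
        using bound[OF elim(2)] \<open>e > 0\<close> mult_left_mono[of "- b n0" "\<bar>b n0\<bar>" "e/2"]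
        by (simp add: field_simps abs_ge_minus_self)
      ultimately have "\<bar>y n\<bar> < e * b n"
        by (simp add: algebra_simps)
      then show ?case using pos by (simp add: field_simps)
    qed
    then show "\<exists>no. \<forall>n\<ge>no. norm (y n / b n - 0) < e"
      by (simp add: eventually_at_top_linorder)
  qed
  then have "(\<lambda>n. y n / b n + c) \<longlonglongrightarrow> 0 + c"
    by (intro tendsto_intros)
  moreover have "\<forall>\<^sub>F n in sequentially. y n / b n + c = x n / b n"
    using b(2)[unfolded filterlim_at_top_dense, rule_format, of 0]
    by eventually_elim (simp add: y_def field_simps)
  ultimately show ?thesis
    using Lim_transform_eventually by fastforce
qed

text \<open>A series without constant term is \<open>fps_X\<close> times its shift, so the
  \<open>i\<close>-th power starts at degree \<open>i\<close>. For positive \<open>i\<close>, degree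
  \<open>j\<close> of the power therefore sees only coefficients of index at most
  \<open>j - i + 1\<close>.\<close>

lemma fps_power_nth_shift:
  fixes F :: "'a :: comm_ring_1 fps"
  assumes "F $ 0 = 0"
  shows "i \<le> j \<Longrightarrow> (F ^ i) $ j = (fps_shift 1 F ^ i) $ (j - i)"
    and "j < i \<Longrightarrow> (F ^ i) $ j = 0"
proof -
  have "F = fps_X * fps_shift 1 F"
    by (rule fps_ext) (use assms in \<open>auto simp: fps_X_mult_nth\<close>)
  then have eq: "F ^ i = fps_X ^ i * fps_shift 1 F ^ i"
    by (metis power_mult_distrib)
  show "i \<le> j \<Longrightarrow> (F ^ i) $ j = (fps_shift 1 F ^ i) $ (j - i)"
    and "j < i \<Longrightarrow> (F ^ i) $ j = 0"
    by (simp_all add: eq fps_X_power_mult_nth)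
qed

text \<open>The scale \<open>\<alpha> L * \<beta> L ^ k\<close> is multiplicative under Cauchy
  products, so limits pass to powers termwise. One statement serves all regimes: with mean \<mu>,
  the pair (\<alpha>, \<beta>) is (\<mu>^L, 1) below criticality, (1, L) at it and (\<mu>^L,
  \<mu>^L) above it.\<close>

lemma tendsto_fps_power_nth:
  fixes F :: "nat \<Rightarrow> real fps" and E :: "real fps"
  assumes "\<And>k. k \<le> m \<Longrightarrow> (\<lambda>L. F L $ k / (\<alpha> L * \<beta> L ^ k)) \<longlonglongrightarrow> E $ k"
    and "i > 0"
  shows "(\<lambda>L. (F L ^ i) $ m / (\<alpha> L ^ i * \<beta> L ^ m)) \<longlonglongrightarrow> (E ^ i) $ m"
  using assms
proof (induction i arbitrary: m)
  case (Suc i)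
  show ?case
  proof (cases "i = 0")
    case True
    then show ?thesis using Suc.prems by simp
  next
    case False
    have "(\<lambda>L. (\<Sum>k=0..m. (F L $ k / (\<alpha> L * \<beta> L ^ k)) *
              ((F L ^ i) $ (m - k) / (\<alpha> L ^ i * \<beta> L ^ (m - k))))) \<longlonglongrightarrow>
            (\<Sum>k=0..m. E $ k * (E ^ i) $ (m - k))"
      using False Suc.prems by (intro tendsto_sum tendsto_mult Suc.IH) auto
    moreover have "(\<Sum>k=0..m. (F L $ k / (\<alpha> L * \<beta> L ^ k)) *
              ((F L ^ i) $ (m - k) / (\<alpha> L ^ i * \<beta> L ^ (m - k)))) =
              (F L ^ Suc i) $ m / (\<alpha> L ^ Suc i * \<beta> L ^ m)" for L
    proof -
      have "\<beta> L ^ k * \<beta> L ^ (m - k) = \<beta> L ^ m" if "k \<le> m" for k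
        using that by (simp flip: power_add)
      then show ?thesis
        unfolding power_Suc fps_mult_nth sum_divide_distrib
        by (intro sum.cong) (auto simp: mult_ac)
    qed
    ultimately show ?thesis by (simp add: fps_mult_nth)
  qed
qed simp

section \<open>Coefficient asymptotics of iterated power series\<close>

primrec fps_iter :: "real fps \<Rightarrow> nat \<Rightarrow> real fps" where
  "fps_iter K 0 = fps_X"
| "fps_iter K (Suc L) = fps_compose K (fps_iter K L)"

lemma fps_iter_nth_0 [simp]: "K $ 0 = 0 \<Longrightarrow> fps_iter K L $ 0 = 0"
  by (cases L) auto

text \<open>With \<open>K\<close> composed on the outside, the \<open>j\<close>-th coefficient obeys
  a linear recursion in \<open>L\<close> whose factor \<open>K $ 1\<close> is the same for every
  \<open>j\<close>; all other terms come from powers \<open>i \<ge> 2\<close>.\<close>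

lemma fps_iter_Suc_nth:
  assumes "K $ 0 = 0" "j \<ge> 1"
  shows "fps_iter K (Suc L) $ j =
    K $ 1 * fps_iter K L $ j + (\<Sum>i=2..j. K $ i * (fps_iter K L ^ i) $ j)"
proof -
  have "fps_iter K (Suc L) $ j = (\<Sum>i=0..j. K $ i * (fps_iter K L ^ i) $ j)"
    by (simp add: fps_compose_nth)
  also have "{0..j} = insert 0 (insert 1 {2..j})"
    using assms by auto
  finally show ?thesis using assms by simp
qed

lemma fps_iter_nth_1: "K $ 0 = 0 \<Longrightarrow> fps_iter K L $ 1 = (K $ 1) ^ L"
  by (induction L) (simp_all add: fps_iter_Suc_nth del: fps_iter.simps(2))

lemma fps_power_nonneg: "(\<And>n. (F::real fps) $ n \<ge> 0) \<Longrightarrow> (F ^ i) $ n \<ge> 0"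
  by (induction i arbitrary: n) (auto simp: fps_mult_nth intro!: sum_nonneg)

lemma fps_iter_nonneg: "(\<And>n. K $ n \<ge> 0) \<Longrightarrow> fps_iter K L $ n \<ge> 0"
  by (induction L arbitrary: n)
     (auto simp: fps_compose_nth intro!: sum_nonneg mult_nonneg_nonneg fps_power_nonneg)

text \<open>For \<open>i \<ge> 2\<close> the \<open>j\<close>-th coefficient of the \<open>i\<close>-th power only involves coefficients below
  \<open>j\<close>, so in the recursion over \<open>L\<close> it acts as an inhomogeneity with known asymptotics.\<close>

lemma tendsto_fps_iter_power:
  assumes K: "K $ 0 = 0"
    and lim: "\<And>k. 1 \<le> k \<Longrightarrow> k < j \<Longrightarrow> (\<lambda>L. fps_iter K L $ k / (\<alpha> L * \<beta> L ^ (k - 1))) \<longlonglongrightarrow> e k"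
    and i: "2 \<le> i" "i \<le> j"
  shows "(\<lambda>L. (fps_iter K L ^ i) $ j / (\<alpha> L ^ i * \<beta> L ^ (j - i))) \<longlonglongrightarrow>
           (Abs_fps (\<lambda>k. e (Suc k)) ^ i) $ (j - i)"
proof -
  have "(\<lambda>L. (fps_shift 1 (fps_iter K L) ^ i) $ (j - i) / (\<alpha> L ^ i * \<beta> L ^ (j - i))) \<longlonglongrightarrow>
           (Abs_fps (\<lambda>k. e (Suc k)) ^ i) $ (j - i)"
  proof (rule tendsto_fps_power_nth)
    show "(\<lambda>L. fps_shift 1 (fps_iter K L) $ k / (\<alpha> L * \<beta> L ^ k)) \<longlonglongrightarrow> Abs_fps (\<lambda>k. e (Suc k)) $ k"
      if "k \<le> j - i" for k
      using lim[of "Suc k"] that i by simp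
  qed (use i in auto)
  then show ?thesis
    using i K by (simp add: fps_power_nth_shift)
qed

text \<open>After division by \<mu>^L the increments are of order \<mu>^(i L) / \<mu>^L with
  \<open>i \<ge> 2\<close>, hence at most of order \<mu>^L and summable, so the normalised
  coefficient converges. The limit may vanish; what is drawn from it later is boundedness.\<close>

lemma fps_iter_subcritical:
  assumes K: "K $ 0 = 0" "0 < K $ 1" "K $ 1 < 1" and j: "j \<ge> 1"
  shows "\<exists>e. (\<lambda>L. fps_iter K L $ j / (K $ 1) ^ L) \<longlonglongrightarrow> e"
  using j
proof (induction j rule: less_induct)
  case (less j)
  define \<mu> where "\<mu> = K $ 1"
  have \<mu>: "0 < \<mu>" "\<mu> < 1" using K by (auto simp: \<mu>_def)
  from less have "\<exists>e. \<forall>k. 1 \<le> k \<longrightarrow> k < j \<longrightarrow> (\<lambda>L. fps_iter K L $ k / \<mu> ^ L) \<longlonglongrightarrow> e k"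
    unfolding \<mu>_def by metis
  then obtain e where e: "\<And>k. 1 \<le> k \<Longrightarrow> k < j \<Longrightarrow> (\<lambda>L. fps_iter K L $ k / \<mu> ^ L) \<longlonglongrightarrow> e k"
    by auto
  define x where "x L = fps_iter K L $ j / \<mu> ^ L" for L
  have diff: "x (Suc L) - x L = (\<Sum>i=2..j. K $ i * (fps_iter K L ^ i) $ j) / \<mu> ^ Suc L" for L
    using \<mu> less.prems K(1) unfolding x_def
    by (simp add: fps_iter_Suc_nth \<mu>_def field_simps del: fps_iter.simps)
  have "summable (\<lambda>L. x (Suc L) - x L)"
  proof -
    have "summable (\<lambda>L. K $ i * (fps_iter K L ^ i) $ j / \<mu> ^ Suc L)" if i: "i \<in> {2..j}" for i
    proof -
      have "(\<lambda>L. (fps_iter K L ^ i) $ j / ((\<mu> ^ L) ^ i * 1 ^ (j - i))) \<longlonglongrightarrow>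
           (Abs_fps (\<lambda>k. e (Suc k)) ^ i) $ (j - i)"
        using e i K(1) by (intro tendsto_fps_iter_power) auto
      then have "Bseq (\<lambda>L. (fps_iter K L ^ i) $ j / (\<mu> ^ L) ^ i)"
        by (intro convergent_imp_Bseq) (auto simp: convergent_def)
      then obtain C where C: "\<And>L. \<bar>(fps_iter K L ^ i) $ j / (\<mu> ^ L) ^ i\<bar> \<le> C"
        by (auto simp: Bseq_def)
      show ?thesis
      proof (rule summable_comparison_test')
        show "summable (\<lambda>L. (\<bar>K $ i\<bar> * C / \<mu>) * \<mu> ^ L)"
          using \<mu> by (intro summable_mult summable_geometric) auto
        show "norm (K $ i * (fps_iter K L ^ i) $ j / \<mu> ^ Suc L) \<le> (\<bar>K $ i\<bar> * C / \<mu>) * \<mu> ^ L"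
          if "L \<ge> 0" for L
        proof -
          have p: "(\<mu> ^ L) ^ i > 0" using \<mu> by simp
          have "(\<mu> ^ L) ^ i \<le> (\<mu> ^ L) ^ 2"
            using i \<mu> by (intro power_decreasing) (auto simp: power_le_one)
          then have q: "\<bar>(fps_iter K L ^ i) $ j\<bar> \<le> C * (\<mu> ^ L * \<mu> ^ L)"
            using C[of L] p mult_left_mono[of "(\<mu> ^ L) ^ i" "(\<mu> ^ L) ^ 2" C] abs_ge_zero[THEN order_trans, OF C[of L]]
            by (simp add: abs_divide field_simps power2_eq_square)
          have "norm (K $ i * (fps_iter K L ^ i) $ j / \<mu> ^ Suc L) = \<bar>K $ i\<bar> * \<bar>(fps_iter K L ^ i) $ j\<bar> / (\<mu> * \<mu> ^ L)"
            using \<mu> by (simp add: abs_mult)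
          also have "\<dots> \<le> \<bar>K $ i\<bar> * (C * (\<mu> ^ L * \<mu> ^ L)) / (\<mu> * \<mu> ^ L)"
            using q \<mu> by (intro divide_right_mono mult_left_mono) auto
          finally show ?thesis using \<mu> by (simp add: field_simps)
        qed
      qed
    qed
    then have "summable (\<lambda>L. \<Sum>i=2..j. K $ i * (fps_iter K L ^ i) $ j / \<mu> ^ Suc L)"
      by (intro summable_sum) auto
    then show ?thesis
      unfolding diff sum_divide_distrib .
  qed
  then have "convergent (\<lambda>n. \<Sum>L<n. x (Suc L) - x L)"
    by (simp add: summable_iff_convergent)
  then have "convergent (\<lambda>n. x n - x 0)"
    by (simp add: sum_lessThan_telescope)
  then have "convergent (\<lambda>n. x n - x 0 + x 0)"
    by (intro convergent_add convergent_const)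
  then show ?case
    by (auto simp: convergent_def x_def[abs_def] \<mu>_def)
qed

text \<open>By induction every product of total degree \<open>j\<close> grows like \<mu>^(j L), so
  all powers \<open>i\<close> from 2 to \<open>j\<close> contribute at the same order. Stolz-Cesaro
  against \<mu>^((j - 1) L) gives the limit \<open>S\<close> / (\<mu>^j - \<mu>), positive because
  the term \<open>i = 2\<close> is positive and the others are nonnegative.\<close>

lemma fps_iter_supercritical:
  assumes K: "K $ 0 = 0" "K $ 1 > 1" "\<And>i. K $ i \<ge> 0" "K $ 2 > 0" and j: "j \<ge> 1"
  shows "\<exists>e>0. (\<lambda>L. fps_iter K L $ j / (K $ 1) ^ (j * L)) \<longlonglongrightarrow> e"
  using j
proof (induction j rule: less_induct)
  case (less j)
  define \<mu> where "\<mu> = K $ 1"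
  have \<mu>: "\<mu> > 1" using K by (auto simp: \<mu>_def)
  show ?case
  proof (cases "j = 1")
    case True
    then show ?thesis
      using fps_iter_nth_1[OF K(1)] \<mu> by (intro exI[of _ 1]) (auto simp: \<mu>_def)
  next
    case False
    then have j: "j \<ge> 2" using less.prems by auto
    from less have "\<exists>e. \<forall>k. 1 \<le> k \<longrightarrow> k < j \<longrightarrow> e k > 0 \<and> (\<lambda>L. fps_iter K L $ k / \<mu> ^ (k * L)) \<longlonglongrightarrow> e k"
      unfolding \<mu>_def by metis
    then obtain e where epos: "\<And>k. 1 \<le> k \<Longrightarrow> k < j \<Longrightarrow> e k > 0"
      and e: "\<And>k. 1 \<le> k \<Longrightarrow> k < j \<Longrightarrow> (\<lambda>L. fps_iter K L $ k / \<mu> ^ (k * L)) \<longlonglongrightarrow> e k"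
      by blast
    \<comment> \<open>The limits \<open>e k\<close> are known to be positive only below
      \<open>j\<close>. The cut to 0 beyond makes every coefficient of \<open>E\<close> nonnegative
      and changes nothing at the degrees that occur, which are at most \<open>j - 2\<close>.\<close>
    define E where "E = Abs_fps (\<lambda>k. if Suc k < j then e (Suc k) else 0)"
    have Enn: "(E ^ i) $ m \<ge> 0" for i m
      by (rule fps_power_nonneg) (auto simp: E_def intro!: less_imp_le[OF epos])
    define S where "S = (\<Sum>i=2..j. K $ i * (E ^ i) $ (j - i))"
    have "(E ^ 2) $ (j - 2) > 0"
    proof -
      have "(E ^ 2) $ (j - 2) = (\<Sum>k=0..j-2. E $ k * E $ (j - 2 - k))"
        by (simp add: power2_eq_square fps_mult_nth)
      also have "\<dots> > 0"
        using j by (intro sum_pos) (auto simp: E_def intro!: mult_pos_pos epos)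
      finally show ?thesis .
    qed
    then have "S > 0" unfolding S_def
      using j K Enn by (intro sum_pos2[of _ 2]) auto
    define x where "x L = fps_iter K L $ j / \<mu> ^ L" for L
    define b where "b L = \<mu> ^ ((j - 1) * L)" for L
    have q: "\<mu> ^ (j - 1) > 1" using \<mu> j by (intro one_less_power) auto
    have b_Suc: "b (Suc L) = b L * \<mu> ^ (j - 1)" for L
      by (simp add: b_def power_add)
    have bpos: "b L > 0" for L using \<mu> by (simp add: b_def)
    have "(\<lambda>n. x n / b n) \<longlonglongrightarrow> S / \<mu> / (\<mu> ^ (j - 1) - 1)"
    proof (rule stolz_cesaro)
      show "b n < b (Suc n)" for n
        using q bpos[of n] by (simp add: b_Suc)
      have "filterlim (\<lambda>n. (\<mu> ^ (j - 1)) ^ n) at_top sequentially"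
        using q by real_asymp
      then show "filterlim b at_top sequentially"
        by (simp add: b_def[abs_def] power_mult)
      have lim: "(\<lambda>L. (\<Sum>i=2..j. K $ i * ((fps_iter K L ^ i) $ j / ((\<mu> ^ L) ^ i * (\<mu> ^ L) ^ (j - i)))))
              \<longlonglongrightarrow> S"
        unfolding S_def
      proof (intro tendsto_sum tendsto_mult tendsto_const)
        fix i assume i: "i \<in> {2..j}"
        have 1: "(\<lambda>L. (fps_iter K L ^ i) $ j / ((\<mu> ^ L) ^ i * (\<mu> ^ L) ^ (j - i)))
            \<longlonglongrightarrow> (Abs_fps (\<lambda>k. (if Suc k < j then e (Suc k) else 0)) ^ i) $ (j - i)"
        proof (rule tendsto_fps_iter_power[where e = "\<lambda>k. if k < j then e k else 0"])
          fix k assume k: "1 \<le> k" "k < j"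
          have "\<mu> ^ L * (\<mu> ^ L) ^ (k - 1) = \<mu> ^ (k * L)" for L
            using k by (cases k) (simp_all add: power_add power_mult[symmetric] mult.commute)
          then show "(\<lambda>L. fps_iter K L $ k / (\<mu> ^ L * (\<mu> ^ L) ^ (k - 1))) \<longlonglongrightarrow> (if k < j then e k else 0)"
            using e[OF k] k by simp
        qed (use K i in auto)
        then show "(\<lambda>L. (fps_iter K L ^ i) $ j / ((\<mu> ^ L) ^ i * (\<mu> ^ L) ^ (j - i)))
            \<longlonglongrightarrow> (E ^ i) $ (j - i)" unfolding E_def .
      qed
      have "(\<lambda>L. (\<Sum>i=2..j. K $ i * ((fps_iter K L ^ i) $ j / ((\<mu> ^ L) ^ i * (\<mu> ^ L) ^ (j - i))))
               / \<mu> / (\<mu> ^ (j - 1) - 1)) \<longlonglongrightarrow> S / \<mu> / (\<mu> ^ (j - 1) - 1)"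
        using \<mu> q by (intro tendsto_divide lim tendsto_const) auto
      moreover have "(\<Sum>i=2..j. K $ i * ((fps_iter K L ^ i) $ j / ((\<mu> ^ L) ^ i * (\<mu> ^ L) ^ (j - i))))
               / \<mu> / (\<mu> ^ (j - 1) - 1) = (x (Suc L) - x L) / (b (Suc L) - b L)" for L
      proof -
        have "(\<mu> ^ L) ^ i * (\<mu> ^ L) ^ (j - i) = \<mu> ^ L * b L" if "i \<in> {2..j}" for i
        proof -
          have "(\<mu> ^ L) ^ i * (\<mu> ^ L) ^ (j - i) = (\<mu> ^ L) ^ j"
            using that by (simp flip: power_add)
          also have "\<dots> = \<mu> ^ L * b L"
            unfolding b_def using j by (cases j) (simp_all add: power_mult[symmetric] power_add[symmetric] mult.commute)
          finally show ?thesis .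
        qed
        then have "(\<Sum>i=2..j. K $ i * ((fps_iter K L ^ i) $ j / ((\<mu> ^ L) ^ i * (\<mu> ^ L) ^ (j - i))))
           = (\<Sum>i=2..j. K $ i * (fps_iter K L ^ i) $ j) / (\<mu> ^ L * b L)"
          unfolding sum_divide_distrib by (intro sum.cong) auto
        moreover have "x (Suc L) - x L = (\<Sum>i=2..j. K $ i * (fps_iter K L ^ i) $ j) / \<mu> ^ Suc L"
          using \<mu> less.prems K(1) unfolding x_def
          by (simp add: fps_iter_Suc_nth \<mu>_def field_simps del: fps_iter.simps)
        moreover have "b (Suc L) - b L = b L * (\<mu> ^ (j - 1) - 1)"
          by (simp add: b_Suc algebra_simps)
        ultimately show ?thesis by (simp add: mult_ac)
      qed
      ultimately show "(\<lambda>n. (x (Suc n) - x n) / (b (Suc n) - b n)) \<longlonglongrightarrow> S / \<mu> / (\<mu> ^ (j - 1) - 1)"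
        by simp
    qed
    moreover have "x n / b n = fps_iter K n $ j / \<mu> ^ (j * n)" for n
      unfolding x_def b_def using j by (cases j) (simp_all add: power_add)
    moreover have "S / \<mu> / (\<mu> ^ (j - 1) - 1) > 0"
      using \<open>S > 0\<close> \<mu> q by simp
    ultimately show ?thesis
      unfolding \<mu>_def by auto
  qed
qed

text \<open>The \<open>i\<close>-th power at degree \<open>j\<close> grows like L^(j - i), while the
  increments of L^(j - 1) are of order L^(j - 2). Thus only \<open>i = 2\<close> survives in the
  Stolz-Cesaro quotient, and the divisor \<open>j - 1\<close> of the limit is the leading
  coefficient of that increment.\<close>

lemma fps_iter_critical:
  assumes K: "K $ 0 = 0" "K $ 1 = 1" "\<And>i. K $ i \<ge> 0" "K $ 2 > 0" and j: "j \<ge> 1"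
  shows "\<exists>e>0. (\<lambda>L. fps_iter K L $ j / real L ^ (j - 1)) \<longlonglongrightarrow> e"
  using j
proof (induction j rule: less_induct)
  case (less j)
  show ?case
  proof (cases "j = 1")
    case True
    then show ?thesis
      using fps_iter_nth_1[OF K(1)] K by (intro exI[of _ 1]) auto
  next
    case False
    then have j: "j \<ge> 2" using less.prems by auto
    from less have "\<exists>e. \<forall>k. 1 \<le> k \<longrightarrow> k < j \<longrightarrow> e k > 0 \<and> (\<lambda>L. fps_iter K L $ k / real L ^ (k - 1)) \<longlonglongrightarrow> e k"
      by metis
    then obtain e where epos: "\<And>k. 1 \<le> k \<Longrightarrow> k < j \<Longrightarrow> e k > 0"
      and e: "\<And>k. 1 \<le> k \<Longrightarrow> k < j \<Longrightarrow> (\<lambda>L. fps_iter K L $ k / real L ^ (k - 1)) \<longlonglongrightarrow> e k"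
      by blast
    define E where "E = Abs_fps (\<lambda>k. e (Suc k))"
    have "(E ^ 2) $ (j - 2) > 0"
    proof -
      have "(E ^ 2) $ (j - 2) = (\<Sum>k=0..j-2. E $ k * E $ (j - 2 - k))"
        by (simp add: power2_eq_square fps_mult_nth)
      also have "\<dots> > 0"
        using j by (intro sum_pos) (auto simp: E_def intro!: mult_pos_pos epos)
      finally show ?thesis .
    qed
    define S where "S = K $ 2 * (E ^ 2) $ (j - 2)"
    have "S > 0" using \<open>(E ^ 2) $ (j - 2) > 0\<close> K by (simp add: S_def)
    define x where "x L = fps_iter K L $ j" for L
    define b where "b L = real L ^ (j - 1)" for L
    have "(\<lambda>n. x n / b n) \<longlonglongrightarrow> S / real (j - 1)"
    proof (rule stolz_cesaro)
      show "b n < b (Suc n)" for n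
        using j by (auto simp: b_def intro!: power_strict_mono)
      show "filterlim b at_top sequentially"
        unfolding b_def using j by (intro filterlim_pow_at_top filterlim_real_sequentially) auto
      have lim_i: "(\<lambda>L. (fps_iter K L ^ i) $ j / real L ^ (j - i)) \<longlonglongrightarrow> (E ^ i) $ (j - i)"
        if i: "i \<in> {2..j}" for i
      proof -
        have "(\<lambda>L. (fps_iter K L ^ i) $ j / (1 ^ i * real L ^ (j - i))) \<longlonglongrightarrow> (E ^ i) $ (j - i)"
          unfolding E_def using K i e by (intro tendsto_fps_iter_power) auto
        then show ?thesis by simp
      qed
      have lim3: "(\<lambda>L. K $ i * (fps_iter K L ^ i) $ j / real L ^ (j - 2)) \<longlonglongrightarrow> 0"
        if i: "i \<in> {3..j}" for i
      proof -
        have "(\<lambda>L. K $ i * ((fps_iter K L ^ i) $ j / real L ^ (j - i) * (1 / real L) ^ (i - 2))) \<longlonglongrightarrow>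
            K $ i * ((E ^ i) $ (j - i) * 0 ^ (i - 2))"
          using i by (intro tendsto_mult tendsto_const lim_i tendsto_power lim_1_over_n) auto
        moreover have "\<forall>\<^sub>F L in sequentially.
            K $ i * ((fps_iter K L ^ i) $ j / real L ^ (j - i) * (1 / real L) ^ (i - 2)) =
            K $ i * (fps_iter K L ^ i) $ j / real L ^ (j - 2)"
          using eventually_gt_at_top[of 0]
        proof eventually_elim
          case (elim L)
          have "real L ^ (j - 2) = real L ^ (j - i) * real L ^ (i - 2)"
            using i by (simp flip: power_add)
          then show ?case by (simp add: power_one_over)
        qed
        ultimately have "(\<lambda>L. K $ i * (fps_iter K L ^ i) $ j / real L ^ (j - 2)) \<longlonglongrightarrow>
            K $ i * ((E ^ i) $ (j - i) * 0 ^ (i - 2))"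
          by (rule Lim_transform_eventually)
        then show ?thesis
          using i by (simp add: power_0_left)
      qed
      have "(\<lambda>L. \<Sum>i=2..j. K $ i * (fps_iter K L ^ i) $ j / real L ^ (j - 2)) \<longlonglongrightarrow>
              (\<Sum>i=2..j. if i = 2 then S else 0)"
      proof (intro tendsto_sum)
        fix i assume i: "i \<in> {2..j}"
        show "(\<lambda>L. K $ i * (fps_iter K L ^ i) $ j / real L ^ (j - 2)) \<longlonglongrightarrow> (if i = 2 then S else 0)"
        proof (cases "i = 2")
          case True
          have "(\<lambda>L. K $ 2 * ((fps_iter K L ^ 2) $ j / real L ^ (j - 2))) \<longlonglongrightarrow> K $ 2 * (E ^ 2) $ (j - 2)"
            using j by (intro tendsto_mult tendsto_const lim_i) auto
          then show ?thesis using True by (simp add: S_def)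
        qed (use lim3 i in auto)
      qed
      also have "(\<Sum>i=2..j. if i = 2 then S else 0) = S"
        using j by (simp add: sum.delta)
      finally have lim: "(\<lambda>L. (\<Sum>i=2..j. K $ i * (fps_iter K L ^ i) $ j / real L ^ (j - 2))) \<longlonglongrightarrow> S" .
      have blim: "(\<lambda>L. (b (Suc L) - b L) / real L ^ (j - 2)) \<longlonglongrightarrow> real (j - 1)"
      proof -
        obtain m where m: "j = Suc (Suc m)" using j by (metis add_2_eq_Suc le_Suc_ex)
        have "(\<lambda>L. (\<Sum>i<Suc m. (1 + 1 / real L) ^ i)) \<longlonglongrightarrow> (\<Sum>i<Suc m. (1 + 0) ^ i)"
          by (intro tendsto_intros lim_1_over_n)
        moreover have "\<forall>\<^sub>F L in sequentially. (\<Sum>i<Suc m. (1 + 1 / real L) ^ i) = (b (Suc L) - b L) / real L ^ (j - 2)"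
          using eventually_gt_at_top[of 0]
        proof eventually_elim
          case (elim L)
          have "b (Suc L) - b L = (\<Sum>i<Suc m. real (Suc L) ^ i * real L ^ (m - i))"
            unfolding b_def m by (simp add: power_diff_sumr2 mult.commute del: power_Suc sum.lessThan_Suc)
          also have "\<dots> / real L ^ m = (\<Sum>i<Suc m. (1 + 1 / real L) ^ i)"
            unfolding sum_divide_distrib
          proof (intro sum.cong refl)
            fix i assume "i \<in> {..<Suc m}"
            then have "real L ^ m = real L ^ i * real L ^ (m - i)"
              by (simp flip: power_add)
            moreover have "1 + 1 / real L = real (Suc L) / real L"
              using elim by (simp add: field_simps)
            ultimately show "real (Suc L) ^ i * real L ^ (m - i) / real L ^ m = (1 + 1 / real L) ^ i"
              using elim by (simp add: power_divide)
          qed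
          finally show ?case by (simp add: m)
        qed
        ultimately have "(\<lambda>L. (b (Suc L) - b L) / real L ^ (j - 2)) \<longlonglongrightarrow> (\<Sum>i<Suc m. (1 + 0) ^ i)"
          by (rule Lim_transform_eventually)
        then show ?thesis by (simp add: m)
      qed
      have "(\<lambda>L. (\<Sum>i=2..j. K $ i * (fps_iter K L ^ i) $ j / real L ^ (j - 2)) /
               ((b (Suc L) - b L) / real L ^ (j - 2))) \<longlonglongrightarrow> S / real (j - 1)"
        using j by (intro tendsto_divide lim blim) auto
      moreover have "\<forall>\<^sub>F L in sequentially. (\<Sum>i=2..j. K $ i * (fps_iter K L ^ i) $ j / real L ^ (j - 2)) /
               ((b (Suc L) - b L) / real L ^ (j - 2)) = (x (Suc L) - x L) / (b (Suc L) - b L)"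
        using eventually_gt_at_top[of 0]
      proof eventually_elim
        case (elim L)
        have "x (Suc L) - x L = (\<Sum>i=2..j. K $ i * (fps_iter K L ^ i) $ j)"
          unfolding x_def using fps_iter_Suc_nth[OF K(1) less.prems] K(2) by simp
        then show ?case using elim by (simp flip: sum_divide_distrib)
      qed
      ultimately show "(\<lambda>n. (x (Suc n) - x n) / (b (Suc n) - b n)) \<longlonglongrightarrow> S / real (j - 1)"
        by (rule Lim_transform_eventually)
    qed
    moreover have "S / real (j - 1) > 0" using \<open>S > 0\<close> j by simp
    ultimately show ?thesis
      unfolding x_def b_def by auto
  qed
qed


section \<open>Probability generating functions\<close>

text \<open>The composition law is immediate for nonnegative integrals. Adding the bound
  \<open>B\<close> moves a bounded signed function into that setting, and \<open>B\<close> is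
  removed again at the end.\<close>

lemma expectation_bind_pmf:
  fixes f :: "'b \<Rightarrow> real"
  assumes B: "\<And>y. \<bar>f y\<bar> \<le> B"
  shows "measure_pmf.expectation (bind_pmf p q) f =
    measure_pmf.expectation p (\<lambda>x. measure_pmf.expectation (q x) f)"
proof -
  have int: "integrable (measure_pmf r) f" for r
    using B by (intro measure_pmf.integrable_const_bound[where B = B]) auto
  have abs: "\<bar>measure_pmf.expectation r f\<bar> \<le> B" for r
  proof -
    have "\<bar>measure_pmf.expectation r f\<bar> \<le> measure_pmf.expectation r (\<lambda>x. \<bar>f x\<bar>)"
      by (rule integral_abs_bound)
    also have "\<dots> \<le> measure_pmf.expectation r (\<lambda>x. B)"
      using B int by (intro integral_mono) auto
    finally show ?thesis by simp
  qed
  have shift: "ennreal (measure_pmf.expectation r f + B) = (\<integral>\<^sup>+y. ennreal (f y + B) \<partial>r)" for r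
  proof -
    have "(\<integral>\<^sup>+y. ennreal (f y + B) \<partial>r) = ennreal (measure_pmf.expectation r (\<lambda>y. f y + B))"
      using int B by (intro nn_integral_eq_integral) (auto simp: abs_le_iff intro!: AE_I2, smt (verit) B)
    then show ?thesis using int by simp
  qed
  have int2: "integrable (measure_pmf p) (\<lambda>x. measure_pmf.expectation (q x) f)"
    using abs by (intro measure_pmf.integrable_const_bound[where B = B]) auto
  have nonneg: "measure_pmf.expectation r f + B \<ge> 0" for r
    using abs[of r] by linarith
  have "ennreal (measure_pmf.expectation (bind_pmf p q) f + B) =
      (\<integral>\<^sup>+x. ennreal (measure_pmf.expectation (q x) f + B) \<partial>p)"
    by (simp add: shift)
  also have "\<dots> = ennreal (measure_pmf.expectation p (\<lambda>x. measure_pmf.expectation (q x) f + B))"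
    using int2 nonneg by (intro nn_integral_eq_integral) auto
  also have "\<dots> = ennreal (measure_pmf.expectation p (\<lambda>x. measure_pmf.expectation (q x) f) + B)"
    using int2 by simp
  finally have "measure_pmf.expectation (bind_pmf p q) f + B =
      measure_pmf.expectation p (\<lambda>x. measure_pmf.expectation (q x) f) + B"
  proof (rule ennreal_inj[THEN iffD1, rotated 2])
    have "measure_pmf.expectation p (\<lambda>x. measure_pmf.expectation (q x) f + B) \<ge> 0"
      using nonneg by (intro integral_nonneg_AE) auto
    then show "0 \<le> measure_pmf.expectation p (\<lambda>x. measure_pmf.expectation (q x) f) + B"
      using int2 by simp
  qed (rule nonneg)
  then show ?thesis by simp
qed

definition pgf :: "nat pmf \<Rightarrow> real \<Rightarrow> real" where
  "pgf p u = (\<Sum>k. pmf p k * u ^ k)"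

lemma pmf_nat_sums: "pmf p sums (1::real)" for p :: "nat pmf"
proof -
  have "ennreal 1 = (\<integral>\<^sup>+k. ennreal (pmf p k) \<partial>count_space UNIV)"
    by (simp add: nn_integral_pmf measure_pmf.emeasure_space_1[simplified])
  also have "\<dots> = (\<Sum>k. ennreal (pmf p k))"
    by (rule nn_integral_count_space_nat)
  finally have "(\<lambda>k. ennreal (pmf p k)) sums ennreal 1"
    using summable_sums[OF summableI, of "\<lambda>k. ennreal (pmf p k)"] by simp
  then show ?thesis
    by (subst (asm) sums_ennreal) auto
qed

lemma summable_pgf:
  fixes p :: "nat pmf" and u :: real
  assumes "\<bar>u\<bar> \<le> 1"
  shows "summable (\<lambda>k. norm (pmf p k * u ^ k))"
proof (rule summable_comparison_test')
  show "summable (pmf p)" using pmf_nat_sums[of p] by (rule sums_summable)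
  show "norm (norm (pmf p k * u ^ k)) \<le> pmf p k" if "k \<ge> 0" for k
    using mult_left_mono[OF power_le_one[of "\<bar>u\<bar>" k], of "pmf p k"] assms
    by (simp add: abs_mult power_abs)
qed

lemma pgf_sums: "\<bar>u\<bar> \<le> 1 \<Longrightarrow> (\<lambda>k. pmf p k * u ^ k) sums pgf p u"
  unfolding pgf_def by (rule summable_sums[OF summable_norm_cancel[OF summable_pgf]])

lemma pgf_eq_expectation:
  assumes "\<bar>u\<bar> \<le> 1"
  shows "pgf p u = measure_pmf.expectation p (\<lambda>k. u ^ k)"
proof -
  have "integrable (measure_pmf p) (\<lambda>k. u ^ k)"
    using assms by (intro measure_pmf.integrable_const_bound[where B = 1])
      (auto simp: power_abs power_le_one)
  then have "integrable (count_space UNIV) (\<lambda>k. pmf p k * u ^ k)"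
    by (simp add: measure_pmf_eq_density integrable_density)
  from sums_integral_count_space_nat[OF this]
  have "(\<lambda>k. pmf p k * u ^ k) sums measure_pmf.expectation p (\<lambda>k. u ^ k)"
    by (simp add: measure_pmf_eq_density integral_density)
  then show ?thesis
    using pgf_sums[OF assms] sums_unique2 by blast
qed

lemma pgf_1 [simp]: "pgf p 1 = 1"
  using sums_unique[OF pmf_nat_sums[of p]] by (simp add: pgf_def)

lemma pgf_abs_le:
  assumes "\<bar>u\<bar> \<le> 1"
  shows "\<bar>pgf p u\<bar> \<le> 1"
proof -
  have "\<bar>pgf p u\<bar> \<le> (\<Sum>k. norm (pmf p k * u ^ k))"
    unfolding pgf_def real_norm_def[symmetric] by (rule summable_norm) (rule summable_pgf[OF assms])
  also have "\<dots> \<le> (\<Sum>k. pmf p k)"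
  proof (rule suminf_le)
    show "norm (pmf p k * u ^ k) \<le> pmf p k" for k
      using mult_left_mono[OF power_le_one[of "\<bar>u\<bar>" k], of "pmf p k"] assms
      by (simp add: abs_mult power_abs)
  qed (use pmf_nat_sums[of p] summable_pgf[OF assms] in \<open>auto simp: sums_iff\<close>)
  finally show ?thesis using pmf_nat_sums[of p] by (simp add: sums_iff)
qed

lemma pgf_0: "pgf p 0 = pmf p 0"
  by (simp add: pgf_def)

section \<open>Compound laws and branching processes\<close>

primrec iid_sum :: "nat pmf \<Rightarrow> nat \<Rightarrow> nat pmf" where
  "iid_sum q 0 = return_pmf 0"
| "iid_sum q (Suc n) = bind_pmf q (\<lambda>k. map_pmf ((+) k) (iid_sum q n))"

definition compound_pmf :: "nat pmf \<Rightarrow> nat pmf \<Rightarrow> nat pmf" where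
  "compound_pmf p q = bind_pmf p (iid_sum q)"

text \<open>The size of generation \<open>L\<close> of a branching process with offspring law
  \<open>p\<close>, split at the first generation: each child of the root starts a process of
  \<open>L\<close> further generations. This order puts \<open>pgf p\<close> outermost, matching
  \<open>fps_iter\<close>.\<close>

primrec branching_pmf :: "nat pmf \<Rightarrow> nat \<Rightarrow> nat pmf" where
  "branching_pmf p 0 = return_pmf 1"
| "branching_pmf p (Suc L) = compound_pmf p (branching_pmf p L)"

lemma pgf_iid_sum:
  assumes "\<bar>u\<bar> \<le> 1"
  shows "pgf (iid_sum q n) u = pgf q u ^ n"
proof (induction n)
  case 0
  then show ?case using assms by (simp add: pgf_eq_expectation)
next
  case (Suc n)
  have "pgf (iid_sum q (Suc n)) u =
      measure_pmf.expectation q (\<lambda>k. u ^ k * pgf (iid_sum q n) u)"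
    using assms unfolding pgf_eq_expectation[OF assms] iid_sum.simps
    by (subst expectation_bind_pmf[where B = 1])
       (auto simp: power_abs power_le_one power_add)
  then show ?case
    using Suc by (simp add: pgf_eq_expectation[OF assms])
qed

lemma pgf_compound_pmf:
  assumes "\<bar>u\<bar> \<le> 1"
  shows "pgf (compound_pmf p q) u = pgf p (pgf q u)"
proof -
  have "pgf (compound_pmf p q) u = measure_pmf.expectation p (\<lambda>n. pgf (iid_sum q n) u)"
    using assms unfolding pgf_eq_expectation[OF assms] compound_pmf_def
    by (subst expectation_bind_pmf[where B = 1]) (auto simp: power_abs power_le_one)
  then show ?thesis
    using pgf_abs_le[OF assms, of q] by (simp add: pgf_iid_sum[OF assms] pgf_eq_expectation)
qed

lemma pgf_branching_pmf:
  assumes "\<bar>u\<bar> \<le> 1"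
  shows "pgf (branching_pmf p L) u = (pgf p ^^ L) u"
proof (induction L)
  case 0
  then show ?case using assms by (simp add: pgf_eq_expectation)
qed (simp add: pgf_compound_pmf[OF assms])

text \<open>These are the Taylor coefficients of the generating function at 1: formally,
  \<open>pgf p (1 + t)\<close> has coefficients \<open>binomial_moment p j\<close>. Values in
  \<open>ennreal\<close> keep the identities valid before finiteness is known.\<close>

definition binomial_moment :: "nat pmf \<Rightarrow> nat \<Rightarrow> ennreal" where
  "binomial_moment p j = (\<integral>\<^sup>+k. of_nat (k choose j) \<partial>measure_pmf p)"

lemma binomial_moment_0 [simp]: "binomial_moment p 0 = 1"
  by (simp add: binomial_moment_def measure_pmf.emeasure_space_1[simplified])

text \<open>Vandermonde's identity makes the binomial moments of an independent sum a Cauchy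
  product, so the series multiply.\<close>

lemma binomial_moment_iid_sum:
  "binomial_moment (iid_sum q n) j = (Abs_fps (binomial_moment q) ^ n) $ j"
proof (induction n arbitrary: j)
  case 0
  then show ?case by (auto simp: binomial_moment_def binomial_eq_0_iff)
next
  case (Suc n)
  have "binomial_moment (iid_sum q (Suc n)) j =
      (\<integral>\<^sup>+k. \<integral>\<^sup>+m. of_nat ((k + m) choose j) \<partial>measure_pmf (iid_sum q n) \<partial>measure_pmf q)"
    by (simp add: binomial_moment_def)
  also have "\<dots> = (\<integral>\<^sup>+k. \<integral>\<^sup>+m. (\<Sum>i\<le>j. of_nat (k choose i) * of_nat (m choose (j - i)))
      \<partial>measure_pmf (iid_sum q n) \<partial>measure_pmf q)"
    unfolding vandermonde[symmetric] by simp
  also have "\<dots> = (\<Sum>i\<le>j. binomial_moment q i * binomial_moment (iid_sum q n) (j - i))"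
    by (simp add: nn_integral_sum nn_integral_cmult nn_integral_multc binomial_moment_def)
  finally show ?case
    by (simp add: Suc fps_mult_nth atMost_atLeast0)
qed

text \<open>Stated over semirings, because it is applied to series with coefficients in
  \<open>ennreal\<close>, which is not a ring.\<close>

lemma fps_power_nth_eq_0:
  fixes F :: "'a :: comm_semiring_1 fps"
  assumes "F $ 0 = 0"
  shows "j < i \<Longrightarrow> (F ^ i) $ j = 0"
proof (induction i arbitrary: j)
  case (Suc i)
  have "F $ k * (F ^ i) $ (j - k) = 0" if "k \<in> {0..j}" for k
    using that Suc assms by (cases k) auto
  then show ?case by (simp add: fps_mult_nth)
qed simp

text \<open>Writing the series of \<open>q\<close> as \<open>R + 1\<close> and expanding its
  \<open>n\<close>-th power by the binomial theorem, the average over \<open>n\<close> produces the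
  binomial moments of \<open>p\<close>. The right-hand side is the composition of the two series
  without their constant terms.\<close>

lemma binomial_moment_compound_pmf:
  fixes q :: "nat pmf"
  defines "R \<equiv> Abs_fps (\<lambda>i. if i = 0 then 0 else binomial_moment q i)"
  assumes "j \<ge> 1"
  shows "binomial_moment (compound_pmf p q) j = (\<Sum>i=1..j. binomial_moment p i * (R ^ i) $ j)"
proof -
  have [simp]: "R $ 0 = 0" by (simp add: R_def)
  have eq: "Abs_fps (binomial_moment q) = R + 1"
    by (rule fps_ext) (auto simp: R_def)
  have pow: "((R + 1) ^ n) $ j = (\<Sum>i=1..j. of_nat (n choose i) * (R ^ i) $ j)" for n
  proof -
    have "((R + 1) ^ n) $ j = (\<Sum>i\<le>n. of_nat (n choose i) * (R ^ i) $ j)"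
      by (subst binomial_ring) (simp add: fps_sum_nth mult.assoc)
    also have "\<dots> = (\<Sum>i=1..j. of_nat (n choose i) * (R ^ i) $ j)"
    proof (rule sum.mono_neutral_cong)
      show "of_nat (n choose i) * (R ^ i) $ j = 0" if "i \<in> {..n} - {1..j}" for i
        using that assms(2) by (cases "i = 0") (auto simp: fps_power_nth_eq_0)
    qed (auto simp: binomial_eq_0_iff)
    finally show ?thesis .
  qed
  have "binomial_moment (compound_pmf p q) j =
      (\<integral>\<^sup>+n. binomial_moment (iid_sum q n) j \<partial>measure_pmf p)"
    by (simp add: binomial_moment_def compound_pmf_def)
  also have "\<dots> = (\<integral>\<^sup>+n. (\<Sum>i=1..j. of_nat (n choose i) * (R ^ i) $ j) \<partial>measure_pmf p)"
    by (simp add: binomial_moment_iid_sum eq pow)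
  also have "\<dots> = (\<Sum>i=1..j. binomial_moment p i * (R ^ i) $ j)"
    by (simp add: nn_integral_sum nn_integral_multc binomial_moment_def)
  finally show ?thesis .
qed

text \<open>Cut off above \<open>s\<close>, where moments may be infinite, and given constant term
  0, so that iterated composition behaves well. The cut is invisible in the coefficients up to
  \<open>s\<close> of any iterate.\<close>

definition moment_fps :: "nat \<Rightarrow> nat pmf \<Rightarrow> real fps" where
  "moment_fps s p = Abs_fps (\<lambda>j. if 1 \<le> j \<and> j \<le> s then enn2real (binomial_moment p j) else 0)"

lemma moment_fps_nonneg: "moment_fps s p $ j \<ge> 0"
  by (simp add: moment_fps_def)

lemma moment_fps_0 [simp]: "moment_fps s p $ 0 = 0"
  by (simp add: moment_fps_def)

lemma ennreal_fps_power_nth: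
  assumes "\<And>j. j \<le> s \<Longrightarrow> G $ j = ennreal (F $ j)" "\<And>j. F $ j \<ge> 0"
  shows "j \<le> s \<Longrightarrow> (G ^ i) $ j = ennreal ((F ^ i) $ j)"
proof (induction i arbitrary: j)
  case (Suc i)
  have "(G ^ Suc i) $ j = (\<Sum>k=0..j. ennreal (F $ k) * ennreal ((F ^ i) $ (j - k)))"
    unfolding power_Suc fps_mult_nth using Suc assms by (intro sum.cong) auto
  also have "\<dots> = (\<Sum>k=0..j. ennreal (F $ k * (F ^ i) $ (j - k)))"
    using assms(2) by (intro sum.cong) (auto simp: ennreal_mult' )
  also have "\<dots> = ennreal ((F ^ Suc i) $ j)"
    using assms(2) by (subst sum_ennreal) (auto simp: fps_mult_nth intro!: mult_nonneg_nonneg fps_power_nonneg)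
  finally show ?case .
qed auto

text \<open>Only coefficients up to \<open>j\<close> enter the \<open>j\<close>-th coefficient of a
  composition, so finiteness of the first \<open>s\<close> moments of \<open>p\<close> passes to
  every generation.\<close>

lemma binomial_moment_branching_pmf:
  assumes fin: "\<And>j. j \<le> s \<Longrightarrow> binomial_moment p j < \<infinity>"
  shows "1 \<le> j \<Longrightarrow> j \<le> s \<Longrightarrow>
    binomial_moment (branching_pmf p L) j = ennreal (fps_iter (moment_fps s p) L $ j)"
proof (induction L arbitrary: j)
  case 0
  then show ?case by (auto simp: binomial_moment_def binomial_eq_0_iff)
next
  case (Suc L)
  define K where "K = moment_fps s p"
  have K: "K $ i \<ge> 0" "K $ 0 = 0" for i by (simp_all add: K_def moment_fps_nonneg)
  define R where "R = Abs_fps (\<lambda>i. if i = 0 then 0 else binomial_moment (branching_pmf p L) i)"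
  have R: "(R ^ i) $ j = ennreal ((fps_iter K L ^ i) $ j)" for i
  proof (rule ennreal_fps_power_nth)
    show "R $ j = ennreal (fps_iter K L $ j)" if "j \<le> s" for j
      using Suc.IH[of j] that K by (cases "j = 0") (auto simp: R_def K_def)
  qed (use Suc.prems K in \<open>auto intro!: fps_iter_nonneg\<close>)
  have "binomial_moment (branching_pmf p (Suc L)) j = (\<Sum>i=1..j. binomial_moment p i * (R ^ i) $ j)"
    using binomial_moment_compound_pmf[OF Suc.prems(1), of p "branching_pmf p L"]
    by (simp add: R_def)
  also have "\<dots> = (\<Sum>i=1..j. ennreal (K $ i * (fps_iter K L ^ i) $ j))"
  proof (rule sum.cong[OF refl])
    fix i assume i: "i \<in> {1..j}"
    then have "binomial_moment p i = ennreal (K $ i)"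
      using fin[of i] Suc.prems by (simp add: K_def moment_fps_def)
    then show "binomial_moment p i * (R ^ i) $ j = ennreal (K $ i * (fps_iter K L ^ i) $ j)"
      using K by (simp add: R ennreal_mult')
  qed
  also have "\<dots> = ennreal (\<Sum>i=1..j. K $ i * (fps_iter K L ^ i) $ j)"
    using K by (intro sum_ennreal) (auto intro!: mult_nonneg_nonneg fps_power_nonneg fps_iter_nonneg)
  also have "(\<Sum>i=1..j. K $ i * (fps_iter K L ^ i) $ j) = (\<Sum>i=0..j. K $ i * (fps_iter K L ^ i) $ j)"
    using K by (intro sum.mono_neutral_left) (auto simp: not_less_eq_eq)
  also have "\<dots> = fps_iter K (Suc L) $ j"
    by (simp add: fps_compose_nth)
  finally show ?case by (simp add: K_def)
qed

section \<open>One-sided derivatives at 1 and finiteness of moments\<close>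

lemma summable_left_derivative_at_1:
  fixes a :: "nat \<Rightarrow> real"
  assumes a: "\<And>n. a n \<ge> 0" "summable a" and \<epsilon>: "\<epsilon> > 0" "\<epsilon> \<le> 1"
    and D: "(F has_real_derivative D) (at 1 within {1-\<epsilon><..1})"
    and F: "\<And>u. u \<in> {1-\<epsilon><..1} \<Longrightarrow> F u = (\<Sum>n. a n * u ^ n)"
  shows "(\<lambda>n. real n * a n) sums D"
proof -
  let ?S = "{1-\<epsilon><..<1::real}"
  have nontriv: "at 1 within ?S \<noteq> bot"
    using \<epsilon> by (simp add: trivial_limit_within islimpt_greaterThanLessThan2)
  have summ: "summable (\<lambda>n. a n * u ^ n)" if "u \<in> {1-\<epsilon><..1}" for u
  proof (rule summable_comparison_test'[OF a(2)])
    show "norm (a n * u ^ n) \<le> a n" if "n \<ge> 0" for n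
      using mult_left_mono[OF power_le_one[of u n], of "a n"] \<open>u \<in> _\<close> \<epsilon> a(1)[of n]
      by (auto simp: abs_mult)
  qed
  \<comment> \<open>The difference quotient is the sum of the \<open>a n\<close> times 1 + u + ... +
    u^(n - 1), nonnegative terms that increase to \<open>real n * a n\<close> as \<open>u\<close>
    tends to 1. Both bounds on \<open>D\<close> follow: finite partial sums pass to the limit, and
    for each \<open>u\<close> the quotient is dominated by the full sum.\<close>
  define Q where "Q u = (F 1 - F u) / (1 - u)" for u
  have "((\<lambda>u. (F u - F 1) / (u - 1)) \<longlongrightarrow> D) (at 1 within {1-\<epsilon><..1})"
    using D by (simp add: has_field_derivative_iff)
  then have "((\<lambda>u. (F u - F 1) / (u - 1)) \<longlongrightarrow> D) (at 1 within ?S)"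
    by (rule tendsto_within_subset) auto
  moreover have "(F u - F 1) / (u - 1) = Q u" for u
    unfolding Q_def by (metis minus_diff_eq minus_divide_divide)
  ultimately have Q: "(Q \<longlongrightarrow> D) (at 1 within ?S)" by simp
  have Qsums: "(\<lambda>n. a n * (\<Sum>k<n. u ^ k)) sums Q u" if "u \<in> ?S" for u
  proof -
    have "(\<lambda>n. (a n * 1 ^ n - a n * u ^ n) / (1 - u)) sums ((F 1 - F u) / (1 - u))"
      using F[of 1] F[of u] summ[of 1] summ[of u] that \<epsilon>
      by (intro sums_divide sums_diff) (auto simp: sums_iff)
    moreover have "(a n * 1 ^ n - a n * u ^ n) / (1 - u) = a n * (\<Sum>k<n. u ^ k)" for n
    proof -
      have "a n * 1 ^ n - a n * u ^ n = (1 - u) * (a n * (\<Sum>k<n. u ^ k))"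
        using one_diff_power_eq[of u n] by (metis mult.left_commute power_one right_diff_distrib)
      then show ?thesis using that by simp
    qed
    ultimately show ?thesis by (simp add: Q_def)
  qed
  have upper: "(\<Sum>n<N. real n * a n) \<le> D" for N
  proof (rule tendsto_le[OF nontriv Q])
    have "((\<lambda>u. \<Sum>n<N. a n * (\<Sum>k<n. u ^ k)) \<longlongrightarrow> (\<Sum>n<N. a n * (\<Sum>k<n. 1 ^ k))) (at 1 within ?S)"
      by (intro tendsto_intros)
    then show "((\<lambda>u. \<Sum>n<N. a n * (\<Sum>k<n. u ^ k)) \<longlongrightarrow> (\<Sum>n<N. real n * a n)) (at 1 within ?S)"
      by (simp add: mult.commute)
    show "\<forall>\<^sub>F u in at 1 within ?S. (\<Sum>n<N. a n * (\<Sum>k<n. u ^ k)) \<le> Q u"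
    proof (rule eventually_at_topological[THEN iffD2], intro exI[of _ UNIV] conjI ballI impI)
      fix u assume u: "u \<in> ?S"
      show "(\<Sum>n<N. a n * (\<Sum>k<n. u ^ k)) \<le> Q u"
        using Qsums[OF u] u \<epsilon> a(1)
        by (intro sum_le_suminf[THEN order_trans])
           (auto simp: sums_iff intro!: mult_nonneg_nonneg sum_nonneg)
    qed auto
  qed
  have summ_na: "summable (\<lambda>n. real n * a n)"
    using upper a(1) by (intro bounded_imp_summable[where B = D])
      (auto simp: lessThan_Suc_atMost[symmetric] simp del: sum.lessThan_Suc)
  have "suminf (\<lambda>n. real n * a n) \<le> D"
    using summ_na upper by (intro suminf_le_const) auto
  moreover have "D \<le> suminf (\<lambda>n. real n * a n)"
  proof (rule tendsto_upperbound[OF Q _ nontriv])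
    show "\<forall>\<^sub>F u in at 1 within ?S. Q u \<le> suminf (\<lambda>n. real n * a n)"
    proof (rule eventually_at_topological[THEN iffD2], intro exI[of _ UNIV] conjI ballI impI)
      fix u assume u: "u \<in> ?S"
      have "(\<Sum>k<n. u ^ k) \<le> real n" for n
        using sum_bounded_above[of "{..<n}" "\<lambda>k. u ^ k" 1] u \<epsilon> by (auto simp: power_le_one)
      then have le: "a n * (\<Sum>k<n. u ^ k) \<le> real n * a n" for n
        using mult_left_mono[OF _ a(1)[of n]] by (metis mult.commute)
      show "Q u \<le> suminf (\<lambda>n. real n * a n)"
        using suminf_le[OF le _ summ_na] Qsums[OF u] by (auto simp: sums_iff)
    qed auto
  qed
  ultimately show ?thesis
    using summ_na by (simp add: sums_iff)
qed

lemma sums_diffs_iff: "diffs c sums D \<longleftrightarrow> (\<lambda>n. of_nat n * c n) sums (D :: real)"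
  using sums_Suc_iff[of "\<lambda>n. of_nat n * c n" D] by (simp add: diffs_def)

text \<open>Inside the open interval the power series can be differentiated termwise; at the
  endpoint 1 the nonnegativity of the coefficients takes over through the quotient argument above.
  Hence each one-sided derivative at 1 is again the sum of its series, and the induction
  continues.\<close>

lemma summable_diffs_at_1:
  fixes a :: "nat \<Rightarrow> real"
  assumes a: "\<And>n. a n \<ge> 0" "summable a" and \<epsilon>: "\<epsilon> > 0" "\<epsilon> \<le> 1"
    and F: "\<And>u. u \<in> {1-\<epsilon><..1} \<Longrightarrow> D 0 u = (\<Sum>n. a n * u ^ n)"
    and D: "\<And>k u. k < s \<Longrightarrow> u \<in> {1-\<epsilon><..1} \<Longrightarrow>
      (D k has_real_derivative D (Suc k) u) (at u within {1-\<epsilon><..1})"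
  shows "k \<le> s \<Longrightarrow> summable ((diffs ^^ k) a) \<and>
    (\<forall>u\<in>{1-\<epsilon><..1}. D k u = (\<Sum>n. (diffs ^^ k) a n * u ^ n))"
proof (induction k)
  case 0
  then show ?case using a F by auto
next
  case (Suc k)
  let ?c = "(diffs ^^ k) a"
  have nonneg: "(diffs ^^ k) a n \<ge> 0" for k n
    by (induction k arbitrary: n) (auto simp: a diffs_def)
  from Suc have IH: "summable ?c" "\<And>u. u \<in> {1-\<epsilon><..1} \<Longrightarrow> D k u = (\<Sum>n. ?c n * u ^ n)"
    and k: "k < s" by auto
  have sums: "(\<lambda>n. real n * ?c n) sums D (Suc k) 1"
    using \<epsilon> by (intro summable_left_derivative_at_1[OF nonneg IH(1) \<epsilon> D[OF k] IH(2)]) auto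
  then have sums': "diffs ?c sums D (Suc k) 1"
    by (simp add: sums_diffs_iff)
  have "D (Suc k) u = (\<Sum>n. diffs ?c n * u ^ n)" if u: "u \<in> {1-\<epsilon><..1}" for u
  proof (cases "u = 1")
    case True
    then show ?thesis using sums' by (simp add: sums_iff)
  next
    case False
    then have u': "u \<in> {1-\<epsilon><..<1}" using u by auto
    have "(D k has_real_derivative D (Suc k) u) (at u within {1-\<epsilon><..<1})"
      using D[OF k u] by (rule has_field_derivative_subset) auto
    then have "(D k has_real_derivative D (Suc k) u) (at u)"
      by (subst (asm) at_within_open[OF u']) auto
    moreover have "((\<lambda>u. \<Sum>n. ?c n * u ^ n) has_real_derivative (\<Sum>n. diffs ?c n * u ^ n)) (at u)"
      using u' \<epsilon> IH(1) by (intro termdiffs_strong[where K = 1]) auto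
    then have "(D k has_real_derivative (\<Sum>n. diffs ?c n * u ^ n)) (at u)"
      by (rule has_field_derivative_transform_within_open[of _ _ _ "{1-\<epsilon><..<1}"])
        (use u' IH(2) in auto)
    ultimately show ?thesis by (rule DERIV_unique)
  qed
  then show ?case using sums' by (auto simp: sums_iff)
qed

lemma diffs_funpow:
  fixes a :: "nat \<Rightarrow> real"
  shows "(diffs ^^ k) a n = fact k * real ((n + k) choose k) * a (n + k)"
proof (induction k arbitrary: n)
  case (Suc k)
  have "Suc n * (Suc (n + k) choose k) = Suc k * (Suc (n + k) choose Suc k)"
    using binomial_absorb_comp[of "Suc (n + k)" k] Suc_times_binomial[of k "n + k"]
    by (simp del: binomial_Suc_Suc)
  then have "real (Suc n) * real ((Suc n + k) choose k) = real (Suc k) * real (Suc (n + k) choose Suc k)"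
    unfolding of_nat_mult[symmetric] by simp
  moreover have "(diffs ^^ Suc k) a n = real (Suc n) * (diffs ^^ k) a (Suc n)"
    by (simp only: funpow.simps o_apply diffs_def)
  ultimately show ?case
    by (simp add: Suc mult_ac del: binomial_Suc_Suc of_nat_Suc funpow.simps)
qed simp

lemma binomial_moment_finite:
  assumes "times_differentiable_near_1 s f" and f: "\<And>u. u \<in> {-1..1} \<Longrightarrow> f u = pgf p u"
    and j: "j \<le> s"
  shows "binomial_moment p j < \<infinity>"
proof -
  obtain \<epsilon> D where \<epsilon>: "\<epsilon> > 0" and D0: "\<And>u. u \<in> {-1..1} \<inter> ball 1 \<epsilon> \<Longrightarrow> D 0 u = f u"
    and D: "\<And>k u. k < s \<Longrightarrow> u \<in> {-1..1} \<inter> ball 1 \<epsilon> \<Longrightarrow>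
       (D k has_real_derivative D (Suc k) u) (at u within {-1..1} \<inter> ball 1 \<epsilon>)"
    using assms(1) unfolding times_differentiable_near_1_def times_differentiable_on_def by blast
  \<comment> \<open>The bound by 1 keeps the interval in the positive half-line, where powers are
    nonnegative.\<close>
  define \<delta> where "\<delta> = min 1 \<epsilon>"
  have \<delta>: "\<delta> > 0" "\<delta> \<le> 1" and sub: "{1-\<delta><..1} \<subseteq> {-1..1} \<inter> ball 1 \<epsilon>"
    using \<epsilon> by (auto simp: \<delta>_def dist_real_def)
  have "summable ((diffs ^^ j) (pmf p))"
  proof (rule summable_diffs_at_1[THEN conjunct1])
    show "D 0 u = (\<Sum>n. pmf p n * u ^ n)" if "u \<in> {1-\<delta><..1}" for u
    proof -
      have "u \<in> {-1..1} \<inter> ball 1 \<epsilon>" using sub that by blast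
      then show ?thesis using D0[of u] f[of u] by (simp add: pgf_def)
    qed
    show "(D k has_real_derivative D (Suc k) u) (at u within {1-\<delta><..1})"
      if "k < s" "u \<in> {1-\<delta><..1}" for k u
      using D[OF that(1)] that(2) sub by (blast intro: has_field_derivative_subset)
  qed (use \<delta> j pmf_nat_sums[of p] in \<open>auto simp: sums_iff\<close>)
  then have "summable (\<lambda>n. fact j * (real ((n + j) choose j) * pmf p (n + j)))"
    by (simp add: diffs_funpow[abs_def] mult.assoc)
  then have "summable (\<lambda>n. real ((n + j) choose j) * pmf p (n + j))"
    by (subst (asm) summable_cmult_iff) auto
  then have "summable (\<lambda>n. real (n choose j) * pmf p n)"
    by (subst (asm) summable_iff_shift[where f = "\<lambda>n. real (n choose j) * pmf p n"])
  then have "(\<Sum>n. ennreal (real (n choose j) * pmf p n)) \<noteq> top"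
    by (rule ennreal_suminf_neq_top) auto
  moreover have "binomial_moment p j = (\<Sum>n. ennreal (real (n choose j) * pmf p n))"
    unfolding binomial_moment_def nn_integral_measure_pmf nn_integral_count_space_nat
    by (simp add: ennreal_mult' ennreal_of_nat_eq_real_of_nat mult.commute)
  ultimately show ?thesis by (simp add: less_top)
qed

lemma pgf_mean_sums:
  assumes f: "\<And>u. u \<in> {-1..1} \<Longrightarrow> f u = pgf p u"
    and D: "(f has_real_derivative D) (at 1 within {-1..1})"
  shows "(\<lambda>n. real n * pmf p n) sums D"
proof (rule summable_left_derivative_at_1)
  show "(f has_real_derivative D) (at 1 within {1-1<..1})"
    using D by (rule has_field_derivative_subset) auto
qed (use f pmf_nat_sums[of p] in \<open>auto simp: sums_iff pgf_def\<close>)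

lemma binomial_moment_1:
  assumes "(\<lambda>n. real n * pmf p n) sums D"
  shows "binomial_moment p 1 = ennreal D"
proof -
  have "binomial_moment p 1 = (\<Sum>n. ennreal (real n * pmf p n))"
    unfolding binomial_moment_def nn_integral_measure_pmf nn_integral_count_space_nat
    by (simp add: ennreal_mult' ennreal_of_nat_eq_real_of_nat mult.commute)
  also have "\<dots> = ennreal D"
    using assms by (intro suminf_ennreal_eq) auto
  finally show ?thesis .
qed


section \<open>Iterated generating functions\<close>

lemma one_minus_power_le:
  assumes "\<bar>u :: real\<bar> \<le> 1"
  shows "1 - u ^ n \<le> real n * (1 - u)"
proof -
  have "u ^ k \<le> 1" for k
    using power_le_one[of "\<bar>u\<bar>" k] assms power_abs[of u k] by linarith
  then have "(\<Sum>k<n. u ^ k) \<le> real n"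
    using sum_bounded_above[of "{..<n}" "\<lambda>k. u ^ k" 1] by simp
  then have "(1 - u) * (\<Sum>k<n. u ^ k) \<le> (1 - u) * real n"
    using assms by (intro mult_left_mono) auto
  then show ?thesis by (simp add: one_diff_power_eq mult.commute)
qed

text \<open>The affine case: with no mass from 2 on, the mean is \<open>pmf p 1\<close>. Together
  with \<open>pmf p 0 > 0\<close> this gives a mean below 1, so critical and supercritical laws
  charge some \<open>n \<ge> 2\<close>.\<close>

lemma pmf_eq_0_if_le_1:
  fixes p :: "nat pmf"
  assumes D: "(\<lambda>n. real n * pmf p n) sums D" and z: "\<And>n. n \<ge> 2 \<Longrightarrow> pmf p n = 0"
  shows "D = 1 - pmf p 0"
proof -
  have "(\<lambda>n. real n * pmf p n) sums (\<Sum>n\<in>{0,1}. real n * pmf p n)"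
  proof (rule sums_finite)
    show "real n * pmf p n = 0" if "n \<notin> {0, 1}" for n
      using z[of n] that by auto
  qed auto
  with D have "D = pmf p 1" using sums_unique2 by fastforce
  moreover have "pmf p sums (\<Sum>n\<in>{0,1}. pmf p n)"
  proof (rule sums_finite)
    show "pmf p n = 0" if "n \<notin> {0, 1}" for n
      using z[of n] that by (cases "n \<ge> 2") auto
  qed auto
  then have "1 = pmf p 0 + pmf p 1"
    using pmf_nat_sums[of p] sums_unique2 by fastforce
  ultimately show ?thesis by simp
qed

text \<open>Comparison with the tangent line at 1. The terms \<open>w n\<close> are nonnegative
  because 1 - v^n \<le> n (1 - v); if \<open>pgf p v \<le> v\<close>, they sum to at most 0, so all
  vanish. Strictness for \<open>n \<ge> 2\<close> then leaves mass on 0 and 1 only, where the mean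
  is \<open>1 - pmf p 0\<close>, below 1, and the sum cannot vanish.\<close>

lemma pgf_gt:
  assumes D: "(\<lambda>n. real n * pmf p n) sums D" "D \<le> 1" and p0: "pmf p 0 > 0"
    and v: "-1 \<le> v" "v < 1"
  shows "v < pgf p v"
proof (rule ccontr)
  assume "\<not> v < pgf p v"
  define w where "w n = pmf p n * (real n * (1 - v) - (1 - v ^ n))" for n
  have w_nonneg: "w n \<ge> 0" for n
    using one_minus_power_le[of v n] v by (auto simp: w_def intro!: mult_nonneg_nonneg)
  have "(\<lambda>n. (1 - v) * (real n * pmf p n) - (pmf p n - pmf p n * v ^ n)) sums
      ((1 - v) * D - (1 - pgf p v))"
    using v by (intro sums_diff sums_mult D pmf_nat_sums pgf_sums) auto
  then have w_sums: "w sums ((1 - v) * D - (1 - pgf p v))"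
    by (simp add: w_def[abs_def] algebra_simps)
  have "(1 - v) * D \<le> (1 - v) * 1" using D v by (intro mult_left_mono) auto
  then have le: "(1 - v) * D - (1 - pgf p v) \<le> 0"
    using \<open>\<not> v < pgf p v\<close> by simp
  have S: "suminf w = (1 - v) * D - (1 - pgf p v)"
    using w_sums by (rule sums_unique[symmetric])
  have "0 \<le> suminf w"
    by (rule suminf_nonneg[OF sums_summable[OF w_sums] w_nonneg])
  then have "suminf w = 0" using le S by (metis antisym)
  then have eq: "(1 - v) * D = 1 - pgf p v" using S by simp
  note \<open>suminf w = 0\<close>
  then have w0: "w n = 0" for n
    using suminf_eq_zero_iff[OF sums_summable[OF w_sums] w_nonneg] by simp
  have "pmf p n = 0" if "n \<ge> 2" for n
  proof -
    have "(\<Sum>k<n. v ^ k) < (\<Sum>k<n. 1)"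
    proof (rule sum_strict_mono_ex1)
      show "\<forall>k\<in>{..<n}. v ^ k \<le> 1"
      proof
        show "v ^ k \<le> 1" for k
          using power_le_one[of "\<bar>v\<bar>" k] v power_abs[of v k] by linarith
      qed
      show "\<exists>k\<in>{..<n}. v ^ k < 1" using v that by (intro bexI[of _ 1]) auto
    qed auto
    then have "(1 - v) * (\<Sum>k<n. v ^ k) < (1 - v) * real n"
      using v by (intro mult_strict_left_mono) auto
    then have "real n * (1 - v) - (1 - v ^ n) > 0"
      by (simp add: one_diff_power_eq mult.commute)
    then show ?thesis using w0[of n] by (auto simp: w_def)
  qed
  then have "D = 1 - pmf p 0" by (rule pmf_eq_0_if_le_1[OF D(1)])
  then have "(1 - v) * D < (1 - v) * 1"
    using p0 v by (intro mult_strict_left_mono) auto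
  then show False using eq \<open>\<not> v < pgf p v\<close> by simp
qed

lemma pgf_iterates_bound: "\<bar>u\<bar> \<le> 1 \<Longrightarrow> \<bar>(pgf p ^^ L) u\<bar> \<le> 1"
  by (induction L) (auto simp: pgf_abs_le)

text \<open>By \<open>pgf_gt\<close> the orbit is nondecreasing and 1 is the only fixed point in
  [-1, 1]; by continuity the limit of the orbit is a fixed point.\<close>

lemma pgf_iterates_tendsto_1:
  assumes D: "(\<lambda>n. real n * pmf p n) sums D" "D \<le> 1" and p0: "pmf p 0 > 0"
    and cont: "continuous_on {-1..1} (pgf p)" and u: "\<bar>u\<bar> \<le> 1"
  shows "(\<lambda>L. (pgf p ^^ L) u) \<longlonglongrightarrow> 1"
proof -
  define v where "v L = (pgf p ^^ L) u" for L
  have v: "\<bar>v L\<bar> \<le> 1" for L using pgf_iterates_bound[OF u] by (simp add: v_def)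
  have vSuc: "v (Suc L) = pgf p (v L)" for L by (simp add: v_def)
  have "incseq v"
  proof (rule incseq_SucI)
    show "v L \<le> v (Suc L)" for L
      using pgf_gt[OF D p0, of "v L"] v[of L] by (cases "v L = 1") (auto simp: vSuc abs_le_iff)
  qed
  then obtain c where c: "v \<longlonglongrightarrow> c"
    using v incseq_convergent[of v 1] by (metis abs_le_D1)
  have c1: "c \<in> {-1..1}"
    by (rule closed_sequentially[OF closed_atLeastAtMost _ c]) (use v in \<open>auto simp: abs_le_iff minus_le_iff\<close>)
  have "(\<lambda>L. pgf p (v L)) \<longlonglongrightarrow> pgf p c"
    using cont c c1 v by (intro continuous_on_tendsto_compose[OF cont c]) (auto simp: abs_le_iff minus_le_iff)
  moreover have "(\<lambda>L. pgf p (v L)) \<longlonglongrightarrow> c"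
    using LIMSEQ_Suc[OF c] by (simp add: vSuc)
  ultimately have "pgf p c = c" using LIMSEQ_unique by blast
  then have "c = 1" using pgf_gt[OF D p0, of c] c1 by fastforce
  then show ?thesis using c by (simp add: v_def[abs_def])
qed

text \<open>Near 1 the slope exceeds 1, so 1 repels: if the orbit of 0 approached 1, it would be
  nonincreasing from some time on and stay below a value less than 1. The starting point 0 is the
  inner product of two orthogonal points of the sphere.\<close>

lemma pgf_iterates_not_tendsto_1:
  assumes D: "(\<lambda>n. real n * pmf p n) sums D" "D > 1"
    and deriv: "(pgf p has_real_derivative D) (at 1 within {-1..1})"
  shows "\<not> (\<lambda>L. (pgf p ^^ L) 0) \<longlonglongrightarrow> 1"
proof
  assume lim: "(\<lambda>L. (pgf p ^^ L) 0) \<longlonglongrightarrow> 1"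
  define v where "v L = (pgf p ^^ L) 0" for L
  have vSuc: "v (Suc L) = pgf p (v L)" for L by (simp add: v_def)
  \<comment> \<open>Mass outside 0 keeps the orbit strictly below 1, so the difference quotient at 1
    makes sense along it.\<close>
  have "\<exists>m\<ge>1. pmf p m > 0"
  proof (rule ccontr)
    assume *: "\<not> (\<exists>m\<ge>1. pmf p m > 0)"
    have "real n * pmf p n = 0" for n
    proof (cases "n \<ge> 1")
      case True
      then have "\<not> pmf p n > 0" using * by blast
      then show ?thesis using pmf_nonneg[of p n] by simp
    qed simp
    then have "(\<lambda>n. 0) sums D" using D(1) by presburger
    then have "D = 0" using sums_unique2[OF sums_zero] by metis
    then show False using D(2) by simp
  qed
  then obtain m where m: "m \<ge> 1" "pmf p m > 0" by blast
  have v: "0 \<le> v L \<and> v L < 1" for L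
  proof (induction L)
    case 0
    then show ?case by (simp add: v_def)
  next
    case (Suc L)
    have sums: "(\<lambda>n. pmf p n * (1 - v L ^ n)) sums (1 - pgf p (v L))"
      using sums_diff[OF pmf_nat_sums[of p] pgf_sums[of "v L" p]] Suc by (simp add: algebra_simps)
    have "0 < suminf (\<lambda>n. pmf p n * (1 - v L ^ n))"
    proof (rule suminf_pos2[OF sums_summable[OF sums]])
      have "v L ^ m \<le> v L" using power_decreasing[of 1 m "v L"] m Suc by simp
      then show "0 < pmf p m * (1 - v L ^ m)"
        using m Suc by (intro mult_pos_pos) auto
      show "0 \<le> pmf p n * (1 - v L ^ n)" for n
        using Suc by (intro mult_nonneg_nonneg) (auto simp: power_le_one)
    qed
    then have "pgf p (v L) < 1" using sums_unique[OF sums] by simp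
    moreover have "pgf p (v L) \<ge> 0"
      using sums_summable[OF pgf_sums[of "v L" p]] Suc unfolding pgf_def
      by (intro suminf_nonneg) auto
    ultimately show ?case by (simp add: vSuc)
  qed
  have "((\<lambda>u. (pgf p u - pgf p 1) / (u - 1)) \<longlongrightarrow> D) (at 1 within {-1..1})"
    using deriv by (simp add: has_field_derivative_iff)
  moreover have "filterlim v (at 1 within {-1..1}) sequentially"
    unfolding filterlim_at
  proof
    show "\<forall>\<^sub>F L in sequentially. v L \<in> {-1..1} \<and> v L \<noteq> 1"
    proof (rule always_eventually, rule allI)
      show "v L \<in> {-1..1} \<and> v L \<noteq> 1" for L using v[of L] by auto
    qed
    show "v \<longlonglongrightarrow> 1" using lim by (simp add: v_def[abs_def])
  qed
  ultimately have "(\<lambda>L. (pgf p (v L) - pgf p 1) / (v L - 1)) \<longlonglongrightarrow> D"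
    by (rule filterlim_compose)
  then have "\<forall>\<^sub>F L in sequentially. (pgf p (v L) - pgf p 1) / (v L - 1) > 1"
    using D(2) by (rule order_tendstoD)
  then obtain L0 where L0: "\<And>L. L \<ge> L0 \<Longrightarrow> (pgf p (v L) - pgf p 1) / (v L - 1) > 1"
    by (auto simp: eventually_at_top_linorder)
  have dec: "v (Suc L) \<le> v L" if "L \<ge> L0" for L
  proof -
    have "v L - 1 < 0" using v[of L] by simp
    then show ?thesis using L0[OF that] by (simp add: vSuc field_simps)
  qed
  have "v L \<le> v L0" if "L \<ge> L0" for L
    using that by (induction L rule: dec_induct) (auto intro: order_trans dec)
  then have "1 \<le> v L0"
    using lim by (intro LIMSEQ_le_const2[of v 1 "v L0"]) (auto simp: v_def[abs_def])
  then show False using v[of L0] by simp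
qed

lemma binomial_moment_2_pos:
  assumes D: "(\<lambda>n. real n * pmf p n) sums D" "D \<ge> 1" and p0: "pmf p 0 > 0"
  shows "binomial_moment p 2 > 0"
proof -
  have "\<not> (\<forall>n\<ge>2. pmf p n = 0)"
    using pmf_eq_0_if_le_1[OF D(1)] D(2) p0 by auto
  then obtain n where n: "n \<ge> 2" "pmf p n \<noteq> 0" by auto
  show ?thesis
  proof (rule ccontr)
    assume "\<not> ?thesis"
    then have "AE k in measure_pmf p. of_nat (k choose 2) = (0::ennreal)"
      unfolding binomial_moment_def by (subst nn_integral_0_iff_AE[symmetric]) auto
    then have "of_nat (n choose 2) = (0::ennreal)"
      using n by (auto simp: AE_measure_pmf_iff set_pmf_iff)
    then show False using n by (simp add: binomial_eq_0_iff)
  qed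
qed

section \<open>Growth of the moments of the generations\<close>

definition branching_moment :: "nat pmf \<Rightarrow> nat \<Rightarrow> nat \<Rightarrow> real" where
  "branching_moment p j L = enn2real (binomial_moment (branching_pmf p L) j)"

context
  fixes p :: "nat pmf" and s :: nat and D :: real
  assumes fin: "\<And>j. j \<le> s \<Longrightarrow> binomial_moment p j < \<infinity>"
    and D: "(\<lambda>n. real n * pmf p n) sums D" and p0: "pmf p 0 > 0"
begin

lemma mean_nonneg: "D \<ge> 0"
  using suminf_nonneg[OF sums_summable[OF D]] sums_unique[OF D] by simp

lemma branching_moment_eq:
  "1 \<le> j \<Longrightarrow> j \<le> s \<Longrightarrow> branching_moment p j L = fps_iter (moment_fps s p) L $ j"
  by (simp add: branching_moment_def binomial_moment_branching_pmf[OF fin] fps_iter_nonneg moment_fps_nonneg)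

lemma binomial_moment_branching_finite:
  "1 \<le> j \<Longrightarrow> j \<le> s \<Longrightarrow> binomial_moment (branching_pmf p L) j = ennreal (branching_moment p j L)"
  by (simp add: branching_moment_eq binomial_moment_branching_pmf[OF fin])

lemma moment_fps_1: "1 \<le> s \<Longrightarrow> moment_fps s p $ 1 = D"
  using binomial_moment_1[OF D] mean_nonneg by (simp add: moment_fps_def)

lemma moment_fps_2:
  assumes "D \<ge> 1" "2 \<le> s"
  shows "moment_fps s p $ 2 > 0"
  using binomial_moment_2_pos[OF D assms(1) p0] fin[OF assms(2)] assms
  by (simp add: moment_fps_def enn2real_positive_iff)

lemma branching_moment_1: "1 \<le> s \<Longrightarrow> branching_moment p 1 L = D ^ L"
  using fps_iter_nth_1[of "moment_fps s p" L] moment_fps_1 by (simp add: branching_moment_eq)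

lemma branching_moment_subcritical:
  assumes "D < 1" "1 \<le> j" "j \<le> s"
  shows "\<exists>C. \<forall>L\<ge>1. branching_moment p j L \<le> C * D ^ L"
proof (cases "D = 0")
  case True
  \<comment> \<open>Mean 0: the offspring law is the point mass at 0 and the process dies at once.
    The case stands apart because the coefficients cannot be normalised by powers of
    \<open>D\<close>.\<close>
  have z: "pmf p n = 0" if "n \<ge> 1" for n
  proof -
    have "real n * pmf p n = 0"
      using suminf_eq_zero_iff[OF sums_summable[OF D]] sums_unique[OF D] True by simp
    then show ?thesis using that by simp
  qed
  have K: "moment_fps s p = 0"
  proof (rule fps_ext)
    fix i
    have "binomial_moment p i = 0" if "i \<ge> 1"
    proof -
      have "AE k in measure_pmf p. of_nat (k choose i) = (0::ennreal)"
      proof (rule AE_pmfI)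
        fix k assume "k \<in> set_pmf p"
        then have "k = 0" using z[of k] by (cases k) (auto simp: set_pmf_iff)
        then show "of_nat (k choose i) = (0::ennreal)" using that by (simp add: binomial_eq_0)
      qed
      then show ?thesis unfolding binomial_moment_def by (subst nn_integral_0_iff_AE) auto
    qed
    then show "moment_fps s p $ i = 0 $ i" by (simp add: moment_fps_def)
  qed
  have "branching_moment p j L = 0" if "L \<ge> 1" for L
    using that assms by (cases L) (simp_all add: branching_moment_eq K)
  then show ?thesis by (auto simp: True power_0_left)
next
  case False
  then have pos: "D > 0" using mean_nonneg by simp
  have K1: "moment_fps s p $ 1 = D" using assms moment_fps_1 by simp
  obtain e where "(\<lambda>L. fps_iter (moment_fps s p) L $ j / D ^ L) \<longlonglongrightarrow> e"
    using fps_iter_subcritical[of "moment_fps s p" j, unfolded K1] pos assms moment_fps_0 by blast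
  then have "Bseq (\<lambda>L. fps_iter (moment_fps s p) L $ j / D ^ L)"
    by (intro convergent_imp_Bseq) (auto simp: convergent_def)
  then obtain C where C: "\<And>L. \<bar>fps_iter (moment_fps s p) L $ j / D ^ L\<bar> \<le> C"
    by (auto simp: Bseq_def)
  have "branching_moment p j L \<le> C * D ^ L" for L
  proof -
    have "fps_iter (moment_fps s p) L $ j / D ^ L \<le> C" using C[of L] by linarith
    then show ?thesis using pos assms by (simp add: branching_moment_eq divide_le_eq)
  qed
  then show ?thesis by blast
qed

lemma branching_moment_critical:
  assumes "D = 1" "1 \<le> j" "j \<le> s"
  shows "\<exists>e>0. (\<lambda>L. branching_moment p j L / real L ^ (j - 1)) \<longlonglongrightarrow> e"
\<comment> \<open>For \<open>j = 1\<close> the moment is exactly \<open>D ^ L\<close>. The case is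
  kept apart because \<open>moment_fps_2\<close> asks for \<open>2 \<le> s\<close>, while
  \<open>s\<close> may be 1.\<close>
proof (cases "j = 1")
  case True
  then show ?thesis using branching_moment_1 assms by (intro exI[of _ 1]) auto
next
  case False
  then show ?thesis
    using fps_iter_critical[OF moment_fps_0 _ moment_fps_nonneg, of s p j] moment_fps_1 moment_fps_2 assms
    unfolding branching_moment_eq[OF assms(2,3)] by simp
qed

lemma branching_moment_supercritical:
  assumes "D > 1" "1 \<le> j" "j \<le> s"
  shows "\<exists>e>0. (\<lambda>L. branching_moment p j L / D ^ (j * L)) \<longlonglongrightarrow> e"
proof (cases "j = 1")
  case True
  then show ?thesis using branching_moment_1 assms by (intro exI[of _ 1]) auto
next
  case False
  then show ?thesis
    using fps_iter_supercritical[OF moment_fps_0 _ moment_fps_nonneg, of s p j] moment_fps_1 moment_fps_2 assms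
    unfolding branching_moment_eq[OF assms(2,3)] by simp
qed

end


section \<open>Legendre polynomials\<close>

text \<open>Legendre polynomials of dimension \<open>d + 1\<close>, normalised to the value 1 at 1.\<close>

fun legendre :: "real \<Rightarrow> nat \<Rightarrow> real poly" where
  "legendre d 0 = 1"
| "legendre d (Suc 0) = [:0, 1:]"
| "legendre d (Suc (Suc l)) = smult (1 / (real l + d))
     (smult (2 * real l + d + 1) ([:0, 1:] * legendre d (Suc l)) - smult (real l + 1) (legendre d l))"

context
  fixes d :: real
  assumes d: "d \<ge> 2"
begin

text \<open>The recursion in a form that also covers \<open>k = 0\<close>, where the truncated index
  \<open>k - 1\<close> is multiplied by 0.\<close>

lemma legendre_rec:
  "smult (real k + d - 1) (legendre d (Suc k)) =
     smult (2 * real k + d - 1) ([:0, 1:] * legendre d k) - smult (real k) (legendre d (k - 1))"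
  using d by (cases k) (auto simp: algebra_simps)

lemma poly_legendre_rec:
  "(real k + d - 1) * poly (legendre d (Suc k)) u =
     (2 * real k + d - 1) * (u * poly (legendre d k) u) - real k * poly (legendre d (k - 1)) u"
  using arg_cong[OF legendre_rec[of k], of "\<lambda>p. poly p u"] by simp

lemma poly_pderiv_legendre_rec:
  "(real k + d - 1) * poly (pderiv (legendre d (Suc k))) u =
     (2 * real k + d - 1) * (poly (legendre d k) u + u * poly (pderiv (legendre d k)) u)
       - real k * poly (pderiv (legendre d (k - 1))) u"
  using arg_cong[OF legendre_rec[of k], of "\<lambda>p. poly (pderiv p) u"]
  by (simp add: pderiv_smult pderiv_mult pderiv_diff pderiv_pCons algebra_simps)

lemma poly_pderiv2_legendre_rec:
  "(real k + d - 1) * poly (pderiv (pderiv (legendre d (Suc k)))) u =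
     (2 * real k + d - 1) * (2 * poly (pderiv (legendre d k)) u + u * poly (pderiv (pderiv (legendre d k))) u)
       - real k * poly (pderiv (pderiv (legendre d (k - 1)))) u"
  using arg_cong[OF legendre_rec[of k], of "\<lambda>p. poly (pderiv (pderiv p)) u"]
  by (simp add: pderiv_smult pderiv_mult pderiv_diff pderiv_add pderiv_pCons algebra_simps)

lemma poly_legendre_1 [simp]: "poly (legendre d l) 1 = 1"
proof (induction l rule: less_induct)
  case (less l)
  show ?case
  proof (cases l)
    case (Suc k)
    have "(real k + d - 1) * poly (legendre d (Suc k)) 1 = real k + d - 1"
      using less[of k] less[of "k - 1"] poly_legendre_rec[of k 1] Suc by simp
    then show ?thesis using d Suc by simp
  qed simp
qed

text \<open>This removes the first derivative left over when the recursion is differentiated twice,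
  in the induction for the differential equation.\<close>

lemma legendre_deriv_identity:
  "(1 - u\<^sup>2) * poly (pderiv (legendre d l)) u =
     real l * (poly (legendre d (l - 1)) u - u * poly (legendre d l) u)"
proof (induction l rule: less_induct)
  case (less l)
  show ?case
  proof (cases l)
    case (Suc k)
    define w where "w = real k + d - 1"
    have w: "w \<noteq> 0" using d by (simp add: w_def)
    define p where "p j = poly (legendre d j) u" for j
    define q where "q j = poly (pderiv (legendre d j)) u" for j
    have 1: "(1 - u\<^sup>2) * q k = real k * (p (k - 1) - u * p k)"
      and 2: "(1 - u\<^sup>2) * q (k - 1) = (real k - 1) * (p (k - 2) - u * p (k - 1))" if "k > 0"
      using less[of k] less[of "k - 1"] Suc that by (auto simp: p_def q_def of_nat_diff numeral_2_eq_2)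
    have 1: "(1 - u\<^sup>2) * q k = real k * (p (k - 1) - u * p k)"
      using 1 by (cases "k = 0") (auto simp: p_def q_def)
    \<comment> \<open>The factor \<open>real k\<close> makes the identity trivial for
      \<open>k = 0\<close>, where the indices \<open>k - 1\<close> and \<open>k - 2\<close> are
      truncated.\<close>
    have 2: "real k * ((1 - u\<^sup>2) * q (k - 1)) = real k * ((real k - 1) * (p (k - 2) - u * p (k - 1)))"
      using 2 by (cases "k = 0") auto
    have 3: "w * p (Suc k) = (2 * real k + d - 1) * (u * p k) - real k * p (k - 1)"
      unfolding w_def p_def by (rule poly_legendre_rec)
    have 4: "w * q (Suc k) = (2 * real k + d - 1) * (p k + u * q k) - real k * q (k - 1)"
      unfolding w_def p_def q_def by (rule poly_pderiv_legendre_rec)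
    have 5: "real k * ((w - 1) * p k) = real k * ((2 * real k + d - 3) * (u * p (k - 1)) - (real k - 1) * p (k - 2))"
    proof (cases k)
      case (Suc m)
      have "(w - 1) * p k = (2 * real k + d - 3) * (u * p (k - 1)) - (real k - 1) * p (k - 2)"
        using poly_legendre_rec[of m u] unfolding w_def p_def Suc
        by (simp add: algebra_simps numeral_2_eq_2)
      then show ?thesis by simp
    qed simp
    have "w * ((1 - u\<^sup>2) * q (Suc k)) = (1 - u\<^sup>2) * (w * q (Suc k))" by simp
    also have "\<dots> = (2 * real k + d - 1) * ((1 - u\<^sup>2) * p k + u * ((1 - u\<^sup>2) * q k))
        - real k * ((1 - u\<^sup>2) * q (k - 1))"
      unfolding 4 by (simp add: algebra_simps)
    also have "\<dots> = (2 * real k + d - 1) * ((1 - u\<^sup>2) * p k + u * (real k * (p (k - 1) - u * p k)))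
        - real k * ((real k - 1) * (p (k - 2) - u * p (k - 1)))"
      unfolding 1 2 ..
    also have "\<dots> = (2 * real k + d - 1) * ((1 - u\<^sup>2) * p k + u * (real k * (p (k - 1) - u * p k)))
        + real k * ((real k - 1) * u * p (k - 1)) + real k * ((w - 1) * p k) - real k * ((2 * real k + d - 3) * (u * p (k - 1)))"
      unfolding 5 by (simp add: algebra_simps)
    also have "\<dots> = w * (real k + 1) * p k - (real k + 1) * u * ((2 * real k + d - 1) * (u * p k) - real k * p (k - 1))"
      by (simp add: w_def algebra_simps power2_eq_square)
    also have "\<dots> = w * (real (Suc k) * (p k - u * p (Suc k)))"
      unfolding 3[symmetric] by (simp add: algebra_simps)
    finally show ?thesis using w Suc by (simp add: p_def q_def)
  qed simp
qed

text \<open>The spherical Laplacian \<open>-\<Delta>\<close> on functions of \<open>\<langle>x, \<cdot>\<rangle>\<close>.\<close>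

definition zonal_op :: "real poly \<Rightarrow> real poly" where
  "zonal_op p = [:-1, 0, 1:] * pderiv (pderiv p) + [:0, d:] * pderiv p"

lemma zonal_op_add: "zonal_op (p + q) = zonal_op p + zonal_op q"
  and zonal_op_smult: "zonal_op (smult c p) = smult c (zonal_op p)"
  by (intro poly_eq_poly_eq_iff[THEN iffD1] ext;
      simp add: zonal_op_def pderiv_add pderiv_smult algebra_simps)+

lemma zonal_op_sum: "zonal_op (\<Sum>i\<in>A. f i) = (\<Sum>i\<in>A. zonal_op (f i))"
  by (induction A rule: infinite_finite_induct) (auto simp: zonal_op_add, auto simp: zonal_op_def)

text \<open>The Gegenbauer differential equation. Applying the operator to the three-term recursion
  leaves, besides the two induction hypotheses, a multiple of 1 - u^2 times the first derivative,
  which \<open>legendre_deriv_identity\<close> resolves.\<close>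

lemma zonal_op_legendre:
  "zonal_op (legendre d l) = smult (real l * (real l + d - 1)) (legendre d l)"
proof -
  have "(u\<^sup>2 - 1) * poly (pderiv (pderiv (legendre d l))) u + d * u * poly (pderiv (legendre d l)) u
      = real l * (real l + d - 1) * poly (legendre d l) u" for u
  proof (induction l rule: less_induct)
    case (less l)
    show ?case
    proof (cases l)
      case (Suc k)
      define w where "w = real k + d - 1"
      have w: "w \<noteq> 0" using d by (simp add: w_def)
      define p where "p j = poly (legendre d j) u" for j
      define q where "q j = poly (pderiv (legendre d j)) u" for j
      define s where "s j = poly (pderiv (pderiv (legendre d j))) u" for j
      have 1: "(u\<^sup>2 - 1) * s k + d * u * q k = real k * (real k + d - 1) * p k"
        using less[of k] Suc by (simp add: p_def q_def s_def)
      have 2: "real k * ((u\<^sup>2 - 1) * s (k - 1) + d * u * q (k - 1)) =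
          real k * ((real k - 1) * (real k + d - 2) * p (k - 1))"
        using less[of "k - 1"] Suc
        by (cases k) (auto simp: p_def q_def s_def)
      have 3: "(1 - u\<^sup>2) * q k = real k * (p (k - 1) - u * p k)"
        unfolding p_def q_def by (rule legendre_deriv_identity)
      have 4: "w * p (Suc k) = (2 * real k + d - 1) * (u * p k) - real k * p (k - 1)"
        unfolding w_def p_def by (rule poly_legendre_rec)
      have 5: "w * q (Suc k) = (2 * real k + d - 1) * (p k + u * q k) - real k * q (k - 1)"
        unfolding w_def p_def q_def by (rule poly_pderiv_legendre_rec)
      have 6: "w * s (Suc k) = (2 * real k + d - 1) * (2 * q k + u * s k) - real k * s (k - 1)"
        unfolding w_def s_def q_def by (rule poly_pderiv2_legendre_rec)
      have "w * ((u\<^sup>2 - 1) * s (Suc k) + d * u * q (Suc k)) =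
          (u\<^sup>2 - 1) * (w * s (Suc k)) + d * u * (w * q (Suc k))"
        by (simp add: algebra_simps)
      also have "\<dots> = (2 * real k + d - 1) * (u * ((u\<^sup>2 - 1) * s k + d * u * q k) - 2 * ((1 - u\<^sup>2) * q k) + d * u * p k)
          - real k * ((u\<^sup>2 - 1) * s (k - 1) + d * u * q (k - 1))"
        unfolding 5 6 by (simp add: algebra_simps)
      also have "\<dots> = (2 * real k + d - 1) * (u * (real k * (real k + d - 1) * p k) -
           2 * (real k * (p (k - 1) - u * p k)) + d * u * p k)
          - real k * ((real k - 1) * (real k + d - 2) * p (k - 1))"
        unfolding 1 2 3 ..
      also have "\<dots> = (real k + 1) * (real k + d) * ((2 * real k + d - 1) * (u * p k) - real k * p (k - 1))"
        by (simp add: algebra_simps)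
      also have "\<dots> = w * ((real k + 1) * (real k + d) * p (Suc k))"
        unfolding 4[symmetric] by simp
      finally have "(u\<^sup>2 - 1) * s (Suc k) + d * u * q (Suc k) = (real k + 1) * (real k + d) * p (Suc k)"
        using w by simp
      then show ?thesis using Suc by (simp add: p_def q_def s_def algebra_simps)
    qed simp
  qed
  then show ?thesis
    by (intro poly_eq_poly_eq_iff[THEN iffD1] ext)
       (simp add: zonal_op_def algebra_simps power2_eq_square)
qed

text \<open>Solved for the product, the recursion writes \<open>u\<close> times the
  \<open>l\<close>-th polynomial as a combination of its two neighbours with nonnegative weights.
  Multiplication by \<open>u\<close> thus preserves nonnegativity of the coefficients.\<close>

lemma monomial_legendre_expansion:
  "\<exists>b. (\<forall>l. b l \<ge> 0) \<and> (\<forall>l>k. b l = 0) \<and> monom 1 k = (\<Sum>l\<le>k. smult (b l) (legendre d l))"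
proof (induction k)
  case 0
  show ?case by (intro exI[of _ "\<lambda>l. if l = 0 then 1 else 0"]) (auto simp: monom_0)
next
  case (Suc k)
  then obtain b where b: "\<And>l. b l \<ge> 0" "\<And>l. l > k \<Longrightarrow> b l = 0"
    and eq: "monom 1 k = (\<Sum>l\<le>k. smult (b l) (legendre d l))" by blast
  define up where "up l = b l * (real l + d - 1) / (2 * real l + d - 1)" for l
  define down where "down l = b l * real l / (2 * real l + d - 1)" for l
  have pos: "2 * real l + d - 1 > 0" "real l + d - 1 > 0" for l using d by auto
  have step: "[:0, 1:] * smult (b l) (legendre d l) =
      smult (up l) (legendre d (Suc l)) + smult (down l) (legendre d (l - 1))" for l
  proof -
    have "smult (2 * real l + d - 1) ([:0, 1:] * legendre d l) =
        smult (real l + d - 1) (legendre d (Suc l)) + smult (real l) (legendre d (l - 1))"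
      using legendre_rec[of l] by simp
    then have "smult (b l / (2 * real l + d - 1)) (smult (2 * real l + d - 1) ([:0, 1:] * legendre d l)) =
        smult (b l / (2 * real l + d - 1)) (smult (real l + d - 1) (legendre d (Suc l)) + smult (real l) (legendre d (l - 1)))"
      by simp
    then show ?thesis
      using pos[of l] by (simp add: smult_add_right up_def down_def del: pCons_0_0 mult_pCons_left)
  qed
  define b' where "b' l = (if l = 0 then 0 else up (l - 1)) + down (Suc l)" for l
  have "monom 1 (Suc k) = [:0, 1:] * (monom 1 k :: real poly)"
    by (simp add: monom_Suc)
  also have "\<dots> = (\<Sum>l\<le>k. smult (up l) (legendre d (Suc l))) + (\<Sum>l\<le>k. smult (down l) (legendre d (l - 1)))"
    unfolding eq sum_distrib_left step by (simp add: sum.distrib)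
  also have "(\<Sum>l\<le>k. smult (up l) (legendre d (Suc l))) =
      (\<Sum>l\<le>Suc k. smult (if l = 0 then 0 else up (l - 1)) (legendre d l))"
    by (subst sum.atMost_Suc_shift) simp
  \<comment> \<open>The added terms vanish because \<open>b\<close> is 0 above \<open>k\<close>; the
    shift that follows drops \<open>l = 0\<close>, where \<open>down\<close> is 0.\<close>
  also have "(\<Sum>l\<le>k. smult (down l) (legendre d (l - 1))) = (\<Sum>l\<le>Suc (Suc k). smult (down l) (legendre d (l - 1)))"
    using b(2) by (simp add: down_def)
  also have "\<dots> = (\<Sum>l\<le>Suc k. smult (down (Suc l)) (legendre d l))"
    by (subst sum.atMost_Suc_shift) (simp add: down_def)
  finally have "monom 1 (Suc k) = (\<Sum>l\<le>Suc k. smult (b' l) (legendre d l))"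
    by (simp add: b'_def smult_add_left sum.distrib)
  moreover have "b' l \<ge> 0" for l
  proof -
    have "up m \<ge> 0" "down m \<ge> 0" for m
      unfolding up_def down_def using b(1)[of m] pos[of m]
      by (auto intro!: divide_nonneg_pos mult_nonneg_nonneg)
    then show ?thesis by (auto simp: b'_def intro!: add_nonneg_nonneg)
  qed
  moreover have "b' l = 0" if "l > Suc k" for l
    using that b(2) by (auto simp: b'_def up_def down_def)
  ultimately show ?case by blast
qed

definition legendre_coeff :: "nat \<Rightarrow> nat \<Rightarrow> real" where
  "legendre_coeff k = (SOME b. (\<forall>l. b l \<ge> 0) \<and> (\<forall>l>k. b l = 0) \<and>
     monom 1 k = (\<Sum>l\<le>k. smult (b l) (legendre d l)))"

lemma legendre_coeff:
  shows legendre_coeff_nonneg: "legendre_coeff k l \<ge> 0"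
    and legendre_coeff_eq_0: "l > k \<Longrightarrow> legendre_coeff k l = 0"
    and monom_eq_legendre: "monom 1 k = (\<Sum>l\<le>k. smult (legendre_coeff k l) (legendre d l))"
  using someI_ex[OF monomial_legendre_expansion[of k]] unfolding legendre_coeff_def[symmetric]
  by blast+

lemma power_eq_legendre: "u ^ k = (\<Sum>l\<le>k. legendre_coeff k l * poly (legendre d l) u)"
  using arg_cong[OF monom_eq_legendre[of k], of "\<lambda>p. poly p u"]
  by (simp add: poly_monom poly_sum)

lemma sum_legendre_coeff: "(\<Sum>l\<le>k. legendre_coeff k l) = 1"
  using power_eq_legendre[of 1 k] by simp

text \<open>Row \<open>r\<close> expresses the value at 1 of the \<open>r\<close>-fold
  \<open>zonal_op\<close> through derivatives at 1 of order at most \<open>r\<close>. At 1 the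
  \<open>j\<close>-th derivative of \<open>zonal_op p\<close> is 2 j + d times derivative
  \<open>j + 1\<close> plus j (j - 1 + d) times derivative \<open>j\<close> of \<open>p\<close>; the
  recursion is the transpose of this rule.\<close>

fun zonal_weight :: "nat \<Rightarrow> nat \<Rightarrow> real" where
  "zonal_weight 0 j = (if j = 0 then 1 else 0)"
| "zonal_weight (Suc r) j =
     (if j = 0 then 0 else (2 * (real j - 1) + d) * zonal_weight r (j - 1)) +
     real j * (real j - 1 + d) * zonal_weight r j"

lemma zonal_weight_nonneg: "zonal_weight r j \<ge> 0"
proof (induction r arbitrary: j)
  case (Suc r)
  show ?case
  proof (cases j)
    case (Suc i)
    then show ?thesis using d \<open>\<And>j. zonal_weight r j \<ge> 0\<close> by (auto intro!: add_nonneg_nonneg mult_nonneg_nonneg)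
  qed simp
qed simp

lemma zonal_weight_eq_0: "j > r \<Longrightarrow> zonal_weight r j = 0"
  by (induction r arbitrary: j) auto

lemma zonal_weight_0: "r \<ge> 1 \<Longrightarrow> zonal_weight r 0 = 0"
  by (cases r) auto

lemma zonal_weight_diag_pos: "zonal_weight r r > 0"
  by (induction r) (use d in \<open>auto simp: zonal_weight_eq_0 intro!: mult_pos_pos\<close>)

lemma higher_pderiv_zonal_op:
  "(pderiv ^^ j) (zonal_op p) = [:-1, 0, 1:] * (pderiv ^^ (j + 2)) p +
     [:0, 2 * real j + d:] * (pderiv ^^ Suc j) p + smult (real j * (real j - 1 + d)) ((pderiv ^^ j) p)"
proof (induction j)
  case 0
  then show ?case by (simp add: zonal_op_def numeral_2_eq_2)
next
  case (Suc j)
  have "pderiv ([:-1, 0, 1:] * q) = [:0, 2:] * q + [:-1, 0, 1:] * pderiv q" for q :: "real poly"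
    unfolding pderiv_mult by (simp add: pderiv_pCons)
  moreover have "pderiv ([:0, a:] * q) = smult a q + [:0, a:] * pderiv q" for q :: "real poly" and a
    by (simp add: pderiv_pCons pderiv_smult)
  ultimately have eq: "(pderiv ^^ Suc j) (zonal_op p) =
      [:0, 2:] * (pderiv ^^ (j + 2)) p + [:-1, 0, 1:] * (pderiv ^^ (j + 3)) p +
      (smult (2 * real j + d) ((pderiv ^^ Suc j) p) + [:0, 2 * real j + d:] * (pderiv ^^ (j + 2)) p) +
      smult (real j * (real j - 1 + d)) ((pderiv ^^ Suc j) p)"
    by (simp only: funpow.simps o_apply Suc pderiv_add pderiv_smult numeral_2_eq_2 numeral_3_eq_3 add_Suc_right add_0_right)
  show ?case
    unfolding eq by (intro poly_eq_poly_eq_iff[THEN iffD1] ext)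
       (simp add: numeral_2_eq_2 numeral_3_eq_3 algebra_simps)
qed

lemma poly_zonal_op_iterate:
  "poly ((zonal_op ^^ r) p) 1 = (\<Sum>j\<le>r. zonal_weight r j * poly ((pderiv ^^ j) p) 1)"
proof (induction r arbitrary: p)
  case (Suc r)
  let ?D = "\<lambda>j. poly ((pderiv ^^ j) p) 1"
  have "poly ((zonal_op ^^ Suc r) p) 1 = poly ((zonal_op ^^ r) (zonal_op p)) 1"
    by (simp only: funpow_Suc_right o_apply)
  also have "\<dots> = (\<Sum>j\<le>r. zonal_weight r j * ((2 * real j + d) * ?D (Suc j) + real j * (real j - 1 + d) * ?D j))"
    unfolding Suc higher_pderiv_zonal_op by simp
  also have "\<dots> = (\<Sum>j\<le>r. (2 * real j + d) * zonal_weight r j * ?D (Suc j)) +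
      (\<Sum>j\<le>r. real j * (real j - 1 + d) * zonal_weight r j * ?D j)"
    unfolding sum.distrib[symmetric] by (intro sum.cong) (auto simp: algebra_simps)
  also have "(\<Sum>j\<le>r. (2 * real j + d) * zonal_weight r j * ?D (Suc j)) =
      (\<Sum>j\<le>Suc r. (if j = 0 then 0 else (2 * (real j - 1) + d) * zonal_weight r (j - 1)) * ?D j)"
    by (subst sum.atMost_Suc_shift) simp
  also have "(\<Sum>j\<le>r. real j * (real j - 1 + d) * zonal_weight r j * ?D j) =
      (\<Sum>j\<le>Suc r. real j * (real j - 1 + d) * zonal_weight r j * ?D j)"
    by (simp add: zonal_weight_eq_0)
  finally show ?case
    by (simp only: sum.distrib[symmetric] zonal_weight.simps distrib_right)
qed simp

lemma higher_pderiv_monom: "(pderiv ^^ j) (monom 1 k :: real poly) = monom (fact j * real (k choose j)) (k - j)"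
proof (induction j)
  case (Suc j)
  have "real (k - j) * real (k choose j) = real (Suc j) * real (k choose Suc j)"
    unfolding of_nat_mult[symmetric] by (metis binomial_absorb_comp binomial_absorption mult.commute)
  then show ?case
    by (simp add: Suc pderiv_monom mult_ac)
qed (simp add: monom_def)

text \<open>The \<open>r\<close>-fold operator applied to u^k is evaluated at 1 in two ways: by
  eigenvalues on the Legendre expansion, all polynomials being 1 at 1, and by the ordinary
  derivatives of u^k. Here angular frequencies turn into factorial moments.\<close>

lemma sum_legendre_coeff_eigenvalue:
  "(\<Sum>l\<le>k. (real l * (real l + d - 1)) ^ r * legendre_coeff k l) =
     (\<Sum>j\<le>r. zonal_weight r j * fact j * real (k choose j))"
proof -
  have iter: "(zonal_op ^^ r) (\<Sum>l\<le>k. smult (c l) (legendre d l)) =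
      (\<Sum>l\<le>k. smult ((real l * (real l + d - 1)) ^ r * c l) (legendre d l))" for c
    by (induction r) (simp_all add: zonal_op_sum zonal_op_smult zonal_op_legendre mult_ac)
  have "(\<Sum>l\<le>k. (real l * (real l + d - 1)) ^ r * legendre_coeff k l) =
      poly ((zonal_op ^^ r) (monom 1 k)) 1"
    unfolding monom_eq_legendre[of k] iter by (simp add: poly_sum)
  also have "\<dots> = (\<Sum>j\<le>r. zonal_weight r j * fact j * real (k choose j))"
    unfolding poly_zonal_op_iterate higher_pderiv_monom by (simp add: poly_monom mult_ac)
  finally show ?thesis .
qed

end


section \<open>Zonal harmonics\<close>

context
  fixes x :: "'a::euclidean_space" and d :: real
  assumes d: "d \<ge> 2" and dim: "real DIM('a) = d + 1" and x: "norm x = 1"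
begin

text \<open>The homogeneous extension \<open>|y|\<^sup>l P\<^sub>l(\<langle>x, y\<rangle> / |y|)\<close>, and the closed recursions satisfied by its
  first and second derivatives in the direction \<open>b\<close>.\<close>

fun solid_zonal :: "nat \<Rightarrow> 'a \<Rightarrow> real" where
  "solid_zonal 0 y = 1"
| "solid_zonal (Suc 0) y = x \<bullet> y"
| "solid_zonal (Suc (Suc l)) y = ((2 * real l + d + 1) * ((x \<bullet> y) * solid_zonal (Suc l) y)
     - (real l + 1) * ((y \<bullet> y) * solid_zonal l y)) / (real l + d)"

fun solid_zonal1 :: "'a \<Rightarrow> nat \<Rightarrow> 'a \<Rightarrow> real" where
  "solid_zonal1 b 0 y = 0"
| "solid_zonal1 b (Suc 0) y = x \<bullet> b"
| "solid_zonal1 b (Suc (Suc l)) y =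
     ((2 * real l + d + 1) * ((x \<bullet> b) * solid_zonal (Suc l) y + (x \<bullet> y) * solid_zonal1 b (Suc l) y)
     - (real l + 1) * (2 * (y \<bullet> b) * solid_zonal l y + (y \<bullet> y) * solid_zonal1 b l y)) / (real l + d)"

fun solid_zonal2 :: "'a \<Rightarrow> nat \<Rightarrow> 'a \<Rightarrow> real" where
  "solid_zonal2 b 0 y = 0"
| "solid_zonal2 b (Suc 0) y = 0"
| "solid_zonal2 b (Suc (Suc l)) y =
     ((2 * real l + d + 1) * (2 * (x \<bullet> b) * solid_zonal1 b (Suc l) y + (x \<bullet> y) * solid_zonal2 b (Suc l) y)
     - (real l + 1) * (2 * (b \<bullet> b) * solid_zonal l y + 4 * (y \<bullet> b) * solid_zonal1 b l y
        + (y \<bullet> y) * solid_zonal2 b l y)) / (real l + d)"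

lemma solid_zonal_sphere: "norm y = 1 \<Longrightarrow> solid_zonal l y = poly (legendre d l) (x \<bullet> y)"
  using d by (induction l y rule: solid_zonal.induct)
    (auto simp: algebra_simps diff_divide_distrib add_divide_distrib simp flip: power2_norm_eq_inner)

lemma solid_zonal_scale: "solid_zonal l (c *\<^sub>R y) = c ^ l * solid_zonal l y"
proof (induction l y rule: solid_zonal.induct)
  case (3 l y)
  then show ?case
    by (simp add: field_simps)
qed auto

lemma real_polynomial_function_inner_self: "real_polynomial_function (\<lambda>y::'a. y \<bullet> y)"
  unfolding euclidean_inner[of y y for y :: 'a]
  by (intro real_polynomial_function_sum real_polynomial_function.intros bounded_linear_inner_left) auto

lemma real_polynomial_function_solid_zonal: "real_polynomial_function (solid_zonal l)"
proof (induction l rule: induct_nat_012)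
  case 0
  then show ?case by (simp add: solid_zonal.simps(1)[abs_def] real_polynomial_function.intros)
next
  case 1
  then show ?case
    by (simp add: solid_zonal.simps(2)[abs_def] real_polynomial_function.intros bounded_linear_inner_right)
next
  case (ge2 k)
  have "real_polynomial_function (\<lambda>y. ((2 * real k + d + 1) * ((x \<bullet> y) * solid_zonal (Suc k) y)
     - (real k + 1) * ((y \<bullet> y) * solid_zonal k y)) * (1 / (real k + d)))"
    using ge2 real_polynomial_function_inner_self
    by (intro real_polynomial_function.intros(2-) real_polynomial_function_diff
        real_polynomial_function.intros(1)[OF bounded_linear_inner_right]) auto
  then show ?case by (simp add: solid_zonal.simps(3)[abs_def])
qed

lemma has_derivative_solid_zonal:
  "((\<lambda>t. solid_zonal l (y + t *\<^sub>R b)) has_real_derivative solid_zonal1 b l (y + t *\<^sub>R b)) (at t)"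
proof (induction l y rule: solid_zonal.induct)
  case (3 l y)
  have yy: "((\<lambda>t. (y + t *\<^sub>R b) \<bullet> (y + t *\<^sub>R b)) has_real_derivative 2 * ((y + t *\<^sub>R b) \<bullet> b)) (at t)"
    by (auto simp: inner_add_left inner_add_right algebra_simps inner_commute intro!: derivative_eq_intros)
  have xy: "((\<lambda>t. x \<bullet> (y + t *\<^sub>R b)) has_real_derivative x \<bullet> b) (at t)"
    by (auto simp: inner_add_right intro!: derivative_eq_intros)
  show ?case
    unfolding solid_zonal.simps solid_zonal1.simps
    by (rule DERIV_cong, (rule DERIV_cdivide DERIV_diff DERIV_cmult DERIV_mult xy yy 3)+)
       (simp add: algebra_simps)
next
  case (2 y)
  then show ?case by (auto simp: inner_add_right intro!: derivative_eq_intros)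
qed auto

lemma has_derivative_solid_zonal1:
  "((\<lambda>t. solid_zonal1 b l (y + t *\<^sub>R b)) has_real_derivative solid_zonal2 b l (y + t *\<^sub>R b)) (at t)"
proof (induction l y rule: solid_zonal.induct)
  case (3 l y)
  have yy: "((\<lambda>t. (y + t *\<^sub>R b) \<bullet> (y + t *\<^sub>R b)) has_real_derivative 2 * ((y + t *\<^sub>R b) \<bullet> b)) (at t)"
    by (auto simp: inner_add_left inner_add_right algebra_simps inner_commute intro!: derivative_eq_intros)
  have xy: "((\<lambda>t. x \<bullet> (y + t *\<^sub>R b)) has_real_derivative x \<bullet> b) (at t)"
    by (auto simp: inner_add_right intro!: derivative_eq_intros)
  have yb: "((\<lambda>t. (y + t *\<^sub>R b) \<bullet> b) has_real_derivative b \<bullet> b) (at t)"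
    by (auto simp: inner_add_left intro!: derivative_eq_intros)
  show ?case
    unfolding solid_zonal1.simps solid_zonal2.simps
    by (rule DERIV_cong, (rule DERIV_cdivide DERIV_diff DERIV_add DERIV_cmult DERIV_mult xy yy yb 3 has_derivative_solid_zonal)+)
       (simp add: algebra_simps)
qed auto

lemma solid_zonal_rec:
  "(real l + d) * solid_zonal (Suc (Suc l)) y = (2 * real l + d + 1) * ((x \<bullet> y) * solid_zonal (Suc l) y)
     - (real l + 1) * ((y \<bullet> y) * solid_zonal l y)"
  "(real l + d) * solid_zonal1 b (Suc (Suc l)) y =
     (2 * real l + d + 1) * ((x \<bullet> b) * solid_zonal (Suc l) y + (x \<bullet> y) * solid_zonal1 b (Suc l) y)
     - (real l + 1) * (2 * (y \<bullet> b) * solid_zonal l y + (y \<bullet> y) * solid_zonal1 b l y)"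
  "(real l + d) * solid_zonal2 b (Suc (Suc l)) y =
     (2 * real l + d + 1) * (2 * (x \<bullet> b) * solid_zonal1 b (Suc l) y + (x \<bullet> y) * solid_zonal2 b (Suc l) y)
     - (real l + 1) * (2 * (b \<bullet> b) * solid_zonal l y + 4 * (y \<bullet> b) * solid_zonal1 b l y
        + (y \<bullet> y) * solid_zonal2 b l y)"
  using d by simp_all

text \<open>Differentiation along the pole lowers the degree. This is one of the two cross terms
  when the Laplacian of the recursion is expanded; the other is Euler's identity for homogeneous
  functions, proved next.\<close>

lemma sum_inner_x_solid_zonal1: "(\<Sum>b\<in>Basis. (x \<bullet> b) * solid_zonal1 b l y) = real l * solid_zonal (l - 1) y"
proof (induction l y rule: solid_zonal.induct)
  case (2 y)
  then show ?case using x by (simp flip: euclidean_inner power2_norm_eq_inner)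
next
  case (3 l y)
  let ?S = "\<lambda>f. (\<Sum>b\<in>Basis. f b)"
  have xx: "?S (\<lambda>b. (x \<bullet> b) * (x \<bullet> b)) = 1"
    using x by (simp flip: euclidean_inner power2_norm_eq_inner)
  have xy: "?S (\<lambda>b. (x \<bullet> b) * (y \<bullet> b)) = x \<bullet> y"
    by (simp flip: euclidean_inner)
  define w where "w = real l + d"
  have w: "w \<noteq> 0" using d by (simp add: w_def)
  have "w * ?S (\<lambda>b. (x \<bullet> b) * solid_zonal1 b (Suc (Suc l)) y) =
     ?S (\<lambda>b. (2 * real l + d + 1) * (solid_zonal (Suc l) y * ((x \<bullet> b) * (x \<bullet> b)) + (x \<bullet> y) * ((x \<bullet> b) * solid_zonal1 b (Suc l) y))
     - (real l + 1) * (2 * solid_zonal l y * ((x \<bullet> b) * (y \<bullet> b)) + (y \<bullet> y) * ((x \<bullet> b) * solid_zonal1 b l y)))"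
    unfolding sum_distrib_left
    by (intro sum.cong refl)
       (simp only: mult.left_commute[of w] solid_zonal_rec[of l, folded w_def], simp add: algebra_simps)
  also have "\<dots> = (2 * real l + d + 1) * (solid_zonal (Suc l) y + (x \<bullet> y) * (real (Suc l) * solid_zonal l y))
     - (real l + 1) * (2 * solid_zonal l y * (x \<bullet> y) + (y \<bullet> y) * (real l * solid_zonal (l - 1) y))"
    unfolding sum_subtractf sum_distrib_left[symmetric] sum.distrib xx xy 3 by simp
  also have "\<dots> = w * (real (Suc (Suc l)) * solid_zonal (Suc l) y)"
  proof (cases l)
    case (Suc m)
    have "(real m + d) * solid_zonal (Suc l) y = (2 * real m + d + 1) * ((x \<bullet> y) * solid_zonal l y)
       - (real m + 1) * ((y \<bullet> y) * solid_zonal m y)"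
      using solid_zonal_rec(1)[of m y] Suc by simp
    then have "(real l + 1) * ((real m + d) * solid_zonal (Suc l) y) = (real l + 1) * ((2 * real m + d + 1) * ((x \<bullet> y) * solid_zonal l y)
       - (real m + 1) * ((y \<bullet> y) * solid_zonal m y))"
      by simp
    then show ?thesis unfolding Suc w_def by (simp add: algebra_simps del: solid_zonal.simps(3))
  qed (simp add: w_def algebra_simps)
  finally show ?case using w by (simp del: solid_zonal1.simps(3) solid_zonal2.simps(3))
qed simp

lemma sum_inner_y_solid_zonal1: "(\<Sum>b\<in>Basis. (y \<bullet> b) * solid_zonal1 b l y) = real l * solid_zonal l y"
proof (induction l y rule: solid_zonal.induct)
  case (2 y)
  then show ?case by (simp add: euclidean_inner[of x y] mult.commute)
next
  case (3 l y)
  let ?S = "\<lambda>f. (\<Sum>b\<in>Basis. f b)"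
  have yy: "?S (\<lambda>b. (y \<bullet> b) * (y \<bullet> b)) = y \<bullet> y"
    by (simp flip: euclidean_inner)
  have xy: "?S (\<lambda>b. (y \<bullet> b) * (x \<bullet> b)) = x \<bullet> y"
    by (simp add: euclidean_inner[of x y] mult.commute)
  define w where "w = real l + d"
  have w: "w \<noteq> 0" using d by (simp add: w_def)
  have "w * ?S (\<lambda>b. (y \<bullet> b) * solid_zonal1 b (Suc (Suc l)) y) =
     ?S (\<lambda>b. (2 * real l + d + 1) * (solid_zonal (Suc l) y * ((y \<bullet> b) * (x \<bullet> b)) + (x \<bullet> y) * ((y \<bullet> b) * solid_zonal1 b (Suc l) y))
     - (real l + 1) * (2 * solid_zonal l y * ((y \<bullet> b) * (y \<bullet> b)) + (y \<bullet> y) * ((y \<bullet> b) * solid_zonal1 b l y)))"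
    unfolding sum_distrib_left
    by (intro sum.cong refl)
       (simp only: mult.left_commute[of w] solid_zonal_rec[of l, folded w_def], simp add: algebra_simps)
  also have "\<dots> = (2 * real l + d + 1) * (solid_zonal (Suc l) y * (x \<bullet> y) + (x \<bullet> y) * (real (Suc l) * solid_zonal (Suc l) y))
     - (real l + 1) * (2 * solid_zonal l y * (y \<bullet> y) + (y \<bullet> y) * (real l * solid_zonal l y))"
    unfolding sum_subtractf sum_distrib_left[symmetric] sum.distrib yy xy 3 by simp
  also have "\<dots> = real (Suc (Suc l)) * ((2 * real l + d + 1) * ((x \<bullet> y) * solid_zonal (Suc l) y)
     - (real l + 1) * ((y \<bullet> y) * solid_zonal l y))"
    by (simp add: algebra_simps)
  also have "\<dots> = w * (real (Suc (Suc l)) * solid_zonal (Suc (Suc l)) y)"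
    by (simp add: solid_zonal_rec(1)[of l, folded w_def] mult.left_commute[of w] del: solid_zonal.simps(3))
  finally show ?case using w by (simp del: solid_zonal.simps(3) solid_zonal1.simps(3))
qed simp

text \<open>What remains after the induction hypotheses is (l + 1) times the solid zonal of degree
  \<open>l\<close> times 2 (2 l + d + 1) - (2 (d + 1) + 4 l). This bracket is 0 because the
  Laplacian of |y|^2 is twice the dimension d + 1.\<close>

lemma sum_solid_zonal2: "(\<Sum>b\<in>Basis. solid_zonal2 b l y) = 0"
proof (induction l y rule: solid_zonal.induct)
  case (3 l y)
  let ?S = "\<lambda>f. (\<Sum>b\<in>Basis. f b)"
  have bb: "?S (\<lambda>b::'a. b \<bullet> b) = d + 1"
    using dim by simp
  define w where "w = real l + d"
  have w: "w \<noteq> 0" using d by (simp add: w_def)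
  have "w * ?S (\<lambda>b. solid_zonal2 b (Suc (Suc l)) y) =
     ?S (\<lambda>b. (2 * real l + d + 1) * (2 * ((x \<bullet> b) * solid_zonal1 b (Suc l) y) + (x \<bullet> y) * solid_zonal2 b (Suc l) y)
     - (real l + 1) * (2 * solid_zonal l y * (b \<bullet> b) + 4 * ((y \<bullet> b) * solid_zonal1 b l y) + (y \<bullet> y) * solid_zonal2 b l y))"
    unfolding sum_distrib_left
    by (intro sum.cong refl)
       (simp only: mult.left_commute[of w] solid_zonal_rec[of l, folded w_def], simp add: algebra_simps)
  also have "\<dots> = (2 * real l + d + 1) * (2 * (real (Suc l) * solid_zonal l y))
     - (real l + 1) * (2 * solid_zonal l y * (d + 1) + 4 * (real l * solid_zonal l y))"
    unfolding sum_subtractf sum_distrib_left[symmetric] sum.distrib bb 3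
      sum_inner_x_solid_zonal1 sum_inner_y_solid_zonal1 by simp
  also have "\<dots> = 0"
    by (simp add: algebra_simps)
  finally show ?case using w by (simp del: solid_zonal1.simps(3) solid_zonal2.simps(3))
qed auto

lemma laplacian_solid_zonal: "laplacian (solid_zonal l) y = 0"
proof -
  have "(deriv ^^ 2) (\<lambda>t. solid_zonal l (y + t *\<^sub>R b)) 0 = solid_zonal2 b l y" for b
  proof -
    have "deriv (\<lambda>t. solid_zonal l (y + t *\<^sub>R b)) = (\<lambda>t. solid_zonal1 b l (y + t *\<^sub>R b))"
      by (intro ext DERIV_imp_deriv has_derivative_solid_zonal)
    moreover have "deriv (\<lambda>t. solid_zonal1 b l (y + t *\<^sub>R b)) 0 = solid_zonal2 b l (y + 0 *\<^sub>R b)"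
      by (intro DERIV_imp_deriv has_derivative_solid_zonal1)
    ultimately show ?thesis by (simp add: numeral_2_eq_2)
  qed
  then show ?thesis by (simp add: laplacian_def sum_solid_zonal2)
qed

lemma spherical_harmonic_legendre: "spherical_harmonic l (\<lambda>y. poly (legendre d l) (x \<bullet> y))"
  unfolding spherical_harmonic_def
  using real_polynomial_function_solid_zonal solid_zonal_scale laplacian_solid_zonal solid_zonal_sphere
  by (intro exI[of _ "solid_zonal l"]) auto

end


section \<open>Mehler's formula\<close>

text \<open>The monic (probabilists') Hermite polynomials, adapted to the density proportional to
  exp (- x^2 / 2).\<close>

fun hermite :: "nat \<Rightarrow> real \<Rightarrow> real" where
  "hermite 0 x = 1"
| "hermite (Suc 0) x = x"
| "hermite (Suc (Suc n)) x = x * hermite (Suc n) x - (real n + 1) * hermite n x"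

text \<open>Because \<open>P $ 0 = 1\<close>, the equation at degree \<open>m\<close> determines the
  coefficient of index \<open>m + 1\<close> from the lower ones.\<close>

lemma fps_linear_ode_unique:
  fixes F G P Q :: "'a::field_char_0 fps"
  assumes P: "P $ 0 = 1" and F: "P * fps_deriv F = Q * F" and G: "P * fps_deriv G = Q * G"
    and init: "F $ 0 = G $ 0"
  shows "F = G"
proof -
  define H where "H = F - G"
  have H: "P * fps_deriv H = Q * H" "H $ 0 = 0"
    using F G init by (simp_all add: H_def algebra_simps)
  have "H $ n = 0" for n
  proof (induction n rule: less_induct)
    case (less n)
    show ?case
    proof (cases n)
      case (Suc m)
      have "(Q * H) $ m = 0"
        unfolding fps_mult_nth using less Suc by (intro sum.neutral) auto
      moreover have "(P * fps_deriv H) $ m = (\<Sum>i=0..m. if i = 0 then fps_deriv H $ m else 0)"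
        unfolding fps_mult_nth
      proof (intro sum.cong refl)
        fix i assume "i \<in> {0..m}"
        then show "P $ i * fps_deriv H $ (m - i) = (if i = 0 then fps_deriv H $ m else 0)"
          using less[of "Suc (m - i)"] Suc P by auto
      qed
      ultimately have "of_nat (Suc m) * H $ Suc m = 0"
        using H(1) by (simp add: sum.delta)
      then show ?thesis using Suc by (simp del: of_nat_Suc)
    qed (use H in auto)
  qed
  then show ?thesis by (simp add: H_def fps_eq_iff)
qed

text \<open>The three-term recurrence, used in \<open>x\<close> or in \<open>y\<close>, gives four
  linear relations among \<open>G\<close>, its derivative and the series \<open>A\<close>,
  \<open>B\<close>, \<open>C\<close> with shifted indices. Eliminating \<open>A\<close>,
  \<open>C\<close> and then \<open>B\<close> leaves a first-order equation for \<open>G\<close>.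
  Coefficients are complex so as to be compared with a Taylor expansion in the complex
  plane.\<close>

lemma hermite_fps_ode:
  fixes x y :: real
  defines "G \<equiv> Abs_fps (\<lambda>k. complex_of_real (hermite k x * hermite k y / fact k))"
  defines "cx \<equiv> fps_const (complex_of_real x)" and "cy \<equiv> fps_const (complex_of_real y)"
  shows "(1 - fps_X ^ 2) ^ 2 * fps_deriv G =
    ((cx - fps_X * cy) * (cy - fps_X * cx) + fps_X * (1 - fps_X ^ 2)) * G"
proof -
  define A where "A = Abs_fps (\<lambda>k. complex_of_real (hermite (Suc k) x * hermite k y / fact k))"
  define B where "B = Abs_fps (\<lambda>k. complex_of_real (hermite k x * hermite (Suc k) y / fact k))"
  define C where "C = Abs_fps (\<lambda>k. complex_of_real (hermite k x * hermite (Suc (Suc k)) y / fact k))"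
  have fact: "fact (Suc n) = (real n + 1) * fact n" for n by (simp add: algebra_simps)
  have nz: "real n + 1 \<noteq> 0" for n by (metis of_nat_Suc of_nat_neq_0 add.commute)
  have quot: "(u * p - c * q) * r / (c * f) = u * (p * r / (c * f)) - q * r / f" if "c \<noteq> 0" for u p c q r f :: real
    using that by (simp add: left_diff_distrib diff_divide_distrib)
  have 1: "A = cx * G - fps_X * B"
  proof (rule fps_ext)
    show "A $ n = (cx * G - fps_X * B) $ n" for n
    proof (cases n)
      case (Suc m)
      have "hermite (Suc (Suc m)) x * hermite (Suc m) y / fact (Suc m) =
          x * (hermite (Suc m) x * hermite (Suc m) y / fact (Suc m)) - hermite m x * hermite (Suc m) y / fact m"
        unfolding fact hermite.simps(3)[of m x] by (rule quot) (rule nz)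
      then show ?thesis
        by (simp only: A_def B_def G_def cx_def Suc fps_sub_nth fps_mult_left_const_nth fps_X_mult_nth
            fps_nth_Abs_fps of_real_mult[symmetric] of_real_diff[symmetric] if_False nat.simps diff_Suc_1)
    qed (simp add: A_def B_def G_def cx_def)
  qed
  have 2: "B = cy * G - fps_X * A"
  proof (rule fps_ext)
    show "B $ n = (cy * G - fps_X * A) $ n" for n
    proof (cases n)
      case (Suc m)
      have "hermite (Suc m) x * hermite (Suc (Suc m)) y / fact (Suc m) =
          y * (hermite (Suc m) x * hermite (Suc m) y / fact (Suc m)) - hermite (Suc m) x * hermite m y / fact m"
        unfolding fact hermite.simps(3)[of m y] mult.commute[of "hermite (Suc m) x"] by (rule quot) (rule nz)
      then show ?thesis
        by (simp only: A_def B_def G_def cy_def Suc fps_sub_nth fps_mult_left_const_nth fps_X_mult_nth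
            fps_nth_Abs_fps of_real_mult[symmetric] of_real_diff[symmetric] if_False nat.simps diff_Suc_1)
    qed (simp add: A_def B_def G_def cy_def)
  qed
  have G': "fps_deriv G $ n = complex_of_real (hermite (Suc n) x * hermite (Suc n) y / fact n)" for n
  proof -
    have "fps_deriv G $ n = complex_of_real ((real n + 1) * (hermite (Suc n) x * hermite (Suc n) y / fact (Suc n)))"
      by (simp add: G_def add.commute del: hermite.simps fact_Suc)
    also have "(real n + 1) * (hermite (Suc n) x * hermite (Suc n) y / fact (Suc n)) =
        hermite (Suc n) x * hermite (Suc n) y / fact n"
      unfolding fact using nz[of n] by simp
    finally show ?thesis .
  qed
  have 3: "fps_deriv G = cx * B - fps_X * C"
  proof (rule fps_ext)
    show "fps_deriv G $ n = (cx * B - fps_X * C) $ n" for n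
    proof (cases n)
      case (Suc m)
      have "hermite (Suc (Suc m)) x * hermite (Suc (Suc m)) y / fact (Suc m) =
          x * (hermite (Suc m) x * hermite (Suc (Suc m)) y / fact (Suc m)) - hermite m x * hermite (Suc (Suc m)) y / fact m"
        unfolding fact hermite.simps(3)[of m x] by (rule quot) (rule nz)
      then show ?thesis
        by (simp only: G' B_def C_def cx_def Suc fps_sub_nth fps_mult_left_const_nth fps_X_mult_nth
            fps_nth_Abs_fps of_real_mult[symmetric] of_real_diff[symmetric] if_False nat.simps diff_Suc_1)
    qed (simp add: G' B_def C_def cx_def del: fps_deriv_nth)
  qed
  have 4: "C = cy * B - G - fps_X * fps_deriv G"
  proof (rule fps_ext)
    show "C $ n = (cy * B - G - fps_X * fps_deriv G) $ n" for n
    proof -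
      have "(fps_X * fps_deriv G) $ n = complex_of_real (real n * (hermite n x * hermite n y / fact n))"
        by (cases n) (simp_all add: G_def del: hermite.simps fact_Suc)
      moreover have "hermite n x * hermite (Suc (Suc n)) y / fact n =
          y * (hermite n x * hermite (Suc n) y / fact n) - hermite n x * hermite n y / fact n
           - real n * (hermite n x * hermite n y / fact n)"
        by (simp add: field_simps)
      ultimately show ?thesis
        by (simp only: C_def B_def G_def cy_def fps_sub_nth fps_mult_left_const_nth
            fps_nth_Abs_fps of_real_mult[symmetric] of_real_diff[symmetric])
    qed
  qed
  have 5: "(1 - fps_X ^ 2) * B = (cy - fps_X * cx) * G"
    using 2 unfolding 1 by (simp add: algebra_simps power2_eq_square)
  have 6: "(1 - fps_X ^ 2) * fps_deriv G = (cx - fps_X * cy) * B + fps_X * G"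
    using 3 unfolding 4 by (simp add: algebra_simps power2_eq_square)
  have "(1 - fps_X ^ 2) ^ 2 * fps_deriv G = (1 - fps_X ^ 2) * ((1 - fps_X ^ 2) * fps_deriv G)"
    by (simp add: power2_eq_square mult.assoc)
  also have "\<dots> = (cx - fps_X * cy) * ((1 - fps_X ^ 2) * B) + fps_X * (1 - fps_X ^ 2) * G"
    unfolding 6 by (simp add: algebra_simps)
  also have "\<dots> = ((cx - fps_X * cy) * (cy - fps_X * cx) + fps_X * (1 - fps_X ^ 2)) * G"
    unfolding 5 by (simp add: algebra_simps)
  finally show ?thesis .
qed

definition mehler_kernel :: "real \<Rightarrow> real \<Rightarrow> real \<Rightarrow> real" where
  "mehler_kernel \<rho> x y = exp ((2 * \<rho> * x * y - \<rho>\<^sup>2 * (x\<^sup>2 + y\<^sup>2)) / (2 * (1 - \<rho>\<^sup>2))) / sqrt (1 - \<rho>\<^sup>2)"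

text \<open>The kernel is holomorphic in \<open>\<rho>\<close> on the unit disc and satisfies the linear differential
  equation that the recursion of the Hermite polynomials encodes.\<close>

lemma mehler_formula:
  assumes "\<bar>\<rho>\<bar> < 1"
  shows "(\<lambda>k. \<rho> ^ k * (hermite k x * hermite k y) / fact k) sums mehler_kernel \<rho> x y"
proof -
  define cx cy where "cx = complex_of_real x" and "cy = complex_of_real y"
  \<comment> \<open>The first factor is the branch of (1 - z^2)^(-1/2) equal to 1 at 0; it is
    holomorphic on the disc because 1 - z^2 has positive real part there.\<close>
  define M where "M z = exp (- Ln (1 - z\<^sup>2) / 2) * exp ((2 * z * cx * cy - z\<^sup>2 * (cx\<^sup>2 + cy\<^sup>2)) / (2 * (1 - z\<^sup>2)))" for z
  define Q where "Q z = (cx - z * cy) * (cy - z * cx) + z * (1 - z\<^sup>2)" for z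
  have Re: "Re (1 - z\<^sup>2) > 0" if "z \<in> ball 0 1" for z
  proof -
    have "Re (z\<^sup>2) \<le> norm (z\<^sup>2)" by (rule complex_Re_le_cmod)
    also have "\<dots> < 1" using that by (simp add: norm_power power_less_one_iff)
    finally show ?thesis by simp
  qed
  have nz: "1 - z\<^sup>2 \<noteq> 0" "1 - z\<^sup>2 \<notin> \<real>\<^sub>\<le>\<^sub>0" if "z \<in> ball 0 1" for z :: complex
    using Re[OF that] by (auto simp: complex_nonpos_Reals_iff)
  have deriv: "(M has_field_derivative Q z / (1 - z\<^sup>2)\<^sup>2 * M z) (at z)" if z: "z \<in> ball 0 1" for z
  proof -
    define w where "w = 1 - z\<^sup>2"
    have w: "w \<noteq> 0" using nz(1)[OF z] by (simp add: w_def)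
    have d1: "((\<lambda>z. - Ln (1 - z\<^sup>2) / 2) has_field_derivative z / w) (at z)"
      using nz[OF z] by (auto intro!: derivative_eq_intros simp: w_def field_simps)
    have d2: "((\<lambda>z. (2 * z * cx * cy - z\<^sup>2 * (cx\<^sup>2 + cy\<^sup>2)) / (2 * (1 - z\<^sup>2))) has_field_derivative
        ((2 * cx * cy - 2 * z * (cx\<^sup>2 + cy\<^sup>2)) * (2 * w) - (2 * z * cx * cy - z\<^sup>2 * (cx\<^sup>2 + cy\<^sup>2)) * (- 4 * z)) / ((2 * w) * (2 * w))) (at z)"
      using nz[OF z] unfolding w_def
      by (intro DERIV_divide) (auto intro!: derivative_eq_intros)
    have "((2 * cx * cy - 2 * z * (cx\<^sup>2 + cy\<^sup>2)) * (2 * w) - (2 * z * cx * cy - z\<^sup>2 * (cx\<^sup>2 + cy\<^sup>2)) * (- 4 * z))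
        = 4 * ((cx - z * cy) * (cy - z * cx))"
      unfolding w_def by (simp add: power2_eq_square algebra_simps)
    then have eq: "((2 * cx * cy - 2 * z * (cx\<^sup>2 + cy\<^sup>2)) * (2 * w) - (2 * z * cx * cy - z\<^sup>2 * (cx\<^sup>2 + cy\<^sup>2)) * (- 4 * z)) / ((2 * w) * (2 * w))
        = (cx - z * cy) * (cy - z * cx) / w\<^sup>2"
      using w by (simp add: power2_eq_square)
    have "z / w + (cx - z * cy) * (cy - z * cx) / w\<^sup>2 = Q z / w\<^sup>2"
    proof -
      have "Q z = (cx - z * cy) * (cy - z * cx) + z * w" by (simp add: Q_def w_def)
      then show ?thesis using w by (simp add: power2_eq_square add_divide_distrib)
    qed
    then have Qeq: "Q z / w\<^sup>2 = z / w + (cx - z * cy) * (cy - z * cx) / w\<^sup>2" by simp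
    have "(M has_field_derivative Q z / w\<^sup>2 * M z) (at z)"
      unfolding M_def
      by (rule DERIV_cong[OF DERIV_mult[OF DERIV_chain2[OF DERIV_exp d1] DERIV_chain2[OF DERIV_exp d2]]])
         (unfold eq Qeq, simp only: distrib_left distrib_right mult_ac add_ac)
    then show ?thesis by (simp only: w_def)
  qed
  have holo: "M holomorphic_on ball 0 1"
    unfolding holomorphic_on_open[OF open_ball] using deriv by blast
  define F where "F = fps_expansion M 0"
  define G where "G = Abs_fps (\<lambda>k. complex_of_real (hermite k x * hermite k y / fact k))"
  define P' where "P' = (1 - fps_X ^ 2 :: complex fps) ^ 2"
  define Q' where "Q' = (fps_const cx - fps_X * fps_const cy) * (fps_const cy - fps_X * fps_const cx)
     + fps_X * (1 - fps_X ^ 2)"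
  have MF: "M has_fps_expansion F"
    unfolding F_def by (rule has_fps_expansion_fps_expansion[OF _ _ holo]) auto
  have lhs: "(\<lambda>z. (1 - z ^ 2) ^ 2 * deriv M z) has_fps_expansion P' * fps_deriv F"
    unfolding P'_def by (intro fps_expansion_intros MF)
  have rhs: "(\<lambda>z. Q z * M z) has_fps_expansion Q' * F"
    unfolding Q_def Q'_def by (intro fps_expansion_intros MF)
  have ev: "\<forall>\<^sub>F z in nhds 0. (1 - z ^ 2) ^ 2 * deriv M z = Q z * M z"
  proof (rule eventually_nhds_in_open[of "ball 0 1", THEN eventually_mono])
    fix z :: complex assume z: "z \<in> ball 0 1"
    show "(1 - z ^ 2) ^ 2 * deriv M z = Q z * M z"
      using DERIV_imp_deriv[OF deriv[OF z]] nz[OF z] by simp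
  qed auto
  have ode: "P' * fps_deriv F = Q' * F"
    by (rule fps_expansion_unique_complex[OF has_fps_expansion_cong[OF ev refl, THEN iffD1, OF lhs] rhs])
  have "F = G"
  proof (rule fps_linear_ode_unique[OF _ ode])
    show "P' $ 0 = 1" by (simp add: P'_def fps_power_zeroth)
    show "P' * fps_deriv G = Q' * G"
      unfolding P'_def Q'_def G_def cx_def cy_def by (rule hermite_fps_ode)
    show "F $ 0 = G $ 0" by (simp add: F_def fps_expansion_def G_def M_def)
  qed
  define z where "z = complex_of_real \<rho>"
  \<comment> \<open>The differential equation has identified the coefficients; convergence for every
    \<rho> of modulus below 1 comes from holomorphy on the whole disc.\<close>
  have "(\<lambda>n. F $ n * z ^ n) sums M z"
  proof (rule has_fps_expansion_imp_sums_complex[OF MF])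
    show "M holomorphic_on eball 0 1" using holo by (simp add: one_ereal_def)
    show "ereal (norm z) < 1" using assms by (simp add: z_def)
  qed
  moreover have "F $ n * z ^ n = complex_of_real (\<rho> ^ n * (hermite n x * hermite n y) / fact n)" for n
    by (simp add: \<open>F = G\<close> G_def z_def)
  moreover have "M z = complex_of_real (mehler_kernel \<rho> x y)"
  proof -
    have pos: "1 - \<rho>\<^sup>2 > 0" using assms by (simp add: abs_square_less_1)
    have 1: "1 - z\<^sup>2 = complex_of_real (1 - \<rho>\<^sup>2)" by (simp add: z_def)
    have "Ln (1 - z\<^sup>2) = complex_of_real (ln (1 - \<rho>\<^sup>2))"
      unfolding 1 by (rule Ln_of_real[OF pos])
    then have "- Ln (1 - z\<^sup>2) / 2 = complex_of_real (- ln (sqrt (1 - \<rho>\<^sup>2)))"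
      using pos by (simp add: ln_sqrt)
    then have "exp (- Ln (1 - z\<^sup>2) / 2) = complex_of_real (exp (- ln (sqrt (1 - \<rho>\<^sup>2))))"
      by (simp only: exp_of_real)
    also have "exp (- ln (sqrt (1 - \<rho>\<^sup>2))) = 1 / sqrt (1 - \<rho>\<^sup>2)"
      using pos by (simp add: exp_minus divide_inverse)
    finally have 2: "exp (- Ln (1 - z\<^sup>2) / 2) = complex_of_real (1 / sqrt (1 - \<rho>\<^sup>2))" .
    have 3: "(2 * z * cx * cy - z\<^sup>2 * (cx\<^sup>2 + cy\<^sup>2)) / (2 * (1 - z\<^sup>2)) =
        complex_of_real ((2 * \<rho> * x * y - \<rho>\<^sup>2 * (x\<^sup>2 + y\<^sup>2)) / (2 * (1 - \<rho>\<^sup>2)))"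
      by (simp only: 1) (simp only: z_def cx_def cy_def of_real_divide of_real_mult of_real_diff
          of_real_add of_real_power of_real_numeral of_real_1)
    have "M z = complex_of_real (1 / sqrt (1 - \<rho>\<^sup>2)) *
        exp (complex_of_real ((2 * \<rho> * x * y - \<rho>\<^sup>2 * (x\<^sup>2 + y\<^sup>2)) / (2 * (1 - \<rho>\<^sup>2))))"
      unfolding M_def 2 3 ..
    then show ?thesis
      by (simp only: exp_of_real of_real_mult[symmetric] mehler_kernel_def) (simp only: times_divide_eq_left mult_1)
  qed
  ultimately show ?thesis by (simp only: sums_of_real_iff)
qed


section \<open>Gaussian expectations as power series\<close>

unbundle no fps_syntax
unbundle vec_syntax

lemma prob_space_std_gaussian: "prob_space std_gaussian"
  by (rule prob_space_normal_density) simp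

lemma sets_std_gaussian [measurable_cong, simp]: "sets std_gaussian = sets borel"
  by simp

lemma borel_measurable_hermite [measurable]: "hermite n \<in> borel_measurable borel"
  by (induction n rule: induct_nat_012) (auto simp: hermite.simps[abs_def])

lemma borel_measurable_mehler [measurable]:
  "(\<lambda>(x, y). mehler_kernel \<rho> x y) \<in> borel_measurable (borel \<Otimes>\<^sub>M borel)"
  unfolding mehler_kernel_def by measurable

lemma mehler_kernel_nonneg: "\<bar>\<rho>\<bar> < 1 \<Longrightarrow> mehler_kernel \<rho> x y \<ge> 0"
  by (simp add: mehler_kernel_def abs_square_le_1)

lemma std_normal_density_mehler:
  assumes "\<bar>\<rho>\<bar> < 1"
  defines "s \<equiv> sqrt (1 - \<rho>\<^sup>2)"
  shows "std_normal_density ((y - \<rho> * x) / s) / s = std_normal_density y * mehler_kernel \<rho> x y"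
proof -
  have pos: "1 - \<rho>\<^sup>2 > 0" using assms by (simp add: abs_square_less_1)
  have s2: "s\<^sup>2 = 1 - \<rho>\<^sup>2" using pos by (simp add: s_def)
  have "- ((y - \<rho> * x) / s)\<^sup>2 / 2 = - y\<^sup>2 / 2 + (2 * \<rho> * x * y - \<rho>\<^sup>2 * (x\<^sup>2 + y\<^sup>2)) / (2 * (1 - \<rho>\<^sup>2))"
    using pos unfolding power_divide s2 by (simp add: field_simps power2_eq_square)
  then show ?thesis
    by (simp add: std_normal_density_def mehler_kernel_def s_def[symmetric] exp_add[symmetric] mult_ac)
qed

text \<open>Given the first coordinate \<open>z\<close>, the second is normal with mean \<rho> z and
  variance 1 - \<rho>^2; the quotient of its density by the standard normal one is the Mehler
  kernel.\<close>

lemma gaussian_pair_eq_density: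
  assumes \<rho>: "\<bar>\<rho>\<bar> < 1"
  shows "gaussian_pair \<rho> =
    density (std_gaussian \<Otimes>\<^sub>M std_gaussian) (\<lambda>(x, y). ennreal (mehler_kernel \<rho> x y))"
proof (rule measure_eqI)
  interpret G: prob_space std_gaussian by (rule prob_space_std_gaussian)
  interpret GG: pair_prob_space std_gaussian std_gaussian ..
  define s where "s = sqrt (1 - \<rho>\<^sup>2)"
  have s: "s > 0" using \<rho> by (simp add: s_def abs_square_less_1)
  show "sets (gaussian_pair \<rho>) = sets (density (std_gaussian \<Otimes>\<^sub>M std_gaussian) (\<lambda>(x, y). ennreal (mehler_kernel \<rho> x y)))"
    by (simp add: gaussian_pair_def cong: sets_pair_measure_cong)
  fix A assume "A \<in> sets (gaussian_pair \<rho>)"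
  then have A [measurable]: "A \<in> sets (borel \<Otimes>\<^sub>M borel)" by (simp add: gaussian_pair_def)
  have A' [measurable]: "A \<in> sets (std_gaussian \<Otimes>\<^sub>M std_gaussian)"
    using A by (simp cong: sets_pair_measure_cong)
  have inner: "(\<integral>\<^sup>+w. indicator A (z, \<rho> * z + s * w) \<partial>std_gaussian) =
      (\<integral>\<^sup>+y. ennreal (mehler_kernel \<rho> z y) * indicator A (z, y) \<partial>std_gaussian)" for z
  proof -
    have "(\<integral>\<^sup>+y. ennreal (mehler_kernel \<rho> z y) * indicator A (z, y) \<partial>std_gaussian) =
        (\<integral>\<^sup>+y. ennreal (std_normal_density y * mehler_kernel \<rho> z y) * indicator A (z, y) \<partial>lborel)"
      using \<rho> by (subst nn_integral_density) (auto simp: ennreal_mult' mehler_kernel_nonneg mult.assoc)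
    also have "\<dots> = (\<integral>\<^sup>+y. ennreal (std_normal_density ((y - \<rho> * z) / s) / s) * indicator A (z, y) \<partial>lborel)"
      using std_normal_density_mehler[OF \<rho>, of _ z] by (simp add: s_def)
    also have "\<dots> = ennreal \<bar>s\<bar> * (\<integral>\<^sup>+w. ennreal (std_normal_density ((\<rho> * z + s * w - \<rho> * z) / s) / s) * indicator A (z, \<rho> * z + s * w) \<partial>lborel)"
      using s by (subst nn_integral_real_affine[where c = s and t = "\<rho> * z"]) auto
    also have "\<dots> = (\<integral>\<^sup>+w. ennreal s * (ennreal (std_normal_density w / s) * indicator A (z, \<rho> * z + s * w)) \<partial>lborel)"
      using s by (subst nn_integral_cmult) auto
    also have "\<dots> = (\<integral>\<^sup>+w. ennreal (std_normal_density w) * indicator A (z, \<rho> * z + s * w) \<partial>lborel)"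
      using s by (intro nn_integral_cong) (simp add: mult.assoc[symmetric] ennreal_mult'[symmetric])
    also have "\<dots> = (\<integral>\<^sup>+w. indicator A (z, \<rho> * z + s * w) \<partial>std_gaussian)"
      by (subst nn_integral_density) auto
    finally show ?thesis ..
  qed
  have "emeasure (gaussian_pair \<rho>) A = (\<integral>\<^sup>+v. indicator A v \<partial>gaussian_pair \<rho>)"
    by (simp add: gaussian_pair_def)
  also have "\<dots> = (\<integral>\<^sup>+v. indicator A (case v of (z, w) \<Rightarrow> (z, \<rho> * z + s * w)) \<partial>(std_gaussian \<Otimes>\<^sub>M std_gaussian))"
    unfolding gaussian_pair_def s_def[symmetric] by (subst nn_integral_distr) auto
  also have "\<dots> = (\<integral>\<^sup>+z. \<integral>\<^sup>+w. indicator A (z, \<rho> * z + s * w) \<partial>std_gaussian \<partial>std_gaussian)"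
    by (subst G.nn_integral_fst[symmetric]) auto
  also have "\<dots> = (\<integral>\<^sup>+z. \<integral>\<^sup>+y. ennreal (mehler_kernel \<rho> z y) * indicator A (z, y) \<partial>std_gaussian \<partial>std_gaussian)"
    unfolding inner ..
  also have "\<dots> = (\<integral>\<^sup>+v. (case v of (z, y) \<Rightarrow> ennreal (mehler_kernel \<rho> z y)) * indicator A v \<partial>(std_gaussian \<Otimes>\<^sub>M std_gaussian))"
    by (subst G.nn_integral_fst[symmetric]) auto
  also have "\<dots> = emeasure (density (std_gaussian \<Otimes>\<^sub>M std_gaussian) (\<lambda>(x, y). ennreal (mehler_kernel \<rho> x y))) A"
    by (subst emeasure_density) auto
  finally show "emeasure (gaussian_pair \<rho>) A = emeasure (density (std_gaussian \<Otimes>\<^sub>M std_gaussian) (\<lambda>(x, y). ennreal (mehler_kernel \<rho> x y))) A" .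
qed

text \<open>On the diagonal the kernel is a Gaussian density again, up to a constant; this bounds the
  second moments of the Hermite polynomials without computing them.\<close>

lemma integrable_mehler_diag:
  assumes "0 \<le> \<rho>" "\<rho> < 1"
  shows "integrable std_gaussian (\<lambda>x. mehler_kernel \<rho> x x)"
proof -
  define v where "v = sqrt ((1 + \<rho>) / (1 - \<rho>))"
  have v: "v > 0" "v\<^sup>2 = (1 + \<rho>) / (1 - \<rho>)" using assms by (simp_all add: v_def)
  have "std_normal_density x * mehler_kernel \<rho> x x = (v / sqrt (1 - \<rho>\<^sup>2)) * normal_density 0 v x" for x
  proof -
    have f: "1 - \<rho>\<^sup>2 = (1 - \<rho>) * (1 + \<rho>)" by (simp add: algebra_simps power2_eq_square)
    have "- x\<^sup>2 / 2 + (2 * \<rho> * x * x - \<rho>\<^sup>2 * (x\<^sup>2 + x\<^sup>2)) / (2 * (1 - \<rho>\<^sup>2)) = - (x - 0)\<^sup>2 / (2 * v\<^sup>2)"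
      unfolding v f using assms by (simp add: divide_simps) (simp add: algebra_simps power2_eq_square)
    then show ?thesis
      using v(1) unfolding std_normal_density_def mehler_kernel_def normal_density_def
      by (simp add: exp_add[symmetric] real_sqrt_mult)
  qed
  then show ?thesis
    using assms v by (subst integrable_density) (auto simp: mehler_kernel_nonneg mehler_kernel_def[abs_def])
qed

lemma hermite_square_sums:
  "0 \<le> \<rho> \<Longrightarrow> \<rho> < 1 \<Longrightarrow> (\<lambda>k. \<rho> ^ k * (hermite k x)\<^sup>2 / fact k) sums mehler_kernel \<rho> x x"
  using mehler_formula[of \<rho> x x] by (simp add: power2_eq_square)

text \<open>Every term of the diagonal Mehler series is nonnegative, so a single one is dominated by
  the kernel. The value 1/2 is an arbitrary choice in (0, 1), paid for by the factor
  \<open>fact k * 2 ^ k\<close>.\<close>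

lemma integrable_hermite_square: "integrable std_gaussian (\<lambda>x. (hermite k x)\<^sup>2)"
proof (rule Bochner_Integration.integrable_bound)
  show "integrable std_gaussian (\<lambda>x. (fact k * 2 ^ k) * mehler_kernel (1/2) x x)"
    by (intro integrable_mult_right integrable_mehler_diag) auto
  have "(hermite k x)\<^sup>2 \<le> (fact k * 2 ^ k) * mehler_kernel (1/2) x x" for x
  proof -
    have "(\<Sum>i\<in>{k}. (1/2) ^ i * (hermite i x)\<^sup>2 / fact i) \<le> mehler_kernel (1/2) x x"
      unfolding sums_unique[OF hermite_square_sums[of "1/2" x, simplified]]
      by (intro sum_le_suminf sums_summable[OF hermite_square_sums]) auto
    then show ?thesis by (simp add: field_simps)
  qed
  then show "AE x in std_gaussian. norm ((hermite k x)\<^sup>2) \<le> norm ((fact k * 2 ^ k) * mehler_kernel (1/2) x x)"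
    by (intro AE_I2) (smt (verit) real_norm_def zero_le_power2)
qed auto

lemma summable_hermite_square_moments:
  assumes "0 \<le> \<rho>" "\<rho> < 1"
  shows "summable (\<lambda>k. \<rho> ^ k / fact k * (\<integral>x. (hermite k x)\<^sup>2 \<partial>std_gaussian))"
proof (rule bounded_imp_summable)
  show "0 \<le> \<rho> ^ k / fact k * (\<integral>x. (hermite k x)\<^sup>2 \<partial>std_gaussian)" for k
    using assms by simp
  show "(\<Sum>k\<le>n. \<rho> ^ k / fact k * (\<integral>x. (hermite k x)\<^sup>2 \<partial>std_gaussian)) \<le> (\<integral>x. mehler_kernel \<rho> x x \<partial>std_gaussian)" for n
  proof -
    have "(\<Sum>k\<le>n. \<rho> ^ k / fact k * (\<integral>x. (hermite k x)\<^sup>2 \<partial>std_gaussian)) =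
        (\<integral>x. (\<Sum>k\<le>n. \<rho> ^ k / fact k * (hermite k x)\<^sup>2) \<partial>std_gaussian)"
      by (subst Bochner_Integration.integral_sum) (auto intro!: integrable_mult_right integrable_hermite_square)
    also have "\<dots> \<le> (\<integral>x. mehler_kernel \<rho> x x \<partial>std_gaussian)"
    proof (rule integral_mono)
      show "(\<Sum>k\<le>n. \<rho> ^ k / fact k * (hermite k x)\<^sup>2) \<le> mehler_kernel \<rho> x x" for x
        unfolding sums_unique[OF hermite_square_sums[OF assms, of x]] times_divide_eq_left
        using assms by (intro sum_le_suminf sums_summable[OF hermite_square_sums]) auto
    qed (auto intro!: Bochner_Integration.integrable_sum integrable_mult_right integrable_hermite_square integrable_mehler_diag assms)
    finally show ?thesis .
  qed
qed

text \<open>The squared coefficient of \<sigma> against \<open>hermite k / sqrt (fact k)\<close>.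
  Being a square, it is the source of all nonnegativity in the expansion of \<kappa>.\<close>

definition hermite_coeff :: "(real \<Rightarrow> real) \<Rightarrow> nat \<Rightarrow> real" where
  "hermite_coeff \<sigma> k = (\<integral>x. \<sigma> x * hermite k x \<partial>std_gaussian)\<^sup>2 / fact k"

lemma hermite_coeff_nonneg: "hermite_coeff \<sigma> k \<ge> 0"
  by (simp add: hermite_coeff_def)

context
  fixes \<sigma> :: "real \<Rightarrow> real"
  assumes \<sigma> [measurable]: "\<sigma> \<in> borel_measurable borel"
    and sq: "integrable std_gaussian (\<lambda>z. (\<sigma> z)\<^sup>2)"
begin

lemma integrable_mult_hermite: "integrable std_gaussian (\<lambda>x. \<sigma> x * hermite k x)"
proof (rule Bochner_Integration.integrable_bound)
  show "integrable std_gaussian (\<lambda>x. (\<sigma> x)\<^sup>2 + (hermite k x)\<^sup>2)"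
    by (intro Bochner_Integration.integrable_add sq integrable_hermite_square)
  have "\<bar>\<sigma> x * hermite k x\<bar> \<le> (\<sigma> x)\<^sup>2 + (hermite k x)\<^sup>2" for x
    using sum_squares_bound[of "\<bar>\<sigma> x\<bar>" "\<bar>hermite k x\<bar>"] mult_nonneg_nonneg[of "\<bar>\<sigma> x\<bar>" "\<bar>hermite k x\<bar>"]
    unfolding abs_mult power2_abs by linarith
  then show "AE x in std_gaussian. norm (\<sigma> x * hermite k x) \<le> norm ((\<sigma> x)\<^sup>2 + (hermite k x)\<^sup>2)"
    by (intro AE_I2) simp
qed auto

lemma gaussian_pair_hermite:
  assumes \<rho>: "\<bar>\<rho>\<bar> < 1"
  shows "(\<lambda>k. hermite_coeff \<sigma> k * \<rho> ^ k) sums (\<integral>z. \<sigma> (fst z) * \<sigma> (snd z) \<partial>gaussian_pair \<rho>)"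
proof -
  interpret G: prob_space std_gaussian by (rule prob_space_std_gaussian)
  interpret GG: pair_prob_space std_gaussian std_gaussian ..
  let ?GG = "std_gaussian \<Otimes>\<^sub>M std_gaussian"
  define f where "f k v = \<rho> ^ k / fact k * ((\<sigma> (fst v) * hermite k (fst v)) * (\<sigma> (snd v) * hermite k (snd v)))" for k and v :: "real \<times> real"
  have prod: "integrable ?GG (\<lambda>v. g (fst v) * h (snd v))"
    "(\<integral>v. g (fst v) * h (snd v) \<partial>?GG) = (\<integral>x. g x \<partial>std_gaussian) * (\<integral>x. h x \<partial>std_gaussian)"
    if [measurable]: "g \<in> borel_measurable borel" "h \<in> borel_measurable borel"
      and g: "integrable std_gaussian g" and h: "integrable std_gaussian h" for g h :: "real \<Rightarrow> real"
  proof -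
    show int: "integrable ?GG (\<lambda>v. g (fst v) * h (snd v))"
      using g h by (intro GG.Fubini_integrable) (auto simp: abs_mult)
    show "(\<integral>v. g (fst v) * h (snd v) \<partial>?GG) = (\<integral>x. g x \<partial>std_gaussian) * (\<integral>x. h x \<partial>std_gaussian)"
      using GG.integral_fst'[OF int] by simp
  qed
  have "(\<lambda>k. \<integral>v. f k v \<partial>?GG) sums (\<integral>v. (\<Sum>k. f k v) \<partial>?GG)"
  proof (rule sums_integral)
    show "integrable ?GG (f k)" for k
      unfolding f_def by (intro integrable_mult_right prod(1) integrable_mult_hermite) auto
    have "summable (\<lambda>k. norm (f k (x, y)))" for x y
    proof -
      have "summable (\<lambda>k. norm (hermite k x * hermite k y / fact k * \<rho> ^ k))"
      proof (rule powser_insidea)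
        show "norm \<rho> < norm ((1 + \<bar>\<rho>\<bar>) / 2)" using \<rho> by simp
        have "\<bar>(1 + \<bar>\<rho>\<bar>) / 2\<bar> < 1" using \<rho> by simp
        from sums_summable[OF mehler_formula[OF this, of x y]]
        show "summable (\<lambda>k. hermite k x * hermite k y / fact k * ((1 + \<bar>\<rho>\<bar>) / 2) ^ k)"
          by (simp add: mult_ac)
      qed
      then have "summable (\<lambda>k. \<bar>\<sigma> x * \<sigma> y\<bar> * norm (hermite k x * hermite k y / fact k * \<rho> ^ k))"
        by (rule summable_mult)
      then show ?thesis by (simp add: f_def abs_mult mult_ac)
    qed
    then show "AE v in ?GG. summable (\<lambda>k. norm (f k v))"
      by (intro AE_I2) (metis surj_pair)
    show "summable (\<lambda>k. \<integral>v. norm (f k v) \<partial>?GG)"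
    proof (rule summable_comparison_test')
      show "summable (\<lambda>k. (\<integral>z. (\<sigma> z)\<^sup>2 \<partial>std_gaussian) * (\<bar>\<rho>\<bar> ^ k / fact k * (\<integral>x. (hermite k x)\<^sup>2 \<partial>std_gaussian)))"
        using \<rho> by (intro summable_mult summable_hermite_square_moments) auto
      fix k :: nat
      \<comment> \<open>The factors are paired crosswise, \<sigma> at one coordinate with the
        Hermite polynomial at the other, before 2 a b \<le> a^2 + b^2 is applied. Both squares in
        the bound are then products of integrable functions of one coordinate each.\<close>
      have "(\<integral>v. norm (f k v) \<partial>?GG) \<le> (\<integral>v. \<bar>\<rho>\<bar> ^ k / fact k * (((\<sigma> (fst v))\<^sup>2 * (hermite k (snd v))\<^sup>2 + (hermite k (fst v))\<^sup>2 * (\<sigma> (snd v))\<^sup>2) / 2) \<partial>?GG)"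
      proof (rule integral_mono)
        show "integrable ?GG (\<lambda>v. norm (f k v))"
          unfolding f_def by (intro integrable_norm integrable_mult_right prod(1) integrable_mult_hermite) auto
        show "integrable ?GG (\<lambda>v. \<bar>\<rho>\<bar> ^ k / fact k * (((\<sigma> (fst v))\<^sup>2 * (hermite k (snd v))\<^sup>2 + (hermite k (fst v))\<^sup>2 * (\<sigma> (snd v))\<^sup>2) / 2))"
          by (intro integrable_mult_right integrable_divide Bochner_Integration.integrable_add prod(1) sq integrable_hermite_square) auto
        fix v :: "real \<times> real"
        have "norm (f k v) = \<bar>\<rho>\<bar> ^ k / fact k * (\<bar>\<sigma> (fst v) * hermite k (snd v)\<bar> * \<bar>hermite k (fst v) * \<sigma> (snd v)\<bar>)"
          by (simp add: f_def abs_mult power_abs mult_ac)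
        also have "\<dots> \<le> \<bar>\<rho>\<bar> ^ k / fact k * (((\<sigma> (fst v) * hermite k (snd v))\<^sup>2 + (hermite k (fst v) * \<sigma> (snd v))\<^sup>2) / 2)"
          using sum_squares_bound[of "\<bar>\<sigma> (fst v) * hermite k (snd v)\<bar>" "\<bar>hermite k (fst v) * \<sigma> (snd v)\<bar>"]
          by (intro mult_left_mono) auto
        finally show "norm (f k v) \<le> \<bar>\<rho>\<bar> ^ k / fact k * (((\<sigma> (fst v))\<^sup>2 * (hermite k (snd v))\<^sup>2 + (hermite k (fst v))\<^sup>2 * (\<sigma> (snd v))\<^sup>2) / 2)"
          by (simp only: power_mult_distrib)
      qed
      also have "\<dots> = \<bar>\<rho>\<bar> ^ k / fact k * (((\<integral>z. (\<sigma> z)\<^sup>2 \<partial>std_gaussian) * (\<integral>x. (hermite k x)\<^sup>2 \<partial>std_gaussian) +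
          (\<integral>x. (hermite k x)\<^sup>2 \<partial>std_gaussian) * (\<integral>z. (\<sigma> z)\<^sup>2 \<partial>std_gaussian)) / 2)"
        using prod[OF _ _ sq integrable_hermite_square[of k]] prod[OF _ _ integrable_hermite_square[of k] sq] by simp
      also have "\<dots> = (\<integral>z. (\<sigma> z)\<^sup>2 \<partial>std_gaussian) * (\<bar>\<rho>\<bar> ^ k / fact k * (\<integral>x. (hermite k x)\<^sup>2 \<partial>std_gaussian))"
        by simp
      finally show "norm (\<integral>v. norm (f k v) \<partial>?GG) \<le> (\<integral>z. (\<sigma> z)\<^sup>2 \<partial>std_gaussian) * (\<bar>\<rho>\<bar> ^ k / fact k * (\<integral>x. (hermite k x)\<^sup>2 \<partial>std_gaussian))"
        by simp
    qed
  qed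
  moreover have "(\<integral>v. f k v \<partial>?GG) = hermite_coeff \<sigma> k * \<rho> ^ k" for k
    unfolding f_def using prod(2)[OF _ _ integrable_mult_hermite[of k] integrable_mult_hermite[of k]]
    by (simp add: hermite_coeff_def power2_eq_square)
  moreover have "(\<integral>v. (\<Sum>k. f k v) \<partial>?GG) = (\<integral>z. \<sigma> (fst z) * \<sigma> (snd z) \<partial>gaussian_pair \<rho>)"
  proof -
    have "(\<Sum>k. f k v) = mehler_kernel \<rho> (fst v) (snd v) * (\<sigma> (fst v) * \<sigma> (snd v))" for v
    proof -
      have "(\<lambda>k. \<rho> ^ k * (hermite k (fst v) * hermite k (snd v)) / fact k * (\<sigma> (fst v) * \<sigma> (snd v))) sums
          (mehler_kernel \<rho> (fst v) (snd v) * (\<sigma> (fst v) * \<sigma> (snd v)))"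
        by (intro sums_mult2 mehler_formula \<rho>)
      then show ?thesis by (simp add: sums_iff f_def mult_ac)
    qed
    moreover have "(\<integral>z. \<sigma> (fst z) * \<sigma> (snd z) \<partial>gaussian_pair \<rho>) =
        (\<integral>v. mehler_kernel \<rho> (fst v) (snd v) *\<^sub>R (\<sigma> (fst v) * \<sigma> (snd v)) \<partial>?GG)"
      unfolding gaussian_pair_eq_density[OF \<rho>] case_prod_beta
    proof (rule integral_density)
      show "(\<lambda>v. mehler_kernel \<rho> (fst v) (snd v)) \<in> borel_measurable ?GG"
        unfolding mehler_kernel_def by measurable
    qed (auto simp: mehler_kernel_nonneg[OF \<rho>])
    ultimately show ?thesis by simp
  qed
  ultimately show ?thesis by simp
qed

text \<open>Correlation 1 lies outside Mehler's formula; there the law is degenerate and the two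
  coordinates coincide.\<close>

lemma gaussian_pair_1: "(\<integral>z. \<sigma> (fst z) * \<sigma> (snd z) \<partial>gaussian_pair 1) = Gamma_sigma \<sigma>"
proof -
  interpret G: prob_space std_gaussian by (rule prob_space_std_gaussian)
  interpret GG: pair_prob_space std_gaussian std_gaussian ..
  have "(\<integral>z. \<sigma> (fst z) * \<sigma> (snd z) \<partial>gaussian_pair 1) = (\<integral>v. (\<sigma> (fst v))\<^sup>2 \<partial>(std_gaussian \<Otimes>\<^sub>M std_gaussian))"
    unfolding gaussian_pair_def by (subst integral_distr) (auto simp: case_prod_beta power2_eq_square)
  also have "\<dots> = (\<integral>x. (\<sigma> x)\<^sup>2 \<partial>std_gaussian)"
  proof -
    have "integrable (std_gaussian \<Otimes>\<^sub>M std_gaussian) (\<lambda>v. (\<sigma> (fst v))\<^sup>2)"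
      using sq by (intro GG.Fubini_integrable) (auto simp: G.prob_space)
    moreover have "G.prob UNIV = 1" using G.prob_space by simp
    ultimately show ?thesis using GG.integral_fst'[of "\<lambda>v. (\<sigma> (fst v))\<^sup>2"] by simp
  qed
  finally show ?thesis by (simp add: Gamma_sigma_def)
qed

end

text \<open>A converse of Abel's theorem for nonnegative coefficients: partial sums are bounded by
  the limit \<open>S\<close>, and each value \<open>g \<rho>\<close> by the full sum. Applied to
  \<open>hermite_coeff\<close>, it yields Parseval's identity for \<sigma> from the continuity of
  \<kappa> at 1.\<close>

lemma sums_from_left_limit:
  fixes c :: "nat \<Rightarrow> real"
  assumes c: "\<And>k. c k \<ge> 0" and g: "\<And>\<rho>. 0 \<le> \<rho> \<Longrightarrow> \<rho> < 1 \<Longrightarrow> (\<lambda>k. c k * \<rho> ^ k) sums g \<rho>"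
    and lim: "(g \<longlongrightarrow> S) (at_left 1)"
  shows "c sums S"
proof -
  have ev: "\<forall>\<^sub>F \<rho> in at_left (1::real). 0 \<le> \<rho> \<and> \<rho> < 1"
    by (rule eventually_at_leftI[of 0]) auto
  have bound: "(\<Sum>k<n. c k) \<le> S" for n
  proof (rule tendsto_le[OF _ lim])
    have "((\<lambda>\<rho>. \<Sum>k<n. c k * \<rho> ^ k) \<longlongrightarrow> (\<Sum>k<n. c k * 1 ^ k)) (at_left 1)"
      by (intro tendsto_intros)
    then show "((\<lambda>\<rho>. \<Sum>k<n. c k * \<rho> ^ k) \<longlongrightarrow> (\<Sum>k<n. c k)) (at_left 1)" by simp
    show "\<forall>\<^sub>F \<rho> in at_left 1. (\<Sum>k<n. c k * \<rho> ^ k) \<le> g \<rho>"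
      using ev
    proof eventually_elim
      case (elim \<rho>)
      then show ?case
        unfolding sums_unique[OF g[of \<rho>, OF conjunct1[OF elim] conjunct2[OF elim]]]
        by (intro sum_le_suminf sums_summable[OF g]) (auto intro!: mult_nonneg_nonneg c)
    qed
  qed simp
  have summ: "summable c"
    using bound c by (intro bounded_imp_summable[where B = S])
      (auto simp: lessThan_Suc_atMost[symmetric] simp del: sum.lessThan_Suc)
  have "suminf c \<le> S" using summ bound by (intro suminf_le_const) auto
  moreover have "S \<le> suminf c"
  proof (rule tendsto_upperbound[OF lim])
    show "\<forall>\<^sub>F \<rho> in at_left 1. g \<rho> \<le> suminf c"
      using ev
    proof eventually_elim
      case (elim \<rho>)
      have "c k * \<rho> ^ k \<le> c k" for k
        using mult_left_mono[OF power_le_one[of \<rho> k], of "c k"] c[of k] elim by simp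
      then show ?case
        unfolding sums_unique[OF g[of \<rho>, OF conjunct1[OF elim] conjunct2[OF elim]]]
        using elim by (intro suminf_le summ sums_summable[OF g]) auto
    qed
  qed simp
  ultimately show ?thesis using summ by (simp add: sums_iff)
qed

lemma pmf_of_sums:
  assumes e: "\<And>k. e k \<ge> 0" "e sums (1::real)"
  obtains p :: "nat pmf" where "\<And>k. pmf p k = e k"
proof -
  have "(\<integral>\<^sup>+k. ennreal (e k) \<partial>count_space UNIV) = 1"
    unfolding nn_integral_count_space_nat using suminf_ennreal_eq[OF e] by simp
  then have "pmf (embed_pmf e) k = e k" for k
    using e by (intro pmf_embed_pmf) auto
  then show ?thesis by (rule that)
qed

text \<open>In the correlation \<rho> the kernel is the generating function of a law
  \<open>p1\<close>, and the map from \<open>u\<close> to the correlation is that of a Bernoulli law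
  \<open>q\<close>; composing the two gives a compound law. Its mass at 0 is \<kappa>(0), which is
  at least \<open>\<Gamma>b\<close>.\<close>

lemma nn_kernel_eq_pgf:
  assumes \<sigma>: "\<sigma> \<in> borel_measurable borel" "integrable std_gaussian (\<lambda>z. (\<sigma> z)\<^sup>2)" "Gamma_sigma \<sigma> > 0"
    and \<Gamma>: "\<Gamma>b > 0" "\<Gamma>W0 > 0" "\<Gamma>b + \<Gamma>W0 = 1"
    and cont: "continuous_on {-1..1} (nn_kernel \<sigma> \<Gamma>b \<Gamma>W0)"
  obtains p :: "nat pmf" where "pmf p 0 > 0" "\<And>u. \<bar>u\<bar> \<le> 1 \<Longrightarrow> nn_kernel \<sigma> \<Gamma>b \<Gamma>W0 u = pgf p u"
proof -
  define g where "g \<rho> = (\<integral>z. \<sigma> (fst z) * \<sigma> (snd z) \<partial>gaussian_pair \<rho>)" for \<rho>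
  define GW where "GW = Gamma_W \<sigma> \<Gamma>b"
  let ?\<kappa> = "nn_kernel \<sigma> \<Gamma>b \<Gamma>W0"
  have GW: "GW > 0" "GW * Gamma_sigma \<sigma> = 1 - \<Gamma>b"
    using \<sigma>(3) \<Gamma> by (simp_all add: GW_def Gamma_W_def)
  have \<kappa>: "?\<kappa> u = \<Gamma>b + GW * g (\<Gamma>b + \<Gamma>W0 * u)" for u
    by (simp add: nn_kernel_def GW_def g_def)
  have g: "(\<lambda>k. hermite_coeff \<sigma> k * \<rho> ^ k) sums g \<rho>" if "\<bar>\<rho>\<bar> < 1" for \<rho>
    unfolding g_def by (rule gaussian_pair_hermite[OF \<sigma>(1,2) that])
  have \<kappa>1: "?\<kappa> 1 = 1"
    using \<Gamma> GW gaussian_pair_1[OF \<sigma>(1,2)] by (simp add: \<kappa> g_def)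
  \<comment> \<open>The left limit of \<open>g\<close> at 1 is read off from the continuity of
    \<kappa> at 1 by solving \<open>\<rho> = \<Gamma>b + \<Gamma>W0 * u\<close> for
    \<open>u\<close>.\<close>
  have "((\<lambda>\<rho>. (?\<kappa> ((\<rho> - \<Gamma>b) / \<Gamma>W0) - \<Gamma>b) / GW) \<longlongrightarrow> (?\<kappa> 1 - \<Gamma>b) / GW) (at_left 1)"
  proof (intro tendsto_intros)
    have "(?\<kappa> \<longlongrightarrow> ?\<kappa> 1) (at 1 within {-1..1})"
      using cont by (auto simp: continuous_on_def)
    moreover have "filterlim (\<lambda>\<rho>. (\<rho> - \<Gamma>b) / \<Gamma>W0) (at 1 within {-1..1}) (at_left 1)"
      unfolding filterlim_at
    proof
      have "((\<lambda>\<rho>. (\<rho> - \<Gamma>b) / \<Gamma>W0) \<longlongrightarrow> (1 - \<Gamma>b) / \<Gamma>W0) (at_left 1)"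
        using \<Gamma> by (intro tendsto_intros) auto
      moreover have "(1 - \<Gamma>b) / \<Gamma>W0 = 1" using \<Gamma> by (simp add: field_simps)
      ultimately show "((\<lambda>\<rho>. (\<rho> - \<Gamma>b) / \<Gamma>W0) \<longlongrightarrow> 1) (at_left 1)" by simp
      show "\<forall>\<^sub>F \<rho> in at_left 1. (\<rho> - \<Gamma>b) / \<Gamma>W0 \<in> {-1..1} \<and> (\<rho> - \<Gamma>b) / \<Gamma>W0 \<noteq> 1"
      proof (rule eventually_at_leftI[of \<Gamma>b])
        fix \<rho> assume "\<rho> \<in> {\<Gamma>b<..<1}"
        then have "0 < (\<rho> - \<Gamma>b) / \<Gamma>W0" "(\<rho> - \<Gamma>b) / \<Gamma>W0 < 1" using \<Gamma> by (auto simp: field_simps)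
        then show "(\<rho> - \<Gamma>b) / \<Gamma>W0 \<in> {-1..1} \<and> (\<rho> - \<Gamma>b) / \<Gamma>W0 \<noteq> 1"
          unfolding atLeastAtMost_iff by linarith
      qed (use \<Gamma> in auto)
    qed
    ultimately show "((\<lambda>\<rho>. ?\<kappa> ((\<rho> - \<Gamma>b) / \<Gamma>W0)) \<longlongrightarrow> ?\<kappa> 1) (at_left 1)"
      by (rule filterlim_compose)
  qed (use GW in auto)
  moreover have "(?\<kappa> ((\<rho> - \<Gamma>b) / \<Gamma>W0) - \<Gamma>b) / GW = g \<rho>" for \<rho>
    using GW \<Gamma> by (simp add: \<kappa>)
  moreover have "(?\<kappa> 1 - \<Gamma>b) / GW = Gamma_sigma \<sigma>"
    using GW \<kappa>1 by (simp add: field_simps)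
  ultimately have "(g \<longlongrightarrow> Gamma_sigma \<sigma>) (at_left 1)" by simp
  then have sums: "hermite_coeff \<sigma> sums Gamma_sigma \<sigma>"
    by (rule sums_from_left_limit[OF hermite_coeff_nonneg, rotated]) (rule g, auto)
  define e where "e k = (if k = 0 then \<Gamma>b else 0) + GW * hermite_coeff \<sigma> k" for k :: nat
  have "e sums (\<Gamma>b + GW * Gamma_sigma \<sigma>)"
    unfolding e_def by (intro sums_add sums_mult sums) (rule sums_single)
  moreover have "e k \<ge> 0" for k
    using \<Gamma> GW by (auto simp: e_def hermite_coeff_nonneg intro!: add_nonneg_nonneg mult_nonneg_nonneg)
  ultimately obtain p1 :: "nat pmf" where p1: "\<And>k. pmf p1 k = e k"
    using GW by (auto intro: pmf_of_sums[of e])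
  have pgf_p1: "pgf p1 \<rho> = \<Gamma>b + GW * g \<rho>" if \<rho>: "\<bar>\<rho>\<bar> < 1" for \<rho>
  proof -
    have "(\<lambda>k. (if k = 0 then \<Gamma>b * \<rho> ^ k else 0) + GW * (hermite_coeff \<sigma> k * \<rho> ^ k)) sums (\<Gamma>b * \<rho> ^ 0 + GW * g \<rho>)"
      by (intro sums_add sums_mult g \<rho>) (rule sums_single)
    moreover have "(if k = 0 then \<Gamma>b * \<rho> ^ k else 0) + GW * (hermite_coeff \<sigma> k * \<rho> ^ k) = pmf p1 k * \<rho> ^ k" for k
      by (simp add: p1 e_def distrib_right)
    ultimately show ?thesis by (simp add: pgf_def sums_iff)
  qed
  define q where "q = map_pmf (\<lambda>b. if b then 1 else 0 :: nat) (bernoulli_pmf \<Gamma>W0)"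
  have \<Gamma>W0: "0 \<le> \<Gamma>W0" "\<Gamma>W0 \<le> 1" using \<Gamma> by auto
  have pgf_q: "pgf q u = \<Gamma>b + \<Gamma>W0 * u" if "\<bar>u\<bar> \<le> 1" for u
    using \<Gamma>(3) by (simp add: pgf_eq_expectation[OF that] q_def integral_bernoulli_pmf[OF \<Gamma>W0])
  define p where "p = compound_pmf p1 q"
  have pgf_p: "?\<kappa> u = pgf p u" if u: "\<bar>u\<bar> \<le> 1" for u
  \<comment> \<open>For \<open>u < 1\<close> the correlation lies strictly between -1 and 1, also at
    \<open>u = -1\<close>, since \<open>\<Gamma>b\<close> and \<open>\<Gamma>W0\<close> are positive
    with sum 1. At \<open>u = 1\<close> both sides are 1.\<close>
  proof (cases "u = 1")
    case True
    then show ?thesis by (simp add: \<kappa>1)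
  next
    case False
    then have "u < 1" "-1 \<le> u" using u by auto
    then have "\<Gamma>W0 * u < \<Gamma>W0 * 1" "\<Gamma>W0 * (-1) \<le> \<Gamma>W0 * u"
      using \<Gamma> by (auto intro!: mult_strict_left_mono simp: mult_left_mono[of "-1" u \<Gamma>W0, simplified])
    then have "\<bar>\<Gamma>b + \<Gamma>W0 * u\<bar> < 1" unfolding abs_less_iff using \<Gamma> by linarith
    then show ?thesis by (simp add: p_def pgf_compound_pmf[OF u] pgf_q[OF u] pgf_p1 \<kappa>)
  qed
  have "pmf p 0 = \<Gamma>b + GW * g \<Gamma>b"
    using pgf_p[of 0] by (simp add: pgf_0 \<kappa>)
  moreover have "g \<Gamma>b \<ge> 0"
  proof -
    have "\<bar>\<Gamma>b\<bar> < 1" using \<Gamma> by simp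
    from g[OF this] show ?thesis
      using \<Gamma> suminf_nonneg[OF sums_summable[OF g[OF \<open>\<bar>\<Gamma>b\<bar> < 1\<close>]]]
      by (simp add: sums_unique[symmetric] hermite_coeff_nonneg)
  qed
  ultimately have "pmf p 0 > 0" using \<Gamma> GW by (simp add: add_pos_nonneg)
  then show ?thesis using that pgf_p by blast
qed


section \<open>Mean-square limits and integrals of random fields\<close>

lemma square_integrable_diff:
  assumes "square_integrable M X" "square_integrable M Z"
  shows "square_integrable M (\<lambda>\<omega>. X \<omega> - Z \<omega>)"
proof -
  have [measurable]: "X \<in> borel_measurable M" "Z \<in> borel_measurable M"
    using assms by (auto simp: square_integrable_def)
  have "integrable M (\<lambda>\<omega>. (X \<omega> - Z \<omega>)\<^sup>2)"
  proof (rule Bochner_Integration.integrable_bound)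
    show "integrable M (\<lambda>\<omega>. 2 * (X \<omega>)\<^sup>2 + 2 * (Z \<omega>)\<^sup>2)"
      using assms by (auto simp: square_integrable_def)
    have "(a - b)\<^sup>2 \<le> 2 * a\<^sup>2 + 2 * b\<^sup>2" for a b :: real
      using zero_le_power2[of "a + b"] by (simp add: power2_eq_square algebra_simps)
    then show "AE \<omega> in M. norm ((X \<omega> - Z \<omega>)\<^sup>2) \<le> norm (2 * (X \<omega>)\<^sup>2 + 2 * (Z \<omega>)\<^sup>2)"
      by (intro AE_I2) simp
  qed simp
  then show ?thesis by (simp add: square_integrable_def)
qed

lemma integrable_mult_square_integrable:
  assumes "square_integrable M X" "square_integrable M Z"
  shows "integrable M (\<lambda>\<omega>. X \<omega> * Z \<omega>)"
proof -
  have [measurable]: "X \<in> borel_measurable M" "Z \<in> borel_measurable M"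
    using assms by (auto simp: square_integrable_def)
  show ?thesis
  proof (rule Bochner_Integration.integrable_bound)
    show "integrable M (\<lambda>\<omega>. (X \<omega>)\<^sup>2 + (Z \<omega>)\<^sup>2)"
      using assms by (auto simp: square_integrable_def)
    have "\<bar>a * b\<bar> \<le> a\<^sup>2 + b\<^sup>2" for a b :: real
      using sum_squares_bound[of "\<bar>a\<bar>" "\<bar>b\<bar>"] mult_nonneg_nonneg[of "\<bar>a\<bar>" "\<bar>b\<bar>"]
      unfolding abs_mult power2_abs by linarith
    then show "AE \<omega> in M. norm (X \<omega> * Z \<omega>) \<le> norm ((X \<omega>)\<^sup>2 + (Z \<omega>)\<^sup>2)"
      by (intro AE_I2) simp
  qed simp
qed

lemma square_integrable_add:
  assumes "square_integrable M X" "square_integrable M Z"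
  shows "square_integrable M (\<lambda>\<omega>. X \<omega> + Z \<omega>)"
proof -
  have "square_integrable M (\<lambda>\<omega>. - Z \<omega>)" using assms(2) by (simp add: square_integrable_def)
  from square_integrable_diff[OF assms(1) this] show ?thesis by simp
qed

lemma square_integrable_cmult:
  "square_integrable M X \<Longrightarrow> square_integrable M (\<lambda>\<omega>. c * X \<omega>)"
  by (auto simp: square_integrable_def power_mult_distrib)

lemma square_integrable_sum:
  "(\<And>i. i \<in> A \<Longrightarrow> square_integrable M (X i)) \<Longrightarrow> square_integrable M (\<lambda>\<omega>. \<Sum>i\<in>A. X i \<omega>)"
  by (induction A rule: infinite_finite_induct) (auto intro: square_integrable_add, auto simp: square_integrable_def)

context prob_space
begin

lemma square_integrable_integrable: "square_integrable M X \<Longrightarrow> integrable M X"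
  unfolding square_integrable_def by (blast intro: square_integrable_imp_integrable)

text \<open>Completeness of the square integrable variables. Mean-square Cauchy implies Cauchy in
  mean, a subsequence then converges almost surely, and Fatou's lemma bounds the mean-square
  distance to its limit.\<close>

lemma L2_Cauchy_limit:
  assumes X: "\<And>n. square_integrable M (X n)"
    and cauchy: "\<And>e. e > 0 \<Longrightarrow> \<exists>K. \<forall>m\<ge>K. \<forall>n\<ge>K. expectation (\<lambda>\<omega>. (X m \<omega> - X n \<omega>)\<^sup>2) \<le> e"
  obtains U where "L2_tendsto M X U"
proof -
  have [measurable]: "X n \<in> borel_measurable M" for n
    using X by (auto simp: square_integrable_def)
  have diff: "integrable M (\<lambda>\<omega>. (X m \<omega> - X n \<omega>)\<^sup>2)" for m n
    using square_integrable_diff[OF X X] by (simp add: square_integrable_def)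
  have cauchy1: "\<exists>K. \<forall>m\<ge>K. \<forall>n\<ge>K. expectation (\<lambda>\<omega>. norm (X m \<omega> - X n \<omega>)) < e" if e: "e > 0" for e
  proof -
    have "e\<^sup>2 / 4 > 0" using e by simp
    from cauchy[OF this] obtain K where K: "\<And>m n. m \<ge> K \<Longrightarrow> n \<ge> K \<Longrightarrow> expectation (\<lambda>\<omega>. (X m \<omega> - X n \<omega>)\<^sup>2) \<le> e\<^sup>2 / 4"
      by blast
    have "expectation (\<lambda>\<omega>. norm (X m \<omega> - X n \<omega>)) < e" if "m \<ge> K" "n \<ge> K" for m n
    proof -
      \<comment> \<open>Integrating t \<le> t^2 / (2 e) + e / 2, the threshold e^2 / 4 for the mean
        square leaves e / 8 + e / 2, below e.\<close>
      have "expectation (\<lambda>\<omega>. norm (X m \<omega> - X n \<omega>)) \<le> expectation (\<lambda>\<omega>. (X m \<omega> - X n \<omega>)\<^sup>2 / (2 * e) + e / 2)"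
      proof (rule integral_mono)
        show "norm (X m \<omega> - X n \<omega>) \<le> (X m \<omega> - X n \<omega>)\<^sup>2 / (2 * e) + e / 2" for \<omega>
          using e sum_squares_bound[of "\<bar>X m \<omega> - X n \<omega>\<bar>" e] by (simp add: field_simps power2_eq_square)
      qed (use diff X square_integrable_integrable in auto)
      also have "\<dots> = expectation (\<lambda>\<omega>. (X m \<omega> - X n \<omega>)\<^sup>2) / (2 * e) + e / 2"
        using diff by (simp add: prob_space)
      also have "\<dots> \<le> (e\<^sup>2 / 4) / (2 * e) + e / 2"
        using e K[OF that] by (intro add_right_mono divide_right_mono) auto
      also have "\<dots> < e" using e by (simp add: power2_eq_square)
      finally show ?thesis .
    qed
    then show ?thesis by blast
  qed
  obtain r where r: "strict_mono r" "AE \<omega> in M. Cauchy (\<lambda>i. X (r i) \<omega>)"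
    by (rule cauchy_L1_AE_cauchy_subseq[OF square_integrable_integrable[OF X] cauchy1])
  define U where "U \<omega> = lim (\<lambda>i. X (r i) \<omega>)" for \<omega>
  have [measurable]: "U \<in> borel_measurable M" unfolding U_def by measurable
  have U: "AE \<omega> in M. (\<lambda>i. X (r i) \<omega>) \<longlonglongrightarrow> U \<omega>"
    using r(2) by eventually_elim (simp add: U_def convergent_LIMSEQ_iff[symmetric] real_Cauchy_convergent)
  have bound: "(\<integral>\<^sup>+\<omega>. ennreal ((X n \<omega> - U \<omega>)\<^sup>2) \<partial>M) \<le> ennreal e"
    if "e > 0" "\<forall>m\<ge>K. \<forall>n\<ge>K. expectation (\<lambda>\<omega>. (X m \<omega> - X n \<omega>)\<^sup>2) \<le> e" "n \<ge> K" for e K n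
  proof -
    have "(\<integral>\<^sup>+\<omega>. ennreal ((X n \<omega> - U \<omega>)\<^sup>2) \<partial>M) = (\<integral>\<^sup>+\<omega>. liminf (\<lambda>i. ennreal ((X n \<omega> - X (r i) \<omega>)\<^sup>2)) \<partial>M)"
    proof (rule nn_integral_cong_AE)
      show "AE \<omega> in M. ennreal ((X n \<omega> - U \<omega>)\<^sup>2) = liminf (\<lambda>i. ennreal ((X n \<omega> - X (r i) \<omega>)\<^sup>2))"
        using U
      proof eventually_elim
        case (elim \<omega>)
        have "(\<lambda>i. ennreal ((X n \<omega> - X (r i) \<omega>)\<^sup>2)) \<longlonglongrightarrow> ennreal ((X n \<omega> - U \<omega>)\<^sup>2)"
          by (intro tendsto_intros elim)
        then show ?case by (rule lim_imp_Liminf[OF sequentially_bot, symmetric])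
      qed
    qed
    also have "\<dots> \<le> liminf (\<lambda>i. \<integral>\<^sup>+\<omega>. ennreal ((X n \<omega> - X (r i) \<omega>)\<^sup>2) \<partial>M)"
      by (rule nn_integral_liminf) measurable
    also have "\<dots> \<le> ennreal e"
    proof (rule Liminf_le)
      show "\<forall>\<^sub>F i in sequentially. (\<integral>\<^sup>+\<omega>. ennreal ((X n \<omega> - X (r i) \<omega>)\<^sup>2) \<partial>M) \<le> ennreal e"
        using eventually_ge_at_top[of K]
      proof eventually_elim
        case (elim i)
        then have "r i \<ge> K" using seq_suble[OF r(1), of i] by simp
        then show ?case
          using that diff by (subst nn_integral_eq_integral) (auto intro: ennreal_leI)
      qed
    qed simp
    finally show ?thesis .
  qed
  have int: "integrable M (\<lambda>\<omega>. (X n \<omega> - U \<omega>)\<^sup>2)" and le: "expectation (\<lambda>\<omega>. (X n \<omega> - U \<omega>)\<^sup>2) \<le> e"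
    if "e > 0" "\<forall>m\<ge>K. \<forall>n\<ge>K. expectation (\<lambda>\<omega>. (X m \<omega> - X n \<omega>)\<^sup>2) \<le> e" "n \<ge> K" for e K n
  proof -
    have fin: "(\<integral>\<^sup>+\<omega>. ennreal (norm ((X n \<omega> - U \<omega>)\<^sup>2)) \<partial>M) < \<infinity>"
      using bound[OF that] by (simp add: order_le_less_trans)
    show int: "integrable M (\<lambda>\<omega>. (X n \<omega> - U \<omega>)\<^sup>2)"
      by (rule integrableI_bounded[OF _ fin]) measurable
    have "ennreal (expectation (\<lambda>\<omega>. (X n \<omega> - U \<omega>)\<^sup>2)) \<le> ennreal e"
      using bound[OF that] int by (subst (asm) nn_integral_eq_integral) auto
    then show "expectation (\<lambda>\<omega>. (X n \<omega> - U \<omega>)\<^sup>2) \<le> e"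
      using that(1) by (simp add: ennreal_le_iff)
  qed
  obtain K1 where K1: "\<forall>m\<ge>K1. \<forall>n\<ge>K1. expectation (\<lambda>\<omega>. (X m \<omega> - X n \<omega>)\<^sup>2) \<le> 1"
    using cauchy[of 1] by auto
  have "square_integrable M (\<lambda>\<omega>. X K1 \<omega> - U \<omega>)"
    using int[OF _ K1, of K1] by (simp add: square_integrable_def)
  from square_integrable_diff[OF X[of K1] this] have sqU: "square_integrable M U" by simp
  have "(\<lambda>n. expectation (\<lambda>\<omega>. (X n \<omega> - U \<omega>)\<^sup>2)) \<longlonglongrightarrow> 0"
  proof (rule LIMSEQ_I)
    fix e :: real assume e: "e > 0"
    then obtain K where "\<forall>m\<ge>K. \<forall>n\<ge>K. expectation (\<lambda>\<omega>. (X m \<omega> - X n \<omega>)\<^sup>2) \<le> e / 2"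
      using cauchy[of "e / 2"] by auto
    then have "expectation (\<lambda>\<omega>. (X n \<omega> - U \<omega>)\<^sup>2) \<le> e / 2" if "n \<ge> K" for n
      using le[of "e / 2" K n] e that by simp
    then have "norm (expectation (\<lambda>\<omega>. (X n \<omega> - U \<omega>)\<^sup>2) - 0) < e" if "n \<ge> K" for n
      using that e by (fastforce simp: abs_of_nonneg)
    then show "\<exists>K. \<forall>n\<ge>K. norm (expectation (\<lambda>\<omega>. (X n \<omega> - U \<omega>)\<^sup>2) - 0) < e" by blast
  qed
  then have "L2_tendsto M X U"
    using X sqU by (simp add: L2_tendsto_def)
  then show ?thesis by (rule that)
qed

lemma expectation_square_le:
  assumes "square_integrable M X"
  shows "(expectation X)\<^sup>2 \<le> expectation (\<lambda>\<omega>. (X \<omega>)\<^sup>2)"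
proof -
  have "integrable M (\<lambda>\<omega>. (X \<omega>)\<^sup>2)" using assms by (simp add: square_integrable_def)
  from variance_eq[OF square_integrable_integrable[OF assms] this] variance_positive[of X]
  show ?thesis by linarith
qed

lemma L2_tendsto_moments:
  assumes XU: "L2_tendsto M X U" and X: "\<And>n. square_integrable M (X n)"
  shows "(\<lambda>n. expectation (X n)) \<longlonglongrightarrow> expectation U"
    and "(\<lambda>n. expectation (\<lambda>\<omega>. (X n \<omega>)\<^sup>2)) \<longlonglongrightarrow> expectation (\<lambda>\<omega>. (U \<omega>)\<^sup>2)"
proof -
  have U: "square_integrable M U" and lim: "(\<lambda>n. expectation (\<lambda>\<omega>. (X n \<omega> - U \<omega>)\<^sup>2)) \<longlonglongrightarrow> 0"
    using XU by (auto simp: L2_tendsto_def)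
  note D = square_integrable_diff[OF X U]
  have "(\<lambda>n. (expectation (X n) - expectation U)\<^sup>2) \<longlonglongrightarrow> 0"
  proof (rule tendsto_sandwich[OF _ _ tendsto_const lim])
    show "\<forall>\<^sub>F n in sequentially. (expectation (X n) - expectation U)\<^sup>2 \<le> expectation (\<lambda>\<omega>. (X n \<omega> - U \<omega>)\<^sup>2)"
      using expectation_square_le[OF D] square_integrable_integrable X U by simp
  qed auto
  then have "(\<lambda>n. sqrt ((expectation (X n) - expectation U)\<^sup>2)) \<longlonglongrightarrow> sqrt 0"
    by (rule tendsto_real_sqrt)
  then have "(\<lambda>n. expectation (X n) - expectation U) \<longlonglongrightarrow> 0"
    by (simp add: tendsto_rabs_zero_iff)
  then show "(\<lambda>n. expectation (X n)) \<longlonglongrightarrow> expectation U"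
    by (simp add: LIM_zero_iff)
  define u where "u = expectation (\<lambda>\<omega>. (U \<omega>)\<^sup>2)"
  have u: "u \<ge> 0" by (simp add: u_def)
  have sq: "integrable M (\<lambda>\<omega>. (X n \<omega>)\<^sup>2)" "integrable M (\<lambda>\<omega>. (U \<omega>)\<^sup>2)" "integrable M (\<lambda>\<omega>. (X n \<omega> - U \<omega>)\<^sup>2)" for n
    using X U D by (auto simp: square_integrable_def)
  \<comment> \<open>Young's inequality with weight \<eta> on the cross term of a^2 + 2 a b: the
    distance to the limit enters with the constant 1 + 1 / \<eta>, the limit itself only with the
    small factor \<eta>.\<close>
  have est: "\<bar>expectation (\<lambda>\<omega>. (X n \<omega>)\<^sup>2) - u\<bar> \<le> (1 + 1 / \<eta>) * expectation (\<lambda>\<omega>. (X n \<omega> - U \<omega>)\<^sup>2) + \<eta> * u"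
    if \<eta>: "\<eta> > 0" for \<eta> n
  proof -
    have "\<bar>expectation (\<lambda>\<omega>. (X n \<omega>)\<^sup>2 - (U \<omega>)\<^sup>2)\<bar> \<le> expectation (\<lambda>\<omega>. \<bar>(X n \<omega>)\<^sup>2 - (U \<omega>)\<^sup>2\<bar>)"
      by (rule integral_abs_bound)
    also have "\<dots> \<le> expectation (\<lambda>\<omega>. (1 + 1 / \<eta>) * (X n \<omega> - U \<omega>)\<^sup>2 + \<eta> * (U \<omega>)\<^sup>2)"
    proof (rule integral_mono)
      fix \<omega>
      define a where "a = X n \<omega> - U \<omega>"
      define b where "b = U \<omega>"
      have "2 * (\<bar>a\<bar> / sqrt \<eta>) * (sqrt \<eta> * \<bar>b\<bar>) \<le> (\<bar>a\<bar> / sqrt \<eta>)\<^sup>2 + (sqrt \<eta> * \<bar>b\<bar>)\<^sup>2"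
        by (rule sum_squares_bound)
      then have ab: "2 * (\<bar>a\<bar> * \<bar>b\<bar>) \<le> a\<^sup>2 / \<eta> + \<eta> * b\<^sup>2"
        using \<eta> by (simp add: power_divide power_mult_distrib)
      have "(X n \<omega>)\<^sup>2 - (U \<omega>)\<^sup>2 = a\<^sup>2 + 2 * (a * b)"
        by (simp add: a_def b_def power2_eq_square algebra_simps)
      then have "\<bar>(X n \<omega>)\<^sup>2 - (U \<omega>)\<^sup>2\<bar> \<le> a\<^sup>2 + 2 * (\<bar>a\<bar> * \<bar>b\<bar>)"
        using abs_triangle_ineq[of "a\<^sup>2" "2 * (a * b)"] by (simp add: abs_mult)
      also have "\<dots> \<le> (1 + 1 / \<eta>) * a\<^sup>2 + \<eta> * b\<^sup>2"
        using ab by (simp add: distrib_right)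
      finally show "\<bar>(X n \<omega>)\<^sup>2 - (U \<omega>)\<^sup>2\<bar> \<le> (1 + 1 / \<eta>) * (X n \<omega> - U \<omega>)\<^sup>2 + \<eta> * (U \<omega>)\<^sup>2"
        by (simp add: a_def b_def)
    qed (use sq in auto)
    also have "\<dots> = (1 + 1 / \<eta>) * expectation (\<lambda>\<omega>. (X n \<omega> - U \<omega>)\<^sup>2) + \<eta> * u"
      using sq by (simp add: u_def)
    finally show ?thesis using sq by (simp add: u_def)
  qed
  show "(\<lambda>n. expectation (\<lambda>\<omega>. (X n \<omega>)\<^sup>2)) \<longlonglongrightarrow> expectation (\<lambda>\<omega>. (U \<omega>)\<^sup>2)"
    unfolding u_def[symmetric]
  proof (rule LIMSEQ_I)
    fix e :: real assume e: "e > 0"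
    define \<eta> where "\<eta> = e / (2 * (u + 1))"
    have "\<eta> * u \<le> e / 2" using e u by (simp add: \<eta>_def field_simps)
    then have \<eta>: "\<eta> > 0" "\<eta> * u < e / 2 + e / 4"
      using e u by (simp add: \<eta>_def, linarith)
    have "(\<lambda>n. (1 + 1 / \<eta>) * expectation (\<lambda>\<omega>. (X n \<omega> - U \<omega>)\<^sup>2)) \<longlonglongrightarrow> (1 + 1 / \<eta>) * 0"
      by (intro tendsto_intros lim)
    then have "\<forall>\<^sub>F n in sequentially. (1 + 1 / \<eta>) * expectation (\<lambda>\<omega>. (X n \<omega> - U \<omega>)\<^sup>2) < e / 4"
      using e by (intro order_tendstoD(2)[where y = 0]) auto
    then have "\<forall>\<^sub>F n in sequentially. norm (expectation (\<lambda>\<omega>. (X n \<omega>)\<^sup>2) - u) < e"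
    proof eventually_elim
      case (elim n)
      then show ?case using est[OF \<eta>(1), of n] \<eta>(2) unfolding real_norm_def by linarith
    qed
    then show "\<exists>K. \<forall>n\<ge>K. norm (expectation (\<lambda>\<omega>. (X n \<omega>)\<^sup>2) - u) < e"
      by (simp add: eventually_at_top_linorder)
  qed
qed

end

lemma integrable_product_mult:
  assumes "sigma_finite_measure M1" "sigma_finite_measure M2"
    and g: "integrable M1 g" and h: "integrable M2 h"
  shows "integrable (M1 \<Otimes>\<^sub>M M2) (\<lambda>v. g (fst v) * h (snd v) :: real)"
    and "(\<integral>v. g (fst v) * h (snd v) \<partial>(M1 \<Otimes>\<^sub>M M2)) = (\<integral>x. g x \<partial>M1) * (\<integral>x. h x \<partial>M2)"
proof -
  interpret P: pair_sigma_finite M1 M2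
    using assms by (simp add: pair_sigma_finite_def)
  have [measurable]: "g \<in> borel_measurable M1" "h \<in> borel_measurable M2"
    using g h by auto
  show int: "integrable (M1 \<Otimes>\<^sub>M M2) (\<lambda>v. g (fst v) * h (snd v))"
    using g h by (intro P.Fubini_integrable) (auto simp: abs_mult)
  show "(\<integral>v. g (fst v) * h (snd v) \<partial>(M1 \<Otimes>\<^sub>M M2)) = (\<integral>x. g x \<partial>M1) * (\<integral>x. h x \<partial>M2)"
    using P.integral_fst'[OF int] by simp
qed

section \<open>Integrals of a random field against bounded functions\<close>

context
  fixes M :: "'w measure" and S :: "'a measure" and X :: "'a \<Rightarrow> 'w \<Rightarrow> real" and B :: real
  assumes M: "prob_space M" and S: "finite_measure S"
    and X_meas: "(\<lambda>(x, \<omega>). X x \<omega>) \<in> borel_measurable (S \<Otimes>\<^sub>M M)"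
    and X_sq: "\<And>x. x \<in> space S \<Longrightarrow> square_integrable M (X x)"
    and X_bound: "\<And>x. x \<in> space S \<Longrightarrow> (\<integral>\<omega>. (X x \<omega>)\<^sup>2 \<partial>M) \<le> B"
    and X_mean: "\<And>x. x \<in> space S \<Longrightarrow> (\<integral>\<omega>. X x \<omega> \<partial>M) = 0"
begin

interpretation M: prob_space M by (rule M)
interpretation S: finite_measure S by (rule S)
interpretation SS: pair_sigma_finite S S ..
interpretation SS: finite_measure "S \<Otimes>\<^sub>M S" by (rule finite_measure_pair_measure) unfold_locales
interpretation SM: pair_sigma_finite S M ..
interpretation SSM: pair_sigma_finite "S \<Otimes>\<^sub>M S" M ..

lemma field_measurable [measurable]: "(\<lambda>v. X (fst v) (snd v)) \<in> borel_measurable (S \<Otimes>\<^sub>M M)"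
  using X_meas by (simp add: case_prod_beta)

definition field_integral :: "('a \<Rightarrow> real) \<Rightarrow> 'w \<Rightarrow> real" where
  "field_integral h \<omega> = (\<integral>x. X x \<omega> * h x \<partial>S)"

lemma field_expectation_abs_le:
  assumes x: "x \<in> space S" shows "(\<integral>\<omega>. \<bar>X x \<omega>\<bar> \<partial>M) \<le> B + 1"
proof -
  have "(\<integral>\<omega>. \<bar>X x \<omega>\<bar> \<partial>M) \<le> (\<integral>\<omega>. (X x \<omega>)\<^sup>2 + 1 \<partial>M)"
  proof (rule integral_mono)
    show "\<bar>X x \<omega>\<bar> \<le> (X x \<omega>)\<^sup>2 + 1" for \<omega>
      using sum_squares_bound[of "\<bar>X x \<omega>\<bar>" 1] abs_ge_zero[of "X x \<omega>"]
      unfolding power2_abs one_power2 by linarith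
    show "integrable M (\<lambda>\<omega>. \<bar>X x \<omega>\<bar>)"
      using M.square_integrable_integrable[OF X_sq[OF x]] by simp
    show "integrable M (\<lambda>\<omega>. (X x \<omega>)\<^sup>2 + 1)"
      using X_sq[OF x] by (simp add: square_integrable_def)
  qed
  also have "\<dots> \<le> B + 1"
    using X_sq[OF x] X_bound[OF x] by (simp add: square_integrable_def M.prob_space)
  finally show ?thesis .
qed

lemma field_integral_integrable:
  assumes [measurable]: "h \<in> borel_measurable S" and h: "\<And>x. x \<in> space S \<Longrightarrow> \<bar>h x\<bar> \<le> C"
  shows "integrable (S \<Otimes>\<^sub>M M) (\<lambda>v. X (fst v) (snd v) * h (fst v))"
proof (rule SM.Fubini_integrable)
  show "AE x in S. integrable M (\<lambda>\<omega>. X (fst (x, \<omega>)) (snd (x, \<omega>)) * h (fst (x, \<omega>)))"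
    using M.square_integrable_integrable[OF X_sq] by (intro AE_I2) auto
  show "integrable S (\<lambda>x. \<integral>\<omega>. norm (X (fst (x, \<omega>)) (snd (x, \<omega>)) * h (fst (x, \<omega>))) \<partial>M)"
  proof (rule S.integrable_const_bound[where B = "(B + 1) * C"])
    show "AE x in S. norm (\<integral>\<omega>. norm (X (fst (x, \<omega>)) (snd (x, \<omega>)) * h (fst (x, \<omega>))) \<partial>M) \<le> (B + 1) * C"
    proof (rule AE_I2)
      fix x assume x: "x \<in> space S"
      have "(\<integral>\<omega>. \<bar>X x \<omega>\<bar> \<partial>M) * \<bar>h x\<bar> \<le> (B + 1) * C"
      proof (rule mult_mono)
        have "0 \<le> (\<integral>\<omega>. \<bar>X x \<omega>\<bar> \<partial>M)" by simp
        then show "0 \<le> B + 1" using field_expectation_abs_le[OF x] by linarith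
      qed (use field_expectation_abs_le[OF x] h[OF x] in auto)
      then show "norm (\<integral>\<omega>. norm (X (fst (x, \<omega>)) (snd (x, \<omega>)) * h (fst (x, \<omega>))) \<partial>M) \<le> (B + 1) * C"
        by (simp add: abs_mult)
    qed
  qed measurable
qed measurable

lemma borel_measurable_field_integral [measurable]:
  assumes [measurable]: "h \<in> borel_measurable S"
  shows "field_integral h \<in> borel_measurable M"
proof -
  have "(\<lambda>(\<omega>, x). X x \<omega> * h x) \<in> borel_measurable (M \<Otimes>\<^sub>M S)"
    using measurable_compose[OF measurable_pair_swap' field_measurable] by (simp add: case_prod_beta)
  then show ?thesis
    unfolding field_integral_def by (rule S.borel_measurable_lebesgue_integral)
qed

lemma expectation_field_integral:
  assumes [measurable]: "h \<in> borel_measurable S" and h: "\<And>x. x \<in> space S \<Longrightarrow> \<bar>h x\<bar> \<le> C"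
  shows "(\<integral>\<omega>. field_integral h \<omega> \<partial>M) = 0"
proof -
  have int: "integrable (S \<Otimes>\<^sub>M M) (case_prod (\<lambda>x \<omega>. X x \<omega> * h x))"
    using field_integral_integrable[OF assms] by (simp add: case_prod_unfold)
  have "(\<integral>\<omega>. field_integral h \<omega> \<partial>M) = (\<integral>x. (\<integral>\<omega>. X x \<omega> * h x \<partial>M) \<partial>S)"
    unfolding field_integral_def using SM.integral_snd[OF int] SM.integral_fst[OF int] by simp
  also have "\<dots> = (\<integral>x. 0 \<partial>S)"
    by (intro Bochner_Integration.integral_cong) (auto simp: X_mean)
  finally show ?thesis by simp
qed

text \<open>Fubini on two copies of \<open>S\<close> and one of \<open>M\<close>: for a fixed path
  the product of the two integrals is a double integral, and its expectation brings in the
  covariance of the field.\<close>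

lemma field_integral_mult:
  assumes g_meas [measurable]: "g \<in> borel_measurable S" and g: "\<And>x. x \<in> space S \<Longrightarrow> \<bar>g x\<bar> \<le> C"
    and h_meas [measurable]: "h \<in> borel_measurable S" and h: "\<And>x. x \<in> space S \<Longrightarrow> \<bar>h x\<bar> \<le> C'"
  shows "integrable M (\<lambda>\<omega>. field_integral g \<omega> * field_integral h \<omega>)"
    and "(\<integral>\<omega>. field_integral g \<omega> * field_integral h \<omega> \<partial>M) =
      (\<integral>x. (\<integral>y. (\<integral>\<omega>. X x \<omega> * X y \<omega> \<partial>M) * (g x * h y) \<partial>S) \<partial>S)"
proof -
  define F where "F v \<omega> = X (fst v) \<omega> * g (fst v) * (X (snd v) \<omega> * h (snd v))" for v \<omega>
  have [measurable]: "(\<lambda>w. X (fst (fst w)) (snd w)) \<in> borel_measurable ((S \<Otimes>\<^sub>M S) \<Otimes>\<^sub>M M)"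
    "(\<lambda>w. X (snd (fst w)) (snd w)) \<in> borel_measurable ((S \<Otimes>\<^sub>M S) \<Otimes>\<^sub>M M)"
    using measurable_compose[of "\<lambda>w. (fst (fst w), snd w)" "(S \<Otimes>\<^sub>M S) \<Otimes>\<^sub>M M" "S \<Otimes>\<^sub>M M", OF _ field_measurable]
      measurable_compose[of "\<lambda>w. (snd (fst w), snd w)" "(S \<Otimes>\<^sub>M S) \<Otimes>\<^sub>M M" "S \<Otimes>\<^sub>M M", OF _ field_measurable] by auto
  have F_meas [measurable]: "(\<lambda>w. F (fst w) (snd w)) \<in> borel_measurable ((S \<Otimes>\<^sub>M S) \<Otimes>\<^sub>M M)"
    unfolding F_def by measurable
  have F_int: "integrable M (F (x, y))" if "x \<in> space S" "y \<in> space S" for x y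
  proof -
    have "integrable M (\<lambda>\<omega>. (g x * h y) * (X x \<omega> * X y \<omega>))"
      using that X_sq by (intro integrable_mult_right integrable_mult_square_integrable)
    moreover have "F (x, y) = (\<lambda>\<omega>. (g x * h y) * (X x \<omega> * X y \<omega>))"
      by (simp add: F_def fun_eq_iff mult_ac)
    ultimately show ?thesis by simp
  qed
  have F_bound: "(\<integral>\<omega>. norm (F (x, y) \<omega>) \<partial>M) \<le> B * (\<bar>C\<bar> * \<bar>C'\<bar>)" if "x \<in> space S" "y \<in> space S" for x y
  proof -
    have "(\<integral>\<omega>. norm (F (x, y) \<omega>) \<partial>M) \<le> (\<integral>\<omega>. ((X x \<omega>)\<^sup>2 + (X y \<omega>)\<^sup>2) / 2 * (\<bar>C\<bar> * \<bar>C'\<bar>) \<partial>M)"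
    proof (rule integral_mono)
      fix \<omega>
      have "\<bar>X x \<omega>\<bar> * \<bar>X y \<omega>\<bar> \<le> ((X x \<omega>)\<^sup>2 + (X y \<omega>)\<^sup>2) / 2"
        using sum_squares_bound[of "\<bar>X x \<omega>\<bar>" "\<bar>X y \<omega>\<bar>"] by simp
      moreover have "\<bar>g x\<bar> * \<bar>h y\<bar> \<le> \<bar>C\<bar> * \<bar>C'\<bar>"
        using order_trans[OF g[OF that(1)] abs_ge_self] order_trans[OF h[OF that(2)] abs_ge_self]
        by (intro mult_mono) auto
      ultimately have "(\<bar>X x \<omega>\<bar> * \<bar>X y \<omega>\<bar>) * (\<bar>g x\<bar> * \<bar>h y\<bar>) \<le> ((X x \<omega>)\<^sup>2 + (X y \<omega>)\<^sup>2) / 2 * (\<bar>C\<bar> * \<bar>C'\<bar>)"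
        by (rule mult_mono) auto
      then show "norm (F (x, y) \<omega>) \<le> ((X x \<omega>)\<^sup>2 + (X y \<omega>)\<^sup>2) / 2 * (\<bar>C\<bar> * \<bar>C'\<bar>)"
        by (simp add: F_def abs_mult mult_ac)
    qed (use F_int that X_sq in \<open>auto simp: square_integrable_def\<close>)
    also have "\<dots> = ((\<integral>\<omega>. (X x \<omega>)\<^sup>2 \<partial>M) + (\<integral>\<omega>. (X y \<omega>)\<^sup>2 \<partial>M)) / 2 * (\<bar>C\<bar> * \<bar>C'\<bar>)"
      using X_sq that by (simp add: square_integrable_def)
    also have "\<dots> \<le> (B + B) / 2 * (\<bar>C\<bar> * \<bar>C'\<bar>)"
      using X_bound that by (intro mult_right_mono divide_right_mono add_mono) auto
    finally show ?thesis by simp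
  qed
  have int: "integrable ((S \<Otimes>\<^sub>M S) \<Otimes>\<^sub>M M) (\<lambda>w. F (fst w) (snd w))"
  proof (rule SSM.Fubini_integrable)
    show "AE v in S \<Otimes>\<^sub>M S. integrable M (\<lambda>\<omega>. F (fst (v, \<omega>)) (snd (v, \<omega>)))"
      using F_int by (intro AE_I2) (auto simp: space_pair_measure)
    show "integrable (S \<Otimes>\<^sub>M S) (\<lambda>v. \<integral>\<omega>. norm (F (fst (v, \<omega>)) (snd (v, \<omega>))) \<partial>M)"
      using F_bound by (intro SS.integrable_const_bound[where B = "B * (\<bar>C\<bar> * \<bar>C'\<bar>)"] AE_I2)
        (auto simp: space_pair_measure)
  qed measurable
  then have int': "integrable ((S \<Otimes>\<^sub>M S) \<Otimes>\<^sub>M M) (case_prod F)"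
    by (simp add: case_prod_unfold)
  \<comment> \<open>On a null set of paths an integral may fail to exist and then defaults to 0, so
    the factorisation is claimed only almost everywhere.\<close>
  have AE: "AE \<omega> in M. (\<integral>v. F v \<omega> \<partial>(S \<Otimes>\<^sub>M S)) = field_integral g \<omega> * field_integral h \<omega>"
  proof -
    have "AE \<omega> in M. integrable S (\<lambda>x. X x \<omega> * g x)"
      using SM.AE_integrable_snd[of "\<lambda>x \<omega>. X x \<omega> * g x"] field_integral_integrable[OF g_meas g]
      by (simp add: case_prod_unfold)
    moreover have "AE \<omega> in M. integrable S (\<lambda>x. X x \<omega> * h x)"
      using SM.AE_integrable_snd[of "\<lambda>x \<omega>. X x \<omega> * h x"] field_integral_integrable[OF h_meas h]
      by (simp add: case_prod_unfold)
    ultimately show ?thesis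
    proof eventually_elim
      case (elim \<omega>)
      show ?case
        using integrable_product_mult(2)[OF S.sigma_finite_measure_axioms S.sigma_finite_measure_axioms elim]
        by (simp add: F_def field_integral_def)
    qed
  qed
  have intM: "integrable M (\<lambda>\<omega>. \<integral>v. F v \<omega> \<partial>(S \<Otimes>\<^sub>M S))"
    by (rule SSM.integrable_snd[OF int'])
  then show "integrable M (\<lambda>\<omega>. field_integral g \<omega> * field_integral h \<omega>)"
    by (subst integrable_cong_AE[OF _ _ AE, symmetric]) auto
  have "(\<integral>\<omega>. field_integral g \<omega> * field_integral h \<omega> \<partial>M) = (\<integral>\<omega>. (\<integral>v. F v \<omega> \<partial>(S \<Otimes>\<^sub>M S)) \<partial>M)"
    using borel_measurable_integrable[OF intM] by (intro integral_cong_AE[OF _ _ AE, symmetric]) auto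
  also have "\<dots> = (\<integral>v. (\<integral>\<omega>. F v \<omega> \<partial>M) \<partial>(S \<Otimes>\<^sub>M S))"
    using SSM.integral_snd[OF int'] SSM.integral_fst[OF int'] by simp
  also have "\<dots> = (\<integral>x. (\<integral>y. (\<integral>\<omega>. F (x, y) \<omega> \<partial>M) \<partial>S) \<partial>S)"
    using SSM.integrable_fst[OF int'] by (subst SS.integral_fst') auto
  also have "\<dots> = (\<integral>x. (\<integral>y. (\<integral>\<omega>. X x \<omega> * X y \<omega> \<partial>M) * (g x * h y) \<partial>S) \<partial>S)"
  proof -
    have "(\<integral>\<omega>. F (x, y) \<omega> \<partial>M) = (\<integral>\<omega>. X x \<omega> * X y \<omega> \<partial>M) * (g x * h y)" for x y
      unfolding integral_mult_left_zero[symmetric] by (simp add: F_def mult_ac)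
    then show ?thesis by simp
  qed
  finally show "(\<integral>\<omega>. field_integral g \<omega> * field_integral h \<omega> \<partial>M) =
      (\<integral>x. (\<integral>y. (\<integral>\<omega>. X x \<omega> * X y \<omega> \<partial>M) * (g x * h y) \<partial>S) \<partial>S)" .
qed

lemma square_integrable_field_integral:
  assumes "h \<in> borel_measurable S" "\<And>x. x \<in> space S \<Longrightarrow> \<bar>h x\<bar> \<le> C"
  shows "square_integrable M (field_integral h)"
  using field_integral_mult(1)[OF assms assms] borel_measurable_field_integral[OF assms(1)]
  by (simp add: square_integrable_def power2_eq_square)

end


section \<open>Harmonic analysis on the sphere\<close>

lemma space_sphere_measure [simp]: "space sphere_measure = sphere 0 1"
  by (simp add: sphere_measure_def space_restrict_space)

lemma sets_sphere_measure: "sets sphere_measure = sets (restrict_space borel (sphere 0 1))"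
  by (simp add: sphere_measure_def sets_restrict_space)

lemma measurable_sphere_measure_borel:
  "f \<in> borel_measurable borel \<Longrightarrow> f \<in> borel_measurable sphere_measure"
  by (subst measurable_cong_sets[OF sets_sphere_measure refl]) (rule measurable_restrict_space1)

lemma measurable_id_sphere_measure [measurable]: "(\<lambda>x. x) \<in> measurable sphere_measure borel"
  by (subst measurable_cong_sets[OF sets_sphere_measure refl]) (rule measurable_restrict_space1, simp)

lemma finite_measure_sphere_measure: "finite_measure (sphere_measure :: 'a::euclidean_space measure)"
proof
  define \<mu> where "\<mu> = density lborel (\<lambda>x::'a. of_nat DIM('a) * indicator (ball 0 1) x :: ennreal)"
  have "emeasure \<mu> UNIV = of_nat DIM('a) * emeasure lborel (ball (0::'a) 1)"
  proof -
    have "(\<lambda>x::'a. c * indicator (ball 0 1) x) \<in> borel_measurable lborel" for c :: ennreal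
      by (intro borel_measurable_times_ennreal borel_measurable_const borel_measurable_indicator) simp
    then show ?thesis
      unfolding \<mu>_def by (subst emeasure_density) (simp_all add: nn_integral_cmult_indicator)
  qed
  also have "\<dots> < \<infinity>"
    using emeasure_bounded_finite[of "ball (0::'a) 1"] by (auto simp: ennreal_mult_less_top of_nat_less_top)
  finally have fin: "emeasure \<mu> UNIV < \<infinity>" .
  have "emeasure (sphere_measure :: 'a measure) (sphere 0 1) = emeasure (distr \<mu> borel sgn) (sphere 0 1)"
    unfolding sphere_measure_def \<mu>_def[symmetric] by (subst emeasure_restrict_space) auto
  also have "\<dots> \<le> emeasure (distr \<mu> borel sgn) (space (distr \<mu> borel sgn))"
    by (rule emeasure_space)
  also have "\<dots> = emeasure \<mu> UNIV"
    by (subst emeasure_distr) (auto simp: \<mu>_def)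
  finally show "emeasure (sphere_measure :: 'a measure) (space sphere_measure) \<noteq> \<infinity>"
    using fin by (simp add: order_le_less_trans top.not_eq_extremum)
qed

lemma spherical_harmonic_bounded_measurable:
  fixes h :: "'a::euclidean_space \<Rightarrow> real"
  assumes "spherical_harmonic l h"
  shows "h \<in> borel_measurable sphere_measure" and "\<exists>C. \<forall>x\<in>sphere 0 1. \<bar>h x\<bar> \<le> C"
proof -
  obtain p where p: "real_polynomial_function p" and hp: "\<And>x. x \<in> sphere 0 1 \<Longrightarrow> h x = p x"
    using assms by (auto simp: spherical_harmonic_def)
  have cont: "continuous_on UNIV p"
    using p by (simp add: continuous_on_polymonial_function real_polynomial_function_eq)
  have "p \<in> borel_measurable sphere_measure"
    by (intro measurable_sphere_measure_borel borel_measurable_continuous_onI cont)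
  then show "h \<in> borel_measurable sphere_measure"
    using hp by (subst measurable_cong[where g = p]) auto
  have "bounded (p ` sphere 0 1)"
    by (intro compact_imp_bounded compact_continuous_image continuous_on_subset[OF cont]) auto
  then show "\<exists>C. \<forall>x\<in>sphere 0 1. \<bar>h x\<bar> \<le> C"
    using hp by (auto simp: bounded_iff)
qed

lemma inner_sphere_abs_le: "y \<in> sphere 0 1 \<Longrightarrow> z \<in> sphere 0 1 \<Longrightarrow> \<bar>y \<bullet> z\<bar> \<le> 1" for y z :: "'a::euclidean_space"
  using Cauchy_Schwarz_ineq2[of y z] by simp

section \<open>Angular power spectrum of a generating function\<close>

context
  fixes d :: real
  assumes d: "d \<ge> 2"
begin

text \<open>The total weight of the \<open>l\<close>-th Legendre polynomial in \<open>pgf q\<close>.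
  As these polynomials are 1 at 1, it is the variance carried by degree \<open>l\<close> at each
  point for a field with covariance \<open>pgf q\<close>.\<close>

definition angular_power :: "nat pmf \<Rightarrow> nat \<Rightarrow> real" where
  "angular_power q l = (\<Sum>k. pmf q k * legendre_coeff d k l)"

lemma legendre_coeff_le_1: "legendre_coeff d k l \<le> 1"
proof (cases "l \<le> k")
  case True
  then have "legendre_coeff d k l \<le> (\<Sum>l\<le>k. legendre_coeff d k l)"
    by (intro member_le_sum) (auto simp: legendre_coeff_nonneg[OF d])
  then show ?thesis by (simp add: sum_legendre_coeff[OF d])
qed (simp add: legendre_coeff_eq_0[OF d])

lemma summable_angular_power: "summable (\<lambda>k. pmf q k * legendre_coeff d k l)"
proof (rule summable_comparison_test')
  show "summable (pmf q)" using pmf_nat_sums[of q] by (rule sums_summable)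
  show "norm (pmf q k * legendre_coeff d k l) \<le> pmf q k" if "k \<ge> 0" for k
    using mult_left_mono[OF legendre_coeff_le_1[of k l], of "pmf q k"] legendre_coeff_nonneg[OF d, of k l]
    by (simp add: abs_mult)
qed

lemma angular_power_nonneg: "angular_power q l \<ge> 0"
  unfolding angular_power_def by (intro suminf_nonneg summable_angular_power) (simp add: legendre_coeff_nonneg[OF d])

end

section \<open>Zonal functions in a basis of spherical harmonics\<close>

context
  fixes d :: real and N :: "nat \<Rightarrow> nat" and Y :: "nat \<Rightarrow> nat \<Rightarrow> 'a::euclidean_space \<Rightarrow> real"
  assumes d: "d \<ge> 2" and dim: "real DIM('a) = d + 1" and basis: "spherical_harmonic_basis N Y"
begin

interpretation S: finite_measure "sphere_measure :: 'a measure" by (rule finite_measure_sphere_measure)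
interpretation SS: pair_sigma_finite "sphere_measure :: 'a measure" "sphere_measure :: 'a measure" ..
interpretation SS: finite_measure "(sphere_measure :: 'a measure) \<Otimes>\<^sub>M (sphere_measure :: 'a measure)"
  by (rule finite_measure_pair_measure) unfold_locales

lemma harmonic_basis: "m < N l \<Longrightarrow> spherical_harmonic l (Y l m)"
  using basis by (simp add: spherical_harmonic_basis_def)

lemma harmonic_basis_measurable: "m < N l \<Longrightarrow> Y l m \<in> borel_measurable sphere_measure"
  by (rule spherical_harmonic_bounded_measurable[OF harmonic_basis])

lemma harmonic_basis_bounded:
  assumes "m < N l"
  obtains C where "\<And>x. x \<in> sphere 0 1 \<Longrightarrow> \<bar>Y l m x\<bar> \<le> C"
  using spherical_harmonic_bounded_measurable(2)[OF harmonic_basis[OF assms]] by blast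

lemma harmonic_basis_orthonormal:
  "m < N l \<Longrightarrow> m' < N l' \<Longrightarrow>
     (\<integral>x. Y l m x * Y l' m' x \<partial>sphere_measure) = (if l = l' \<and> m = m' then 1 else 0)"
  using basis unfolding spherical_harmonic_basis_def by blast

lemma integrable_harmonic_mult:
  assumes m: "m < N l" and f: "f \<in> borel_measurable sphere_measure"
    and fC: "\<And>x. x \<in> sphere 0 1 \<Longrightarrow> \<bar>f x\<bar> \<le> C"
  shows "integrable sphere_measure (\<lambda>z. f z * Y l m z)"
proof -
  obtain C' where C': "\<And>x. x \<in> sphere 0 1 \<Longrightarrow> \<bar>Y l m x\<bar> \<le> C'"
    by (rule harmonic_basis_bounded[OF m]) auto
  note [measurable] = harmonic_basis_measurable[OF m] f
  show ?thesis
  proof (rule S.integrable_const_bound[where B = "\<bar>C\<bar> * \<bar>C'\<bar>"])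
    have "\<bar>f z\<bar> * \<bar>Y l m z\<bar> \<le> \<bar>C\<bar> * \<bar>C'\<bar>" if "z \<in> sphere 0 1" for z
      using order_trans[OF fC[OF that] abs_ge_self] order_trans[OF C'[OF that] abs_ge_self]
      by (rule mult_mono) auto
    then show "AE z in sphere_measure. norm (f z * Y l m z) \<le> \<bar>C\<bar> * \<bar>C'\<bar>"
      by (intro AE_I2) (simp add: abs_mult)
  qed measurable
qed

definition zonal_coeff :: "nat \<Rightarrow> nat \<Rightarrow> 'a \<Rightarrow> real" where
  "zonal_coeff l m y = (\<integral>z. poly (legendre d l) (y \<bullet> z) * Y l m z \<partial>sphere_measure)"

lemma legendre_bounded_on_sphere:
  obtains C where "\<And>y z :: 'a. y \<in> sphere 0 1 \<Longrightarrow> z \<in> sphere 0 1 \<Longrightarrow> \<bar>poly (legendre d l) (y \<bullet> z)\<bar> \<le> C"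
proof -
  have "bounded (poly (legendre d l) ` {-1..1})"
    by (intro compact_imp_bounded compact_continuous_image continuous_intros) auto
  then obtain C where "\<forall>u\<in>{-1..1}. \<bar>poly (legendre d l) u\<bar> \<le> C"
    by (auto simp: bounded_iff)
  then have C: "\<bar>poly (legendre d l) u\<bar> \<le> C" if "u \<in> {-1..1}" for u
    using that by blast
  have "\<bar>poly (legendre d l) (y \<bullet> z)\<bar> \<le> C" if "y \<in> sphere 0 1" "z \<in> sphere 0 1" for y z :: 'a
  proof (rule C)
    show "y \<bullet> z \<in> {-1..1}"
      using Cauchy_Schwarz_ineq2[of y z] that by (auto simp: abs_le_iff)
  qed
  then show ?thesis by (rule that)
qed

lemma borel_measurable_legendre_inner [measurable]:
  "(\<lambda>z. poly (legendre d l) (y \<bullet> z)) \<in> borel_measurable sphere_measure" for y :: 'a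
  by (intro measurable_sphere_measure_borel borel_measurable_continuous_onI continuous_intros)

lemma borel_measurable_inner_pair [measurable]:
  "(\<lambda>v. fst v \<bullet> snd v) \<in> borel_measurable ((sphere_measure :: 'a measure) \<Otimes>\<^sub>M sphere_measure)"
  by (intro borel_measurable_inner measurable_compose[OF measurable_fst measurable_id_sphere_measure]
      measurable_compose[OF measurable_snd measurable_id_sphere_measure])

lemma borel_measurable_legendre_inner_pair [measurable]:
  "(\<lambda>v. poly (legendre d l) (fst v \<bullet> snd v)) \<in> borel_measurable ((sphere_measure :: 'a measure) \<Otimes>\<^sub>M sphere_measure)"
  by (intro measurable_compose[OF borel_measurable_inner_pair] borel_measurable_continuous_onI continuous_intros)

lemma legendre_harmonic_expansion:
  assumes y: "y \<in> sphere 0 1"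
  obtains c where "\<And>x. x \<in> sphere 0 1 \<Longrightarrow> poly (legendre d l) (y \<bullet> x) = (\<Sum>m<N l. c m * Y l m x)"
proof -
  have "spherical_harmonic l (\<lambda>x. poly (legendre d l) (y \<bullet> x))"
    using y by (intro spherical_harmonic_legendre[OF d dim]) simp
  then show ?thesis
    using basis that unfolding spherical_harmonic_basis_def by blast
qed

text \<open>A zonal harmonic of degree \<open>j\<close> is a combination of the
  \<open>Y j m\<close>, because the basis spans that degree; orthonormality then reads off its
  coefficients and kills all other degrees.\<close>

lemma integral_legendre_harmonic:
  assumes y: "y \<in> sphere 0 1" and m: "m < N l"
  shows "l \<noteq> j \<Longrightarrow> (\<integral>z. poly (legendre d j) (y \<bullet> z) * Y l m z \<partial>sphere_measure) = 0"
    and "x \<in> sphere 0 1 \<Longrightarrow> poly (legendre d l) (y \<bullet> x) = (\<Sum>m<N l. zonal_coeff l m y * Y l m x)"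
proof -
  have int: "(\<integral>z. poly (legendre d j) (y \<bullet> z) * Y l m z \<partial>sphere_measure) =
      (\<Sum>m'<N j. c m' * (if j = l \<and> m' = m then 1 else 0))"
    if c: "\<And>x. x \<in> sphere 0 1 \<Longrightarrow> poly (legendre d j) (y \<bullet> x) = (\<Sum>m<N j. c m * Y j m x)"
      and m: "m < N l" for c j m l
  proof -
    have "(\<integral>z. poly (legendre d j) (y \<bullet> z) * Y l m z \<partial>sphere_measure) =
        (\<integral>z. (\<Sum>m'<N j. c m' * (Y j m' z * Y l m z)) \<partial>sphere_measure)"
      by (intro Bochner_Integration.integral_cong) (auto simp: c sum_distrib_right mult.assoc)
    also have "\<dots> = (\<Sum>m'<N j. c m' * (\<integral>z. Y j m' z * Y l m z \<partial>sphere_measure))"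
    proof (subst Bochner_Integration.integral_sum)
      fix m' assume "m' \<in> {..<N j}"
      then have m': "m' < N j" by simp
      obtain C where "\<And>x. x \<in> sphere 0 1 \<Longrightarrow> \<bar>Y j m' x\<bar> \<le> C"
        by (rule harmonic_basis_bounded[OF m']) auto
      then show "integrable sphere_measure (\<lambda>z. c m' * (Y j m' z * Y l m z))"
        by (intro integrable_mult_right integrable_harmonic_mult[OF m harmonic_basis_measurable[OF m']])
    qed simp
    finally show ?thesis
      using m by (simp add: harmonic_basis_orthonormal)
  qed
  show "(\<integral>z. poly (legendre d j) (y \<bullet> z) * Y l m z \<partial>sphere_measure) = 0" if "l \<noteq> j"
  proof -
    obtain c where "\<And>x. x \<in> sphere 0 1 \<Longrightarrow> poly (legendre d j) (y \<bullet> x) = (\<Sum>m<N j. c m * Y j m x)"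
      by (rule legendre_harmonic_expansion[OF y]) auto
    from int[OF this m] that show ?thesis by simp
  qed
  show "poly (legendre d l) (y \<bullet> x) = (\<Sum>m<N l. zonal_coeff l m y * Y l m x)" if x: "x \<in> sphere 0 1"
  proof -
    obtain c where c: "\<And>x. x \<in> sphere 0 1 \<Longrightarrow> poly (legendre d l) (y \<bullet> x) = (\<Sum>m<N l. c m * Y l m x)"
      by (rule legendre_harmonic_expansion[OF y]) auto
    have "zonal_coeff l m y = c m" if "m < N l" for m
      using int[OF c that] that by (simp add: zonal_coeff_def sum.delta' if_distrib cong: if_cong)
    then show ?thesis using c[OF x] by simp
  qed
qed

lemma legendre_eq_sum_zonal_coeff:
  assumes "y \<in> sphere 0 1" "x \<in> sphere 0 1"
  shows "poly (legendre d l) (y \<bullet> x) = (\<Sum>m<N l. zonal_coeff l m y * Y l m x)"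
proof (cases "N l")
  case 0
  obtain c where "\<And>x. x \<in> sphere 0 1 \<Longrightarrow> poly (legendre d l) (y \<bullet> x) = (\<Sum>m<N l. c m * Y l m x)"
    by (rule legendre_harmonic_expansion[OF assms(1)]) auto
  then show ?thesis using assms(2) 0 by simp
next
  case (Suc k)
  then show ?thesis using integral_legendre_harmonic(2)[OF assms(1), of 0 l x] assms by simp
qed

lemma integral_power_harmonic:
  assumes y: "y \<in> sphere 0 1" and m: "m < N l"
  shows "(\<integral>z. (y \<bullet> z) ^ k * Y l m z \<partial>sphere_measure) = legendre_coeff d k l * zonal_coeff l m y"
proof -
  have "(\<integral>z. (y \<bullet> z) ^ k * Y l m z \<partial>sphere_measure) =
      (\<integral>z. (\<Sum>j\<le>k. legendre_coeff d k j * (poly (legendre d j) (y \<bullet> z) * Y l m z)) \<partial>sphere_measure)"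
    by (simp add: power_eq_legendre[OF d] sum_distrib_right mult.assoc)
  also have "\<dots> = (\<Sum>j\<le>k. legendre_coeff d k j * (\<integral>z. poly (legendre d j) (y \<bullet> z) * Y l m z \<partial>sphere_measure))"
  proof (subst Bochner_Integration.integral_sum)
    fix j
    obtain C where "\<And>y z :: 'a. y \<in> sphere 0 1 \<Longrightarrow> z \<in> sphere 0 1 \<Longrightarrow> \<bar>poly (legendre d j) (y \<bullet> z)\<bar> \<le> C"
      by (rule legendre_bounded_on_sphere[of j]) auto
    with y show "integrable sphere_measure (\<lambda>z. legendre_coeff d k j * (poly (legendre d j) (y \<bullet> z) * Y l m z))"
      by (intro integrable_mult_right integrable_harmonic_mult[OF m]) auto
  qed simp
  also have "\<dots> = (\<Sum>j\<le>k. if j = l then legendre_coeff d k l * zonal_coeff l m y else 0)"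
    using integral_legendre_harmonic(1)[OF y m] by (intro sum.cong) (auto simp: zonal_coeff_def)
  also have "\<dots> = legendre_coeff d k l * zonal_coeff l m y"
    using legendre_coeff_eq_0[OF d, of k l] by (auto simp: sum.delta)
  finally show ?thesis .
qed

text \<open>The Funk-Hecke formula.\<close>

lemma integral_pgf_harmonic:
  assumes y: "y \<in> sphere 0 1" and m: "m < N l"
  shows "(\<integral>z. pgf q (y \<bullet> z) * Y l m z \<partial>sphere_measure) = angular_power d q l * zonal_coeff l m y"
proof -
  obtain C where C: "\<And>x. x \<in> sphere 0 1 \<Longrightarrow> \<bar>Y l m x\<bar> \<le> C"
    by (rule harmonic_basis_bounded[OF m]) auto
  note [measurable] = harmonic_basis_measurable[OF m]
  define f where "f k z = pmf q k * ((y \<bullet> z) ^ k * Y l m z)" for k z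
  have pow [measurable]: "(\<lambda>z. (y \<bullet> z) ^ k) \<in> borel_measurable sphere_measure" for k
    by (intro measurable_sphere_measure_borel borel_measurable_continuous_onI continuous_intros)
  have fint: "integrable sphere_measure (f k)" for k
    unfolding f_def using inner_sphere_abs_le[OF y]
    by (intro integrable_mult_right integrable_harmonic_mult[OF m, where C = 1]) (auto simp: power_abs power_le_one)
  have fle: "\<bar>f k z\<bar> \<le> pmf q k * C" if z: "z \<in> sphere 0 1" for k z
  proof -
    have "\<bar>y \<bullet> z\<bar> ^ k * \<bar>Y l m z\<bar> \<le> 1 * C"
      using inner_sphere_abs_le[OF y z] C[OF z] by (intro mult_mono) (auto simp: power_le_one)
    then show ?thesis by (simp add: f_def abs_mult power_abs mult_left_mono)
  qed
  have summ: "summable (\<lambda>k. pmf q k * C)" for C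
    using pmf_nat_sums[of q] by (intro summable_mult2) (rule sums_summable)
  have "(\<lambda>k. \<integral>z. f k z \<partial>sphere_measure) sums (\<integral>z. (\<Sum>k. f k z) \<partial>sphere_measure)"
  proof (rule sums_integral[OF fint])
    show "AE z in sphere_measure. summable (\<lambda>k. norm (f k z))"
      using fle by (intro AE_I2 summable_comparison_test'[OF summ[of C]]) auto
    show "summable (\<lambda>k. \<integral>z. norm (f k z) \<partial>sphere_measure)"
    proof (rule summable_comparison_test'[OF summ[of "C * measure sphere_measure (sphere (0::'a) 1)"]])
      fix k :: nat
      have "(\<integral>z. norm (f k z) \<partial>sphere_measure) \<le> (\<integral>z. pmf q k * C \<partial>(sphere_measure :: 'a measure))"
        using fint fle by (intro integral_mono) auto
      then show "norm (\<integral>z. norm (f k z) \<partial>sphere_measure) \<le> pmf q k * (C * measure sphere_measure (sphere (0::'a) 1))"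
        by (simp add: mult_ac)
    qed
  qed
  moreover have "(\<integral>z. f k z \<partial>sphere_measure) = pmf q k * legendre_coeff d k l * zonal_coeff l m y" for k
    unfolding f_def by (simp add: integral_power_harmonic[OF y m])
  moreover have "(\<integral>z. (\<Sum>k. f k z) \<partial>sphere_measure) = (\<integral>z. pgf q (y \<bullet> z) * Y l m z \<partial>sphere_measure)"
  proof (intro Bochner_Integration.integral_cong refl)
    fix z :: 'a assume "z \<in> space sphere_measure"
    then have "(\<lambda>k. pmf q k * (y \<bullet> z) ^ k * Y l m z) sums (pgf q (y \<bullet> z) * Y l m z)"
      using inner_sphere_abs_le[OF y, of z] by (intro sums_mult2 pgf_sums) simp
    then show "(\<Sum>k. f k z) = pgf q (y \<bullet> z) * Y l m z"
      by (simp add: f_def mult.assoc sums_iff)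
  qed
  ultimately have "(\<lambda>k. pmf q k * legendre_coeff d k l * zonal_coeff l m y) sums (\<integral>z. pgf q (y \<bullet> z) * Y l m z \<partial>sphere_measure)"
    by simp
  moreover have "(\<lambda>k. pmf q k * legendre_coeff d k l * zonal_coeff l m y) sums (angular_power d q l * zonal_coeff l m y)"
    unfolding angular_power_def[OF d] by (intro sums_mult2 summable_sums summable_angular_power[OF d])
  ultimately show ?thesis by (rule sums_unique2)
qed

text \<open>Up to the factor \<open>angular_power\<close>, the covariance of the random coefficients
  with indices (l, m) and (l', m').\<close>

definition harmonic_gram :: "nat \<Rightarrow> nat \<Rightarrow> nat \<Rightarrow> nat \<Rightarrow> real" where
  "harmonic_gram l m l' m' = (\<integral>y. zonal_coeff l' m' y * Y l m y \<partial>sphere_measure)"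

lemma zonal_kernel_integrable:
  assumes m: "m < N l" and m': "m' < N l'"
  shows "integrable (sphere_measure \<Otimes>\<^sub>M sphere_measure)
    (\<lambda>v. poly (legendre d j) (fst v \<bullet> snd v) * Y l' m' (snd v) * Y l m (fst v))"
proof -
  note [measurable] = harmonic_basis_measurable[OF m] harmonic_basis_measurable[OF m']
  obtain C where C: "\<And>x. x \<in> sphere 0 1 \<Longrightarrow> \<bar>Y l m x\<bar> \<le> C"
    by (rule harmonic_basis_bounded[OF m]) auto
  obtain C' where C': "\<And>x. x \<in> sphere 0 1 \<Longrightarrow> \<bar>Y l' m' x\<bar> \<le> C'"
    by (rule harmonic_basis_bounded[OF m']) auto
  obtain C'' where C'': "\<And>y z :: 'a. y \<in> sphere 0 1 \<Longrightarrow> z \<in> sphere 0 1 \<Longrightarrow> \<bar>poly (legendre d j) (y \<bullet> z)\<bar> \<le> C''"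
    by (rule legendre_bounded_on_sphere[of j]) auto
  show ?thesis
  proof (rule SS.integrable_const_bound[where B = "\<bar>C''\<bar> * \<bar>C'\<bar> * \<bar>C\<bar>"])
    have "\<bar>poly (legendre d j) (y \<bullet> z)\<bar> * \<bar>Y l' m' z\<bar> * \<bar>Y l m y\<bar> \<le> \<bar>C''\<bar> * \<bar>C'\<bar> * \<bar>C\<bar>"
      if "y \<in> sphere 0 1" "z \<in> sphere 0 1" for y z
      using order_trans[OF C[OF that(1)] abs_ge_self] order_trans[OF C'[OF that(2)] abs_ge_self]
        order_trans[OF C''[OF that] abs_ge_self] by (intro mult_mono) auto
    then show "AE v in sphere_measure \<Otimes>\<^sub>M sphere_measure.
        norm (poly (legendre d j) (fst v \<bullet> snd v) * Y l' m' (snd v) * Y l m (fst v)) \<le> \<bar>C''\<bar> * \<bar>C'\<bar> * \<bar>C\<bar>"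
      by (intro AE_I2) (auto simp: space_pair_measure abs_mult)
  qed measurable
qed

lemma integrable_zonal_coeff_mult:
  assumes "m < N l" "m' < N l'"
  shows "integrable sphere_measure (\<lambda>y. zonal_coeff l' m' y * Y l m y)"
  using SS.integrable_fst'[OF zonal_kernel_integrable[OF assms, of l']] by (simp add: zonal_coeff_def)

text \<open>Fubini and the symmetry of the inner product allow integrating over \<open>y\<close>
  first, where a zonal harmonic of degree \<open>l'\<close> with pole \<open>z\<close> meets a
  \<open>Y l m\<close> of another degree.\<close>

lemma harmonic_gram_eq_0:
  assumes m: "m < N l" and m': "m' < N l'" and ne: "l \<noteq> l'"
  shows "harmonic_gram l m l' m' = 0"
proof -
  have int: "integrable (sphere_measure \<Otimes>\<^sub>M sphere_measure)
      (case_prod (\<lambda>y z. poly (legendre d l') (y \<bullet> z) * Y l' m' z * Y l m y))"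
    using zonal_kernel_integrable[OF m m', of l'] by (simp add: case_prod_unfold)
  have "harmonic_gram l m l' m' = (\<integral>y. (\<integral>z. poly (legendre d l') (y \<bullet> z) * Y l' m' z * Y l m y \<partial>sphere_measure) \<partial>sphere_measure)"
    by (simp add: harmonic_gram_def zonal_coeff_def)
  also have "\<dots> = (\<integral>z. (\<integral>y. poly (legendre d l') (y \<bullet> z) * Y l' m' z * Y l m y \<partial>sphere_measure) \<partial>sphere_measure)"
    using SS.integral_fst[OF int] SS.integral_snd[OF int] by simp
  also have "\<dots> = (\<integral>z. 0 \<partial>(sphere_measure :: 'a measure))"
  proof (intro Bochner_Integration.integral_cong refl)
    fix z :: 'a assume "z \<in> space sphere_measure"
    then have "(\<integral>y. poly (legendre d l') (z \<bullet> y) * Y l m y \<partial>sphere_measure) = 0"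
      using integral_legendre_harmonic(1)[of z m l l'] m ne by simp
    moreover have "(\<integral>y. poly (legendre d l') (y \<bullet> z) * Y l' m' z * Y l m y \<partial>sphere_measure) =
        Y l' m' z * (\<integral>y. poly (legendre d l') (z \<bullet> y) * Y l m y \<partial>sphere_measure)"
      unfolding integral_mult_right_zero[symmetric] by (simp add: inner_commute mult_ac)
    ultimately show "(\<integral>y. poly (legendre d l') (y \<bullet> z) * Y l' m' z * Y l m y \<partial>sphere_measure) = 0" by simp
  qed
  finally show ?thesis by simp
qed

text \<open>The combination of entries that the variance at \<open>x\<close> sees. Each of the two
  sums is the expansion of a zonal harmonic of pole \<open>x\<close>, and what remains is the
  Legendre polynomial at \<open>x \<bullet> x = 1\<close>.\<close>

lemma sum_harmonic_gram:
  assumes x: "x \<in> sphere 0 1"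
  shows "(\<Sum>m<N l. \<Sum>m'<N l. Y l m x * Y l m' x * harmonic_gram l m l m') = 1"
proof -
  have "(\<Sum>m'<N l. Y l m' x * harmonic_gram l m l m') = zonal_coeff l m x" if m: "m < N l" for m
  proof -
    have "(\<Sum>m'<N l. Y l m' x * harmonic_gram l m l m') =
        (\<integral>y. (\<Sum>m'<N l. Y l m' x * (zonal_coeff l m' y * Y l m y)) \<partial>sphere_measure)"
      unfolding harmonic_gram_def using m
      by (subst Bochner_Integration.integral_sum) (auto intro!: integrable_mult_right integrable_zonal_coeff_mult)
    also have "\<dots> = (\<integral>y. poly (legendre d l) (x \<bullet> y) * Y l m y \<partial>sphere_measure)"
    proof (intro Bochner_Integration.integral_cong refl)
      fix y :: 'a assume "y \<in> space sphere_measure"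
      then have eq: "poly (legendre d l) (x \<bullet> y) = (\<Sum>m'<N l. zonal_coeff l m' y * Y l m' x)"
        using legendre_eq_sum_zonal_coeff[of y x l] x by (simp add: inner_commute)
      show "(\<Sum>m'<N l. Y l m' x * (zonal_coeff l m' y * Y l m y)) = poly (legendre d l) (x \<bullet> y) * Y l m y"
        unfolding eq sum_distrib_right by (simp add: mult_ac)
    qed
    finally show ?thesis by (simp add: zonal_coeff_def)
  qed
  then have "(\<Sum>m'<N l. Y l m x * Y l m' x * harmonic_gram l m l m') = zonal_coeff l m x * Y l m x" if "m < N l" for m
    using that by (simp add: mult.assoc mult.commute[of "zonal_coeff l m x"] flip: sum_distrib_left)
  then have "(\<Sum>m<N l. \<Sum>m'<N l. Y l m x * Y l m' x * harmonic_gram l m l m') = (\<Sum>m<N l. zonal_coeff l m x * Y l m x)"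
    by (intro sum.cong refl) simp
  also have "\<dots> = poly (legendre d l) (x \<bullet> x)"
    using legendre_eq_sum_zonal_coeff[OF x x] by simp
  also have "x \<bullet> x = 1" using x by (simp add: dot_square_norm)
  finally show ?thesis using d by simp
qed

lemma double_integral_pgf_harmonic:
  assumes m: "m < N l" and m': "m' < N l'"
  shows "(\<integral>y. (\<integral>z. pgf q (y \<bullet> z) * (Y l m y * Y l' m' z) \<partial>sphere_measure) \<partial>sphere_measure) =
    angular_power d q l' * harmonic_gram l m l' m'"
proof -
  have "(\<integral>y. (\<integral>z. pgf q (y \<bullet> z) * (Y l m y * Y l' m' z) \<partial>sphere_measure) \<partial>sphere_measure) =
      (\<integral>y. angular_power d q l' * (zonal_coeff l' m' y * Y l m y) \<partial>sphere_measure)"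
  proof (intro Bochner_Integration.integral_cong refl)
    fix y :: 'a assume y: "y \<in> space sphere_measure"
    have "(\<integral>z. pgf q (y \<bullet> z) * (Y l m y * Y l' m' z) \<partial>sphere_measure) =
        Y l m y * (\<integral>z. pgf q (y \<bullet> z) * Y l' m' z \<partial>sphere_measure)"
      unfolding integral_mult_right_zero[symmetric] by (simp add: mult_ac)
    then show "(\<integral>z. pgf q (y \<bullet> z) * (Y l m y * Y l' m' z) \<partial>sphere_measure) =
        angular_power d q l' * (zonal_coeff l' m' y * Y l m y)"
      using y by (simp add: integral_pgf_harmonic[OF _ m'])
  qed
  then show ?thesis by (simp add: harmonic_gram_def)
qed

end


section \<open>Spectral derivatives of an isotropic Gaussian field\<close>

lemma (in prob_space) expectation_sum_square:
  assumes "finite I" and "\<And>i. i \<in> I \<Longrightarrow> square_integrable M (b i)"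
  shows "expectation (\<lambda>\<omega>. (\<Sum>i\<in>I. c i * b i \<omega>)\<^sup>2) =
    (\<Sum>i\<in>I. \<Sum>j\<in>I. c i * c j * expectation (\<lambda>\<omega>. b i \<omega> * b j \<omega>))"
proof -
  have "expectation (\<lambda>\<omega>. (\<Sum>i\<in>I. c i * b i \<omega>)\<^sup>2) = expectation (\<lambda>\<omega>. \<Sum>i\<in>I. \<Sum>j\<in>I. (c i * c j) * (b i \<omega> * b j \<omega>))"
    by (simp add: power2_eq_square sum_product mult_ac)
  also have "\<dots> = (\<Sum>i\<in>I. \<Sum>j\<in>I. c i * c j * expectation (\<lambda>\<omega>. b i \<omega> * b j \<omega>))"
    using integrable_mult_square_integrable[OF assms(2) assms(2)]
    by (subst Bochner_Integration.integral_sum, force intro!: Bochner_Integration.integrable_sum)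
       (intro sum.cong refl, subst Bochner_Integration.integral_sum, auto)
  finally show ?thesis .
qed

lemma ennreal_angular_power:
  assumes "d \<ge> 2"
  shows "ennreal (angular_power d q l) = (\<integral>\<^sup>+k. ennreal (legendre_coeff d k l) \<partial>measure_pmf q)"
proof -
  have "(\<integral>\<^sup>+k. ennreal (legendre_coeff d k l) \<partial>measure_pmf q) = (\<Sum>k. ennreal (pmf q k * legendre_coeff d k l))"
    unfolding nn_integral_measure_pmf nn_integral_count_space_nat
    by (simp add: ennreal_mult' legendre_coeff_nonneg[OF assms])
  also have "\<dots> = ennreal (angular_power d q l)"
    unfolding angular_power_def[OF assms]
    by (rule suminf_ennreal2) (auto simp: legendre_coeff_nonneg[OF assms] summable_angular_power[OF assms])
  finally show ?thesis ..
qed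

text \<open>Tonelli: the sums over \<open>l\<close> and \<open>k\<close> are exchanged in
  \<open>ennreal\<close>, before convergence is known, and the sum over \<open>l\<close> becomes a
  finite combination of binomial coefficients. Convergence of the real series is read off at the
  end. The index \<open>j\<close> starts at 1 because the zeroth weight vanishes for
  \<open>r \<ge> 1\<close>.\<close>

lemma eigenvalue_angular_power_sums:
  assumes d: "d \<ge> 2" and r: "r \<ge> 1" and fin: "\<And>j. 1 \<le> j \<Longrightarrow> j \<le> r \<Longrightarrow> binomial_moment q j < \<infinity>"
  shows "(\<lambda>l. (real l * (real l + d - 1)) ^ r * angular_power d q l) sums
    (\<Sum>j=1..r. zonal_weight d r j * fact j * enn2real (binomial_moment q j))"
proof -
  let ?f = "\<lambda>l. (real l * (real l + d - 1)) ^ r * angular_power d q l"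
  let ?V = "\<Sum>j=1..r. zonal_weight d r j * fact j * enn2real (binomial_moment q j)"
  have eig: "real l * (real l + d - 1) \<ge> 0" for l using d by simp
  have f: "?f l \<ge> 0" for l using eig angular_power_nonneg[OF d] by simp
  have "ennreal (?f l) = (\<integral>\<^sup>+k. ennreal ((real l * (real l + d - 1)) ^ r * legendre_coeff d k l) \<partial>measure_pmf q)" for l
  proof -
    let ?e = "(real l * (real l + d - 1)) ^ r"
    have e: "?e \<ge> 0" using eig by simp
    have "ennreal (?f l) = ennreal ?e * ennreal (angular_power d q l)"
      by (rule ennreal_mult'[OF e])
    also have "\<dots> = (\<integral>\<^sup>+k. ennreal ?e * ennreal (legendre_coeff d k l) \<partial>measure_pmf q)"
      unfolding ennreal_angular_power[OF d] by (rule nn_integral_cmult[symmetric]) simp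
    also have "\<dots> = (\<integral>\<^sup>+k. ennreal (?e * legendre_coeff d k l) \<partial>measure_pmf q)"
      by (simp only: ennreal_mult'[OF e])
    finally show ?thesis .
  qed
  then have "(\<Sum>l. ennreal (?f l)) = (\<Sum>l. \<integral>\<^sup>+k. ennreal ((real l * (real l + d - 1)) ^ r * legendre_coeff d k l) \<partial>measure_pmf q)"
    by (simp only:)
  also have "\<dots> = (\<integral>\<^sup>+k. (\<Sum>l. ennreal ((real l * (real l + d - 1)) ^ r * legendre_coeff d k l)) \<partial>measure_pmf q)"
    by (rule nn_integral_suminf[symmetric]) simp
  also have "\<dots> = (\<integral>\<^sup>+k. (\<Sum>j=1..r. ennreal (zonal_weight d r j * fact j) * of_nat (k choose j)) \<partial>measure_pmf q)"
  proof (rule nn_integral_cong)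
    fix k :: nat
    have "(\<Sum>l. ennreal ((real l * (real l + d - 1)) ^ r * legendre_coeff d k l)) =
        (\<Sum>l\<le>k. ennreal ((real l * (real l + d - 1)) ^ r * legendre_coeff d k l))"
      by (rule suminf_finite) (auto simp: legendre_coeff_eq_0[OF d])
    also have "\<dots> = ennreal (\<Sum>l\<le>k. (real l * (real l + d - 1)) ^ r * legendre_coeff d k l)"
      using eig by (intro sum_ennreal) (auto simp: legendre_coeff_nonneg[OF d])
    also have "\<dots> = ennreal (\<Sum>j\<le>r. zonal_weight d r j * fact j * real (k choose j))"
      by (simp add: sum_legendre_coeff_eigenvalue[OF d])
    also have "(\<Sum>j\<le>r. zonal_weight d r j * fact j * real (k choose j)) = (\<Sum>j=1..r. zonal_weight d r j * fact j * real (k choose j))"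
      using zonal_weight_0[OF d r] by (intro sum.mono_neutral_right) (auto simp: not_less_eq_eq)
    also have "ennreal \<dots> = (\<Sum>j=1..r. ennreal (zonal_weight d r j * fact j * real (k choose j)))"
      by (rule sum_ennreal[symmetric]) (simp add: zonal_weight_nonneg[OF d])
    also have "\<dots> = (\<Sum>j=1..r. ennreal (zonal_weight d r j * fact j) * of_nat (k choose j))"
      by (simp add: ennreal_mult' zonal_weight_nonneg[OF d] ennreal_of_nat_eq_real_of_nat)
    finally show "(\<Sum>l. ennreal ((real l * (real l + d - 1)) ^ r * legendre_coeff d k l)) =
        (\<Sum>j=1..r. ennreal (zonal_weight d r j * fact j) * of_nat (k choose j))" .
  qed
  also have "\<dots> = (\<Sum>j=1..r. ennreal (zonal_weight d r j * fact j) * binomial_moment q j)"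
    by (simp add: nn_integral_sum nn_integral_cmult binomial_moment_def)
  also have "\<dots> = (\<Sum>j=1..r. ennreal (zonal_weight d r j * fact j * enn2real (binomial_moment q j)))"
    using fin by (intro sum.cong) (auto simp: ennreal_mult zonal_weight_nonneg[OF d])
  also have "\<dots> = ennreal ?V"
    by (intro sum_ennreal) (simp add: zonal_weight_nonneg[OF d])
  finally have eq: "(\<Sum>l. ennreal (?f l)) = ennreal ?V" .
  have summ: "summable ?f"
    using eq f by (intro summable_suminf_not_top) auto
  have "ennreal (suminf ?f) = ennreal ?V"
    using suminf_ennreal2[OF f summ] eq by simp
  moreover have "suminf ?f \<ge> 0" using suminf_nonneg[OF summ f] .
  moreover have "?V \<ge> 0" by (intro sum_nonneg) (simp add: zonal_weight_nonneg[OF d])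
  ultimately have "suminf ?f = ?V" by simp
  then show ?thesis using summ by (simp add: sums_iff)
qed

lemma centered_normal_moments:
  assumes "centered_normal M X"
  shows "square_integrable M X" and "(\<integral>\<omega>. X \<omega> \<partial>M) = 0"
proof -
  have X [measurable]: "X \<in> borel_measurable M" using assms by (simp add: centered_normal_def)
  have "integrable (distr M borel X) (\<lambda>z. z\<^sup>2) \<and> (\<integral>z. z \<partial>distr M borel X) = 0"
    using assms unfolding centered_normal_def
  proof (elim conjE disjE exE)
    assume "distr M borel X = return borel 0"
    moreover have "integrable (return borel 0) (\<lambda>z::real. z\<^sup>2)"
      by (rule integrableI_bounded) (simp_all add: nn_integral_return)
    ultimately show ?thesis by (simp add: integral_return)
  next
    fix s :: real assume s: "s > 0" and eq: "distr M borel X = density lborel (\<lambda>z. ennreal (normal_density 0 s z))"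
    have "integrable lborel (\<lambda>z. normal_density 0 s z * z\<^sup>2)"
      using integrable_normal_moment[OF s, of 0 2] by simp
    then show ?thesis
      unfolding eq using integral_normal_moment_nz_1[OF s, of 0]
      by (subst integrable_density, simp_all, subst integral_density, simp_all)
  qed
  then show "square_integrable M X" and "(\<integral>\<omega>. X \<omega> \<partial>M) = 0"
    by (simp_all add: square_integrable_def integrable_distr_eq integral_distr)
qed

lemma centered_gaussian_field_moments:
  assumes "centered_gaussian_field M I X" "i \<in> I"
  shows "square_integrable M (X i)" and "(\<integral>\<omega>. X i \<omega> \<partial>M) = 0"
proof -
  have "centered_normal M (X i)"
    using assms(1)[unfolded centered_gaussian_field_def, rule_format, of "{i}" "\<lambda>_. 1"] assms(2) by simp
  then show "square_integrable M (X i)" and "(\<integral>\<omega>. X i \<omega> \<partial>M) = 0"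
    by (rule centered_normal_moments)+
qed

section \<open>Random spectral coefficients and the mean-square derivative\<close>

context
  fixes d :: real and N :: "nat \<Rightarrow> nat" and Y :: "nat \<Rightarrow> nat \<Rightarrow> 'a::euclidean_space \<Rightarrow> real"
    and M :: "'w measure" and X :: "'a \<Rightarrow> 'w \<Rightarrow> real" and q :: "nat pmf"
  assumes d: "d \<ge> 2" and dim: "real DIM('a) = d + 1" and basis: "spherical_harmonic_basis N Y"
    and M: "prob_space M"
    and X_meas: "(\<lambda>(x, \<omega>). X x \<omega>) \<in> borel_measurable (sphere_measure \<Otimes>\<^sub>M M)"
    and X_gaussian: "centered_gaussian_field M (sphere 0 1) X"
    and X_cov: "\<And>x y. x \<in> sphere 0 1 \<Longrightarrow> y \<in> sphere 0 1 \<Longrightarrow> (\<integral>\<omega>. X x \<omega> * X y \<omega> \<partial>M) = pgf q (x \<bullet> y)"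
begin

interpretation M: prob_space M by (rule M)

lemma field_second_moment_le_1: "x \<in> sphere 0 1 \<Longrightarrow> (\<integral>\<omega>. (X x \<omega>)\<^sup>2 \<partial>M) \<le> 1"
  using X_cov[of x x] by (simp add: power2_eq_square dot_square_norm)

lemmas field_integral_assms = M finite_measure_sphere_measure X_meas
  centered_gaussian_field_moments(1)[OF X_gaussian, folded space_sphere_measure]
  field_second_moment_le_1[folded space_sphere_measure]
  centered_gaussian_field_moments(2)[OF X_gaussian, folded space_sphere_measure]

abbreviation (input) "angular_coeff l m \<equiv> field_integral sphere_measure X (Y l m)"

lemma angular_coeff_square_integrable:
  assumes m: "m < N l"
  shows "square_integrable M (angular_coeff l m)" and "(\<integral>\<omega>. angular_coeff l m \<omega> \<partial>M) = 0"
proof -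
  obtain C where C: "\<And>x. x \<in> sphere 0 1 \<Longrightarrow> \<bar>Y l m x\<bar> \<le> C"
    by (rule harmonic_basis_bounded[OF d dim basis m]) auto
  show "square_integrable M (angular_coeff l m)"
    using C by (intro square_integrable_field_integral[OF field_integral_assms harmonic_basis_measurable[OF d dim basis m]]) auto
  show "(\<integral>\<omega>. angular_coeff l m \<omega> \<partial>M) = 0"
    using C by (intro expectation_field_integral[OF field_integral_assms harmonic_basis_measurable[OF d dim basis m]]) auto
qed

lemma angular_coeff_covariance:
  assumes m: "m < N l" and m': "m' < N l'"
  shows "(\<integral>\<omega>. angular_coeff l m \<omega> * angular_coeff l' m' \<omega> \<partial>M) =
    (if l = l' then angular_power d q l * harmonic_gram d Y l m l m' else 0)"
proof -
  obtain C where C: "\<And>x. x \<in> sphere 0 1 \<Longrightarrow> \<bar>Y l m x\<bar> \<le> C"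
    by (rule harmonic_basis_bounded[OF d dim basis m]) auto
  obtain C' where C': "\<And>x. x \<in> sphere 0 1 \<Longrightarrow> \<bar>Y l' m' x\<bar> \<le> C'"
    by (rule harmonic_basis_bounded[OF d dim basis m']) auto
  have "(\<integral>\<omega>. angular_coeff l m \<omega> * angular_coeff l' m' \<omega> \<partial>M) =
      (\<integral>x. (\<integral>y. (\<integral>\<omega>. X x \<omega> * X y \<omega> \<partial>M) * (Y l m x * Y l' m' y) \<partial>sphere_measure) \<partial>sphere_measure)"
    using C C' by (intro field_integral_mult(2)[OF field_integral_assms harmonic_basis_measurable[OF d dim basis m] _
        harmonic_basis_measurable[OF d dim basis m']]) auto
  also have "\<dots> = (\<integral>x. (\<integral>y. pgf q (x \<bullet> y) * (Y l m x * Y l' m' y) \<partial>sphere_measure) \<partial>sphere_measure)"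
    by (intro Bochner_Integration.integral_cong refl) (auto simp: X_cov)
  also have "\<dots> = angular_power d q l' * harmonic_gram d Y l m l' m'"
    by (rule double_integral_pgf_harmonic[OF d dim basis m m'])
  finally show ?thesis
    using harmonic_gram_eq_0[OF d dim basis m m'] by auto
qed

text \<open>Arbitrary sets of degrees and arbitrary weights, so that partial sums and their
  differences are covered alike.\<close>

definition spectral_sum :: "nat set \<Rightarrow> (nat \<Rightarrow> real) \<Rightarrow> 'a \<Rightarrow> 'w \<Rightarrow> real" where
  "spectral_sum A w x \<omega> = (\<Sum>l\<in>A. \<Sum>m<N l. w l * angular_coeff l m \<omega> * Y l m x)"

lemma spectral_sum_moments:
  assumes A: "finite A" and x: "x \<in> sphere 0 1"
  shows "square_integrable M (spectral_sum A w x)"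
    and "(\<integral>\<omega>. spectral_sum A w x \<omega> \<partial>M) = 0"
    and "(\<integral>\<omega>. (spectral_sum A w x \<omega>)\<^sup>2 \<partial>M) = (\<Sum>l\<in>A. (w l)\<^sup>2 * angular_power d q l)"
proof -
  define I where "I = Sigma A (\<lambda>l. {..<N l})"
  define c where "c i = w (fst i) * Y (fst i) (snd i) x" for i
  define b where "b i = angular_coeff (fst i) (snd i)" for i
  have I: "finite I" using A by (simp add: I_def)
  have b: "square_integrable M (b i)" "(\<integral>\<omega>. b i \<omega> \<partial>M) = 0" if "i \<in> I" for i
    using that angular_coeff_square_integrable by (auto simp: I_def b_def)
  have conv: "(\<Sum>i\<in>I. f i) = (\<Sum>l\<in>A. \<Sum>m<N l. f (l, m))" for f :: "nat \<times> nat \<Rightarrow> real"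
    unfolding I_def using A by (subst sum.Sigma) auto
  have eq: "spectral_sum A w x = (\<lambda>\<omega>. \<Sum>i\<in>I. c i * b i \<omega>)"
    unfolding conv c_def b_def by (simp add: spectral_sum_def fun_eq_iff mult_ac)
  show "square_integrable M (spectral_sum A w x)"
    unfolding eq by (intro square_integrable_sum square_integrable_cmult b)
  have "(\<integral>\<omega>. spectral_sum A w x \<omega> \<partial>M) = (\<Sum>i\<in>I. c i * (\<integral>\<omega>. b i \<omega> \<partial>M))"
    unfolding eq using M.square_integrable_integrable[OF b(1)]
    by (subst Bochner_Integration.integral_sum) auto
  then show "(\<integral>\<omega>. spectral_sum A w x \<omega> \<partial>M) = 0"
    by (simp add: b(2))
  have "(\<integral>\<omega>. (spectral_sum A w x \<omega>)\<^sup>2 \<partial>M) = (\<Sum>i\<in>I. \<Sum>j\<in>I. c i * c j * (\<integral>\<omega>. b i \<omega> * b j \<omega> \<partial>M))"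
    unfolding eq by (rule M.expectation_sum_square[OF I b(1)])
  also have "\<dots> = (\<Sum>l\<in>A. \<Sum>m<N l. \<Sum>l'\<in>A. \<Sum>m'<N l'.
      (w l * Y l m x) * (w l' * Y l' m' x) * (\<integral>\<omega>. angular_coeff l m \<omega> * angular_coeff l' m' \<omega> \<partial>M))"
    unfolding conv c_def b_def fst_conv snd_conv ..
  also have "\<dots> = (\<Sum>l\<in>A. \<Sum>m<N l. \<Sum>l'\<in>A. if l' = l then \<Sum>m'<N l.
      ((w l)\<^sup>2 * angular_power d q l) * (Y l m x * Y l m' x * harmonic_gram d Y l m l m') else 0)"
  proof (intro sum.cong refl)
    fix l m l' assume "m \<in> {..<N l}"
    then have m: "m < N l" by simp
    show "(\<Sum>m'<N l'. (w l * Y l m x) * (w l' * Y l' m' x) * (\<integral>\<omega>. angular_coeff l m \<omega> * angular_coeff l' m' \<omega> \<partial>M)) =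
        (if l' = l then \<Sum>m'<N l. ((w l)\<^sup>2 * angular_power d q l) * (Y l m x * Y l m' x * harmonic_gram d Y l m l m') else 0)"
      using angular_coeff_covariance[OF m] by (auto intro!: sum.cong simp: power2_eq_square)
  qed
  also have "\<dots> = (\<Sum>l\<in>A. ((w l)\<^sup>2 * angular_power d q l) * (\<Sum>m<N l. \<Sum>m'<N l. Y l m x * Y l m' x * harmonic_gram d Y l m l m'))"
    using A by (intro sum.cong refl) (simp add: sum.delta' sum_distrib_left)
  also have "\<dots> = (\<Sum>l\<in>A. (w l)\<^sup>2 * angular_power d q l)"
    by (simp add: sum_harmonic_gram[OF d dim basis x])
  finally show "(\<integral>\<omega>. (spectral_sum A w x \<omega>)\<^sup>2 \<partial>M) = (\<Sum>l\<in>A. (w l)\<^sup>2 * angular_power d q l)" .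
qed

text \<open>Distinct degrees are uncorrelated, so the mean-square distance of two partial sums is
  the distance of two partial sums \<open>P\<close> of a convergent numerical series. Hence they are
  Cauchy, the derivative exists, and mean and second moment pass to the limit.\<close>

lemma spectral_deriv_moments:
  fixes r :: nat
  assumes r: "r \<ge> 1" and fin: "\<And>j. 1 \<le> j \<Longrightarrow> j \<le> r \<Longrightarrow> binomial_moment q j < \<infinity>" and x: "x \<in> sphere 0 1"
  defines "V \<equiv> \<Sum>j=1..r. zonal_weight d r j * fact j * enn2real (binomial_moment q j)"
  shows "is_spectral_deriv M N Y r X x (spectral_deriv M N Y r X x)"
    and "square_integrable M (spectral_deriv M N Y r X x)"
    and "(\<integral>\<omega>. (spectral_deriv M N Y r X x \<omega>)\<^sup>2 \<partial>M) = V"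
    and "M.variance (spectral_deriv M N Y r X x) = V"
proof -
  define \<Lambda> where "\<Lambda> l = real l * (real l + d - 1)" for l
  define w where "w l = sqrt (\<Lambda> l) ^ r" for l
  have w2: "(w l)\<^sup>2 = \<Lambda> l ^ r" for l
  proof -
    have "\<Lambda> l \<ge> 0" using d by (simp add: \<Lambda>_def)
    moreover have "(w l)\<^sup>2 = ((sqrt (\<Lambda> l))\<^sup>2) ^ r"
      by (simp only: w_def power_mult[symmetric] mult.commute)
    ultimately show ?thesis by simp
  qed
  define S where "S n = spectral_sum {..<n} w x" for n
  define P where "P n = (\<Sum>l<n. \<Lambda> l ^ r * angular_power d q l)" for n
  have S_eq: "(\<lambda>\<omega>. spectral_partial_sum N Y r (\<lambda>y. X y \<omega>) n x) = S n" for n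
  proof
    fix \<omega>
    have "\<Lambda> l = real l * (real l + real DIM('a) - 2)" for l
      using dim by (simp add: \<Lambda>_def)
    then have "w l = sqrt (real l * (real l + real DIM('a) - 2)) ^ r" for l
      by (simp only: w_def)
    moreover have "field_integral sphere_measure X h \<omega> = harmonic_coeff h (\<lambda>y. X y \<omega>)" for h
      unfolding harmonic_coeff_def by (rule field_integral_def[OF field_integral_assms])
    ultimately show "spectral_partial_sum N Y r (\<lambda>y. X y \<omega>) n x = S n \<omega>"
      unfolding S_def spectral_partial_sum_def spectral_sum_def by (simp only:)
  qed
  have S_sq: "square_integrable M (S n)" for n
    unfolding S_def by (rule spectral_sum_moments(1)[OF _ x]) simp
  have S_mean: "(\<integral>\<omega>. S n \<omega> \<partial>M) = 0" for n
    unfolding S_def by (rule spectral_sum_moments(2)[OF _ x]) simp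
  have S_var: "(\<integral>\<omega>. (S n \<omega>)\<^sup>2 \<partial>M) = P n" for n
    unfolding S_def P_def w2[symmetric] by (rule spectral_sum_moments(3)[OF _ x]) simp
  have diff: "(\<integral>\<omega>. (S m \<omega> - S n \<omega>)\<^sup>2 \<partial>M) = \<bar>P m - P n\<bar>" for m n
  proof -
    have *: "(\<integral>\<omega>. (S n \<omega> - S m \<omega>)\<^sup>2 \<partial>M) = P n - P m \<and> P m \<le> P n" if "m \<le> n" for m n
    proof -
      have split: "sum f {..<n} - sum f {..<m} = sum f {m..<n}" for f :: "nat \<Rightarrow> real"
        using sum.atLeastLessThan_concat[of 0 m n f] that by (simp add: atLeast0LessThan)
      have "S n \<omega> - S m \<omega> = spectral_sum {m..<n} w x \<omega>" for \<omega>
        unfolding S_def spectral_sum_def split ..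
      then have "(\<integral>\<omega>. (S n \<omega> - S m \<omega>)\<^sup>2 \<partial>M) = (\<Sum>l\<in>{m..<n}. \<Lambda> l ^ r * angular_power d q l)"
        using spectral_sum_moments(3)[OF _ x, of "{m..<n}" w] by (simp add: w2)
      moreover have "\<dots> = P n - P m" unfolding P_def split ..
      moreover have "(\<integral>\<omega>. (S n \<omega> - S m \<omega>)\<^sup>2 \<partial>M) \<ge> 0" by simp
      ultimately show ?thesis by linarith
    qed
    show ?thesis
    proof (cases "m \<le> n")
      case True
      have "(\<integral>\<omega>. (S m \<omega> - S n \<omega>)\<^sup>2 \<partial>M) = (\<integral>\<omega>. (S n \<omega> - S m \<omega>)\<^sup>2 \<partial>M)"
        by (simp add: power2_commute)
      then show ?thesis using *[OF True] by linarith
    next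
      case False
      then show ?thesis using *[of n m] by linarith
    qed
  qed
  have P_lim: "P \<longlonglongrightarrow> V"
    using eigenvalue_angular_power_sums[OF d r fin] unfolding sums_def P_def \<Lambda>_def V_def by simp
  then have "Cauchy P" by (rule LIMSEQ_imp_Cauchy)
  obtain U where U: "L2_tendsto M S U"
  proof (rule M.L2_Cauchy_limit[OF S_sq])
    fix e :: real assume "e > 0"
    from CauchyD[OF \<open>Cauchy P\<close> this] show "\<exists>K. \<forall>m\<ge>K. \<forall>n\<ge>K. (\<integral>\<omega>. (S m \<omega> - S n \<omega>)\<^sup>2 \<partial>M) \<le> e"
      unfolding diff real_norm_def by (blast intro: less_imp_le)
  qed
  then have "is_spectral_deriv M N Y r X x U"
    by (simp add: is_spectral_deriv_def S_eq)
  \<comment> \<open>Existence makes the choice in \<open>spectral_deriv\<close> meaningful; the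
    moments computed next hold for whichever limit it picks.\<close>
  then show deriv: "is_spectral_deriv M N Y r X x (spectral_deriv M N Y r X x)"
    unfolding spectral_deriv_def by (rule someI[of "is_spectral_deriv M N Y r X x"])
  let ?D = "spectral_deriv M N Y r X x"
  have D: "L2_tendsto M S ?D"
    using deriv by (simp add: is_spectral_deriv_def S_eq)
  then show sq: "square_integrable M ?D" by (simp add: L2_tendsto_def)
  have "(\<lambda>n. \<integral>\<omega>. S n \<omega> \<partial>M) \<longlonglongrightarrow> (\<integral>\<omega>. ?D \<omega> \<partial>M)"
    by (rule M.L2_tendsto_moments(1)[OF D S_sq])
  then have mean: "(\<integral>\<omega>. ?D \<omega> \<partial>M) = 0"
    by (simp add: S_mean LIMSEQ_const_iff)
  have "P \<longlonglongrightarrow> (\<integral>\<omega>. (?D \<omega>)\<^sup>2 \<partial>M)"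
    using M.L2_tendsto_moments(2)[OF D S_sq] by (simp add: S_var)
  then show second: "(\<integral>\<omega>. (?D \<omega>)\<^sup>2 \<partial>M) = V"
    using P_lim LIMSEQ_unique by blast
  then show "M.variance ?D = V" by (simp add: mean)
qed

end


section \<open>The three regimes\<close>

text \<open>As the normalisation \<open>f\<close> is at least 1, the second moment dominates the
  normalised one, whose limit is positive.\<close>

lemma not_L2_tendsto_0:
  fixes f :: "nat \<Rightarrow> real"
  assumes "\<And>L. L \<ge> 1 \<Longrightarrow> (\<integral>\<omega>. (X L \<omega>)\<^sup>2 \<partial>M) = V L" "\<And>L. V L \<ge> 0"
    and f: "\<And>L. L \<ge> 1 \<Longrightarrow> f L \<ge> 1" and lim: "(\<lambda>L. V L / f L) \<longlonglongrightarrow> c" "c > 0"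
  shows "\<not> L2_tendsto M X (\<lambda>_. 0)"
proof
  assume "L2_tendsto M X (\<lambda>_. 0)"
  then have "(\<lambda>L. \<integral>\<omega>. (X L \<omega>)\<^sup>2 \<partial>M) \<longlonglongrightarrow> 0" by (simp add: L2_tendsto_def)
  moreover have "\<forall>\<^sub>F L in sequentially. V L / f L \<le> (\<integral>\<omega>. (X L \<omega>)\<^sup>2 \<partial>M)"
    using eventually_ge_at_top[of 1]
  proof eventually_elim
    case (elim L)
    then show ?case
      using assms(1)[OF elim] assms(2)[of L] f[OF elim] mult_left_mono[OF f[OF elim] assms(2)[of L]]
      by (simp add: divide_le_eq)
  qed
  ultimately have "c \<le> 0"
    using tendsto_le[OF _ _ lim(1)] by (metis trivial_limit_sequentially)
  then show False using lim(2) by simp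
qed

theorem theorem3p3:
  fixes d :: nat
    and \<sigma> :: "real \<Rightarrow> real" and \<Gamma>b \<Gamma>W0 :: real
    and \<kappa> \<kappa>' :: "real \<Rightarrow> real"
    and M :: "'w measure"
    and T :: "nat \<Rightarrow> (real ^ 'n) \<Rightarrow> 'w \<Rightarrow> real"
    and N :: "nat \<Rightarrow> nat" and Y :: "nat \<Rightarrow> nat \<Rightarrow> (real ^ 'n) \<Rightarrow> real"
    and last :: 'n and north :: "real ^ 'n"
    and TD :: "nat \<Rightarrow> nat \<Rightarrow> (real ^ 'n) \<Rightarrow> 'w \<Rightarrow> real"
    and P :: bool
  assumes d: "d \<ge> 2" "CARD('n) = d + 1"
    and sigma: "\<sigma> \<in> borel_measurable borel" "integrable std_gaussian (\<lambda>z. (\<sigma> z)\<^sup>2)"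
      "Gamma_sigma \<sigma> > 0"
    and Gamma: "\<Gamma>b > 0" "\<Gamma>W0 > 0" "\<Gamma>b + \<Gamma>W0 = 1"
    and kappa: "\<kappa> = nn_kernel \<sigma> \<Gamma>b \<Gamma>W0"
    and kappa_C1: "\<And>u. u \<in> {-1..1} \<Longrightarrow> (\<kappa> has_real_derivative \<kappa>' u) (at u within {-1..1})"
      "continuous_on {-1..1} \<kappa>'"
    and M: "prob_space M"
    and T_measurable: "\<And>L. L \<ge> 1 \<Longrightarrow>
      (\<lambda>(x, \<omega>). T L x \<omega>) \<in> borel_measurable (sphere_measure \<Otimes>\<^sub>M M)"
    and T_gaussian: "\<And>L. L \<ge> 1 \<Longrightarrow> centered_gaussian_field M (sphere 0 1) (T L)"
    and T_cov: "\<And>L x y. L \<ge> 1 \<Longrightarrow> x \<in> sphere 0 1 \<Longrightarrow> y \<in> sphere 0 1 \<Longrightarrow>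
      prob_space.expectation M (\<lambda>\<omega>. T L x \<omega> * T L y \<omega>) = (\<kappa> ^^ L) (x \<bullet> y)"
    and Y: "spherical_harmonic_basis N Y"
    and north: "north = axis last 1"
    and TD: "TD = (\<lambda>r L. spectral_deriv M N Y r (T L))"
    and P: "P \<longleftrightarrow> (\<forall>x\<in>sphere 0 1. L2_tendsto M (\<lambda>L \<omega>. T L x \<omega> - T L north \<omega>) (\<lambda>_. 0))"
  shows
    \<comment> \<open>the derivatives exist\<close>
    "(\<forall>s. times_differentiable_near_1 s \<kappa> \<longrightarrow>
        (\<forall>r\<in>{1..s}. \<forall>L\<ge>1. \<forall>x\<in>sphere 0 1. is_spectral_deriv M N Y r (T L) x (TD r L x)))
     \<and>
     \<comment> \<open>low-disorder\<close>
     (\<kappa>' 1 < 1 \<longrightarrow>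
        P \<and>
        (\<forall>s. times_differentiable_near_1 s \<kappa> \<longrightarrow>
          (\<forall>r\<in>{1..s}. \<forall>x\<in>sphere 0 1.
             (\<lambda>L. prob_space.variance M (TD r L x)) \<in> O(\<lambda>L. \<kappa>' 1 ^ L) \<and>
             L2_tendsto M (\<lambda>L. TD r L x) (\<lambda>_. 0))))
     \<and>
     \<comment> \<open>sparse\<close>
     (\<kappa>' 1 = 1 \<longrightarrow>
        P \<and>
        (\<forall>s. times_differentiable_near_1 s \<kappa> \<longrightarrow>
          (\<forall>r\<in>{1..s}. \<exists>c>0. \<forall>x\<in>sphere 0 1.
             (\<lambda>L. prob_space.variance M (TD r L x) / real L ^ (r - 1)) \<longlonglongrightarrow> c \<and>
             \<not> L2_tendsto M (\<lambda>L. TD r L x) (\<lambda>_. 0))))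
     \<and>
     \<comment> \<open>high-disorder\<close>
     (\<kappa>' 1 > 1 \<longrightarrow>
        \<not> P \<and>
        (\<forall>s. times_differentiable_near_1 s \<kappa> \<longrightarrow>
          (\<forall>r\<in>{1..s}. \<exists>c>0. \<forall>x\<in>sphere 0 1.
             (\<lambda>L. prob_space.variance M (TD r L x) / \<kappa>' 1 ^ (r * L)) \<longlonglongrightarrow> c \<and>
             \<not> L2_tendsto M (\<lambda>L. TD r L x) (\<lambda>_. 0))))"
proof -
  interpret M: prob_space M by (rule M)
  define D where "D = \<kappa>' 1"
  define dr where "dr = real d"
  have dr: "dr \<ge> 2" using d(1) by (simp add: dr_def)
  have dim: "real DIM(real ^ 'n) = dr + 1" using d(2) by (simp add: dr_def)
  have cont: "continuous_on {-1..1} \<kappa>"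
    using kappa_C1(1) by (intro DERIV_continuous_on)
  \<comment> \<open>The assumption that \<kappa> is continuously differentiable enters through
    continuity here and through the slope \<open>D\<close> at 1 below.\<close>
  obtain p :: "nat pmf" where p0: "pmf p 0 > 0" and \<kappa>p: "\<And>u. \<bar>u\<bar> \<le> 1 \<Longrightarrow> \<kappa> u = pgf p u"
    using nn_kernel_eq_pgf[OF sigma Gamma cont[unfolded kappa]] unfolding kappa by blast
  have \<kappa>p': "\<kappa> u = pgf p u" if "u \<in> {-1..1}" for u
    using \<kappa>p[of u] that by (simp add: abs_le_iff)
  have pgf_deriv: "(pgf p has_real_derivative D) (at 1 within {-1..1})"
    unfolding D_def
    by (rule has_field_derivative_transform_within[OF kappa_C1(1)[of 1], where d = 1]) (auto simp: \<kappa>p')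
  have pgf_cont: "continuous_on {-1..1} (pgf p)"
    by (rule continuous_on_eq[OF cont \<kappa>p'])
  have D_sums: "(\<lambda>n. real n * pmf p n) sums D"
    unfolding D_def using kappa_C1(1)[of 1] by (intro pgf_mean_sums[OF \<kappa>p']) auto
  have iterates: "(\<kappa> ^^ L) u = (pgf p ^^ L) u" if "\<bar>u\<bar> \<le> 1" for u L
    using pgf_iterates_bound[OF that, of _ p] by (induction L) (simp_all add: \<kappa>p)
  have cov: "(\<integral>\<omega>. T L x \<omega> * T L y \<omega> \<partial>M) = pgf (branching_pmf p L) (x \<bullet> y)"
    if "L \<ge> 1" "x \<in> sphere 0 1" "y \<in> sphere 0 1" for L x y
    using T_cov[OF that] inner_sphere_abs_le[OF that(2,3)]
    by (simp add: iterates pgf_branching_pmf)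
  have T_sq: "square_integrable M (T L x)" if "L \<ge> 1" "x \<in> sphere 0 1" for L x
    by (rule centered_gaussian_field_moments(1)[OF T_gaussian[OF that(1)] that(2)])
  have north1: "north \<in> sphere 0 1" by (simp add: north norm_axis_1)
  \<comment> \<open>Both variances are 1 because a generating function is 1 at 1, so the increment
    is governed by the iterated kernel at \<open>x \<bullet> north\<close>.\<close>
  have P_diff: "(\<integral>\<omega>. (T L x \<omega> - T L north \<omega>)\<^sup>2 \<partial>M) = 2 - 2 * (pgf p ^^ L) (x \<bullet> north)"
    if L: "L \<ge> 1" and x: "x \<in> sphere 0 1" for L x
  proof -
    note int = integrable_mult_square_integrable
    have "(\<integral>\<omega>. (T L x \<omega> - T L north \<omega>)\<^sup>2 \<partial>M) =
        (\<integral>\<omega>. T L x \<omega> * T L x \<omega> - 2 * (T L x \<omega> * T L north \<omega>) + T L north \<omega> * T L north \<omega> \<partial>M)"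
      by (intro Bochner_Integration.integral_cong refl) (simp add: power2_eq_square algebra_simps)
    also have "\<dots> = pgf (branching_pmf p L) (x \<bullet> x) - 2 * pgf (branching_pmf p L) (x \<bullet> north) + pgf (branching_pmf p L) (north \<bullet> north)"
      using int[OF T_sq[OF L x] T_sq[OF L x]] int[OF T_sq[OF L x] T_sq[OF L north1]]
        int[OF T_sq[OF L north1] T_sq[OF L north1]]
      by (simp add: cov[OF L x x] cov[OF L x north1] cov[OF L north1 north1])
    also have "\<dots> = 2 - 2 * pgf (branching_pmf p L) (x \<bullet> north)"
      using x north1 by (simp add: dot_square_norm)
    finally show ?thesis using inner_sphere_abs_le[OF x north1] by (simp add: pgf_branching_pmf)
  qed
  have P_iff: "L2_tendsto M (\<lambda>L \<omega>. T L x \<omega> - T L north \<omega>) (\<lambda>_. 0) \<longleftrightarrow> (\<lambda>L. (pgf p ^^ L) (x \<bullet> north)) \<longlonglongrightarrow> 1"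
    if x: "x \<in> sphere 0 1" for x
  proof -
    have ev: "\<forall>\<^sub>F L in sequentially. square_integrable M (\<lambda>\<omega>. T L x \<omega> - T L north \<omega>)"
      using eventually_ge_at_top[of 1]
      by eventually_elim (intro square_integrable_diff T_sq x north1)
    have "\<forall>\<^sub>F L in sequentially. (\<integral>\<omega>. (T L x \<omega> - T L north \<omega> - 0)\<^sup>2 \<partial>M) = 2 - 2 * (pgf p ^^ L) (x \<bullet> north)"
      using eventually_ge_at_top[of 1] by eventually_elim (simp add: P_diff[OF _ x])
    from tendsto_cong[OF this]
    have "L2_tendsto M (\<lambda>L \<omega>. T L x \<omega> - T L north \<omega>) (\<lambda>_. 0) \<longleftrightarrow> (\<lambda>L. 2 - 2 * (pgf p ^^ L) (x \<bullet> north)) \<longlonglongrightarrow> 0"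
      using ev by (simp add: L2_tendsto_def square_integrable_def)
    also have "\<dots> \<longleftrightarrow> (\<lambda>L. (pgf p ^^ L) (x \<bullet> north)) \<longlonglongrightarrow> 1"
    proof
      assume "(\<lambda>L. 2 - 2 * (pgf p ^^ L) (x \<bullet> north)) \<longlonglongrightarrow> 0"
      then have "(\<lambda>L. 1 - (2 - 2 * (pgf p ^^ L) (x \<bullet> north)) / 2) \<longlonglongrightarrow> 1 - 0 / 2"
        by (intro tendsto_intros) auto
      then show "(\<lambda>L. (pgf p ^^ L) (x \<bullet> north)) \<longlonglongrightarrow> 1" by (simp add: diff_divide_distrib)
    next
      assume "(\<lambda>L. (pgf p ^^ L) (x \<bullet> north)) \<longlonglongrightarrow> 1"
      then have "(\<lambda>L. 2 - 2 * (pgf p ^^ L) (x \<bullet> north)) \<longlonglongrightarrow> 2 - 2 * 1"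
        by (intro tendsto_intros)
      then show "(\<lambda>L. 2 - 2 * (pgf p ^^ L) (x \<bullet> north)) \<longlonglongrightarrow> 0" by simp
    qed
    finally show ?thesis .
  qed
  have P_true: P if "D \<le> 1"
    unfolding P using pgf_iterates_tendsto_1[OF D_sums that p0 pgf_cont] inner_sphere_abs_le[OF _ north1]
    by (auto simp: P_iff)
  have P_false: "\<not> P" if "D > 1"
  proof
    assume P
    \<comment> \<open>In dimension \<open>d + 1\<close> with \<open>d \<ge> 2\<close> there is
      another axis. Its unit vector is orthogonal to the pole and starts the iteration at 0, where
      convergence to 1 fails.\<close>
    have "\<exists>k. k \<noteq> last"
    proof (rule ccontr)
      assume "\<not> ?thesis"
      then have "UNIV = {last}" by auto
      then have "CARD('n) = 1" by (metis card_1_singleton_iff One_nat_def)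
      then show False using d by simp
    qed
    then obtain k where k: "k \<noteq> last" by blast
    define x :: "real ^ 'n" where "x = axis k 1"
    have "x \<in> sphere 0 1" by (simp add: x_def norm_axis_1)
    moreover have "x \<bullet> north = 0" using k by (simp add: x_def north inner_axis_axis)
    ultimately have "(\<lambda>L. (pgf p ^^ L) 0) \<longlonglongrightarrow> 1"
      using \<open>P\<close> P_iff[of x] unfolding P by auto
    then show False using pgf_iterates_not_tendsto_1[OF D_sums that pgf_deriv] by simp
  qed
  \<comment> \<open>The factor \<open>fact j\<close> turns binomial moments into factorial ones.
    Positivity of \<open>W r r\<close> secures the constant, since the moment of order
    \<open>r\<close> dominates in the critical and supercritical regimes.\<close>
  define W where "W r j = zonal_weight dr r j * fact j" for r j
  define V where "V r L = (\<Sum>j=1..r. W r j * branching_moment p j L)" for r L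
  have W: "W r j \<ge> 0" "W r r > 0" for r j
    using zonal_weight_nonneg[OF dr] zonal_weight_diag_pos[OF dr] by (simp_all add: W_def)
  have bm_nonneg: "branching_moment p j L \<ge> 0" for j L by (simp add: branching_moment_def)
  have V_nonneg: "V r L \<ge> 0" for r L
    unfolding V_def using W bm_nonneg by (intro sum_nonneg) simp
  have fin: "binomial_moment p j < \<infinity>" if "times_differentiable_near_1 s \<kappa>" "j \<le> s" for s j
    by (rule binomial_moment_finite[OF that(1) \<kappa>p' that(2)])
  have main: "is_spectral_deriv M N Y r (T L) x (TD r L x)"
    "square_integrable M (TD r L x)" "(\<integral>\<omega>. (TD r L x \<omega>)\<^sup>2 \<partial>M) = V r L" "M.variance (TD r L x) = V r L"
    if s: "times_differentiable_near_1 s \<kappa>" and r: "r \<in> {1..s}" and L: "L \<ge> 1" and x: "x \<in> sphere 0 1" for s r L x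
  proof -
    have finL: "binomial_moment (branching_pmf p L) j < \<infinity>" if "1 \<le> j" "j \<le> r" for j
      using binomial_moment_branching_finite[OF fin[OF s] D_sums p0, of s j L] that r by simp
    have r1: "r \<ge> 1" using r by simp
    note * = spectral_deriv_moments[OF dr dim Y M T_measurable[OF L] T_gaussian[OF L] cov[OF L] r1 finL x]
    have V: "V r L = (\<Sum>j=1..r. zonal_weight dr r j * fact j * enn2real (binomial_moment (branching_pmf p L) j))"
      by (simp add: V_def W_def branching_moment_def)
    show "is_spectral_deriv M N Y r (T L) x (TD r L x)" unfolding TD by (rule *(1))
    show "square_integrable M (TD r L x)" unfolding TD by (rule *(2))
    show "(\<integral>\<omega>. (TD r L x \<omega>)\<^sup>2 \<partial>M) = V r L" unfolding TD V by (rule *(3))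
    show "M.variance (TD r L x) = V r L" unfolding TD V by (rule *(4))
  qed
  have exist: "is_spectral_deriv M N Y r (T L) x (TD r L x)"
    if "times_differentiable_near_1 s \<kappa>" "r \<in> {1..s}" "L \<ge> 1" "x \<in> sphere 0 1" for s r L x
    using main(1)[OF that] .
  have low: "(\<lambda>L. M.variance (TD r L x)) \<in> O(\<lambda>L. D ^ L) \<and> L2_tendsto M (\<lambda>L. TD r L x) (\<lambda>_. 0)"
    if D: "D < 1" and s: "times_differentiable_near_1 s \<kappa>" and r: "r \<in> {1..s}" and x: "x \<in> sphere 0 1" for s r x
  proof -
    have D0: "D \<ge> 0" by (rule mean_nonneg[OF fin[OF s] D_sums p0])
    have "\<forall>j\<in>{1..r}. \<exists>C. \<forall>L\<ge>1. branching_moment p j L \<le> C * D ^ L"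
      using branching_moment_subcritical[OF fin[OF s] D_sums p0 D] r by auto
    then obtain C where C: "\<And>j L. j \<in> {1..r} \<Longrightarrow> L \<ge> 1 \<Longrightarrow> branching_moment p j L \<le> C j * D ^ L"
      by (metis (no_types))
    \<comment> \<open>Below criticality every moment is bounded by a multiple of the same power
      \<open>D ^ L\<close>, so the constants simply add up.\<close>
    define K where "K = (\<Sum>j=1..r. W r j * C j)"
    have V_le: "V r L \<le> K * D ^ L" if "L \<ge> 1" for L
      unfolding V_def K_def sum_distrib_right mult.assoc
      using C that W by (intro sum_mono mult_left_mono) auto
    have "(\<lambda>L. M.variance (TD r L x)) \<in> O(\<lambda>L. D ^ L)"
    proof (rule bigoI)
      show "\<forall>\<^sub>F L in sequentially. norm (M.variance (TD r L x)) \<le> K * norm (D ^ L)"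
        using eventually_ge_at_top[of 1]
      proof eventually_elim
        case (elim L)
        then show ?case
          using main(4)[OF s r elim x] V_le[OF elim] V_nonneg[of r L] D0 by simp
      qed
    qed
    moreover have "L2_tendsto M (\<lambda>L. TD r L x) (\<lambda>_. 0)"
    proof -
      have ev: "\<forall>\<^sub>F L in sequentially. square_integrable M (TD r L x)"
        using eventually_ge_at_top[of 1] by eventually_elim (rule main(2)[OF s r _ x])
      have "(\<lambda>L. D ^ L) \<longlonglongrightarrow> 0" using D D0 by (intro LIMSEQ_realpow_zero)
      from tendsto_mult[OF tendsto_const this, of K] have lim: "(\<lambda>L. K * D ^ L) \<longlonglongrightarrow> 0" by simp
      have "(\<lambda>L. \<integral>\<omega>. (TD r L x \<omega>)\<^sup>2 \<partial>M) \<longlonglongrightarrow> 0"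
      proof (rule tendsto_sandwich[OF _ _ tendsto_const lim])
        show "\<forall>\<^sub>F L in sequentially. (\<integral>\<omega>. (TD r L x \<omega>)\<^sup>2 \<partial>M) \<le> K * D ^ L"
          using eventually_ge_at_top[of 1]
          by eventually_elim (simp add: main(3)[OF s r _ x] V_le)
      qed simp
      then show ?thesis using ev by (simp add: L2_tendsto_def square_integrable_def)
    qed
    ultimately show ?thesis ..
  qed
  have sparse: "\<exists>c>0. \<forall>x\<in>sphere 0 1.
      (\<lambda>L. M.variance (TD r L x) / real L ^ (r - 1)) \<longlonglongrightarrow> c \<and> \<not> L2_tendsto M (\<lambda>L. TD r L x) (\<lambda>_. 0)"
    if D: "D = 1" and s: "times_differentiable_near_1 s \<kappa>" and r: "r \<in> {1..s}" for s r
  proof -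
    have bm: "\<exists>e>0. (\<lambda>L. branching_moment p j L / real L ^ (j - 1)) \<longlonglongrightarrow> e" if "1 \<le> j" "j \<le> r" for j
      using branching_moment_critical[OF fin[OF s] D_sums p0 D that(1)] that(2) r by auto
    obtain e where e: "e > 0" "(\<lambda>L. branching_moment p r L / real L ^ (r - 1)) \<longlonglongrightarrow> e"
      using bm[of r] r by auto
    have lim: "(\<lambda>L. V r L / real L ^ (r - 1)) \<longlonglongrightarrow> W r r * e"
    proof -
      have "(\<lambda>L. \<Sum>j=1..r. W r j * (branching_moment p j L / real L ^ (r - 1))) \<longlonglongrightarrow> (\<Sum>j=1..r. if j = r then W r r * e else 0)"
      proof (intro tendsto_sum)
        fix j assume j: "j \<in> {1..r}"
        show "(\<lambda>L. W r j * (branching_moment p j L / real L ^ (r - 1))) \<longlonglongrightarrow> (if j = r then W r r * e else 0)"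
        proof (cases "j = r")
          case True
          then show ?thesis using tendsto_mult[OF tendsto_const e(2), of "W r r"] by simp
        next
          case False
          \<comment> \<open>A moment of order \<open>j < r\<close> grows only like L^(j - 1); after
            division by L^(r - 1) a factor (1 / L)^(r - j) is left over and tends to 0.\<close>
          obtain e' where e': "(\<lambda>L. branching_moment p j L / real L ^ (j - 1)) \<longlonglongrightarrow> e'"
            using bm[of j] j by auto
          have "(\<lambda>L. W r j * (branching_moment p j L / real L ^ (j - 1) * (1 / real L) ^ (r - j))) \<longlonglongrightarrow> W r j * (e' * 0 ^ (r - j))"
            by (intro tendsto_intros e' lim_1_over_n)
          moreover have "branching_moment p j L / real L ^ (j - 1) * (1 / real L) ^ (r - j) = branching_moment p j L / real L ^ (r - 1)" for L
          proof -
            have "r - 1 = (j - 1) + (r - j)" using j by auto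
            then have "real L ^ (r - 1) = real L ^ (j - 1) * real L ^ (r - j)" by (metis power_add)
            then show ?thesis by (simp add: power_one_over)
          qed
          ultimately have "(\<lambda>L. W r j * (branching_moment p j L / real L ^ (r - 1))) \<longlonglongrightarrow> W r j * (e' * 0 ^ (r - j))"
            by (simp only:)
          then show ?thesis using False j by (simp add: power_0_left)
        qed
      qed
      then show ?thesis using r by (simp add: V_def sum_divide_distrib sum.delta)
    qed
    have "(\<lambda>L. M.variance (TD r L x) / real L ^ (r - 1)) \<longlonglongrightarrow> W r r * e \<and> \<not> L2_tendsto M (\<lambda>L. TD r L x) (\<lambda>_. 0)"
      if x: "x \<in> sphere 0 1" for x
    proof
      have "\<forall>\<^sub>F L in sequentially. V r L / real L ^ (r - 1) = M.variance (TD r L x) / real L ^ (r - 1)"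
        using eventually_ge_at_top[of 1] by eventually_elim (simp add: main(4)[OF s r _ x])
      then show "(\<lambda>L. M.variance (TD r L x) / real L ^ (r - 1)) \<longlonglongrightarrow> W r r * e"
        by (rule Lim_transform_eventually[OF lim])
      show "\<not> L2_tendsto M (\<lambda>L. TD r L x) (\<lambda>_. 0)"
      proof (rule not_L2_tendsto_0[OF main(3)[OF s r _ x] V_nonneg _ lim])
        show "1 \<le> real L ^ (r - 1)" if "1 \<le> L" for L using that by simp
        show "0 < W r r * e" using W e by simp
      qed
    qed
    moreover have "W r r * e > 0" using W e by simp
    ultimately show ?thesis by blast
  qed
  have high: "\<exists>c>0. \<forall>x\<in>sphere 0 1.
      (\<lambda>L. M.variance (TD r L x) / D ^ (r * L)) \<longlonglongrightarrow> c \<and> \<not> L2_tendsto M (\<lambda>L. TD r L x) (\<lambda>_. 0)"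
    if D: "D > 1" and s: "times_differentiable_near_1 s \<kappa>" and r: "r \<in> {1..s}" for s r
  proof -
    have bm: "\<exists>e>0. (\<lambda>L. branching_moment p j L / D ^ (j * L)) \<longlonglongrightarrow> e" if "1 \<le> j" "j \<le> r" for j
      using branching_moment_supercritical[OF fin[OF s] D_sums p0 D that(1)] that(2) r by auto
    obtain e where e: "e > 0" "(\<lambda>L. branching_moment p r L / D ^ (r * L)) \<longlonglongrightarrow> e"
      using bm[of r] r by auto
    have lim: "(\<lambda>L. V r L / D ^ (r * L)) \<longlonglongrightarrow> W r r * e"
    proof -
      have "(\<lambda>L. \<Sum>j=1..r. W r j * (branching_moment p j L / D ^ (r * L))) \<longlonglongrightarrow> (\<Sum>j=1..r. if j = r then W r r * e else 0)"
      proof (intro tendsto_sum)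
        fix j assume j: "j \<in> {1..r}"
        show "(\<lambda>L. W r j * (branching_moment p j L / D ^ (r * L))) \<longlonglongrightarrow> (if j = r then W r r * e else 0)"
        proof (cases "j = r")
          case True
          then show ?thesis using tendsto_mult[OF tendsto_const e(2), of "W r r"] by simp
        next
          case False
          obtain e' where e': "(\<lambda>L. branching_moment p j L / D ^ (j * L)) \<longlonglongrightarrow> e'"
            using bm[of j] j by auto
          \<comment> \<open>A moment of order \<open>j < r\<close> falls behind by this geometric
            ratio per layer.\<close>
          have "(1 / D) ^ (r - j) < 1"
            using D j False by (intro power_Suc_less_one[THEN order.strict_trans2] | simp add: power_less_one_iff)+
          then have "(\<lambda>L. ((1 / D) ^ (r - j)) ^ L) \<longlonglongrightarrow> 0"
            using D by (intro LIMSEQ_realpow_zero) auto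
          from tendsto_mult[OF e' this]
          have "(\<lambda>L. W r j * (branching_moment p j L / D ^ (j * L) * ((1 / D) ^ (r - j)) ^ L)) \<longlonglongrightarrow> W r j * (e' * 0)"
            by (rule tendsto_mult[OF tendsto_const])
          moreover have "branching_moment p j L / D ^ (j * L) * ((1 / D) ^ (r - j)) ^ L = branching_moment p j L / D ^ (r * L)" for L
          proof -
            have "r * L = j * L + (r - j) * L" using j by (simp flip: add_mult_distrib)
            then have "D ^ (r * L) = D ^ (j * L) * (D ^ (r - j)) ^ L" by (metis power_add power_mult)
            then show ?thesis by (simp add: power_one_over)
          qed
          ultimately have "(\<lambda>L. W r j * (branching_moment p j L / D ^ (r * L))) \<longlonglongrightarrow> W r j * (e' * 0)"
            by (simp only:)
          then show ?thesis using False by simp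
        qed
      qed
      then show ?thesis using r by (simp add: V_def sum_divide_distrib sum.delta)
    qed
    have "(\<lambda>L. M.variance (TD r L x) / D ^ (r * L)) \<longlonglongrightarrow> W r r * e \<and> \<not> L2_tendsto M (\<lambda>L. TD r L x) (\<lambda>_. 0)"
      if x: "x \<in> sphere 0 1" for x
    proof
      have "\<forall>\<^sub>F L in sequentially. V r L / D ^ (r * L) = M.variance (TD r L x) / D ^ (r * L)"
        using eventually_ge_at_top[of 1] by eventually_elim (simp add: main(4)[OF s r _ x])
      then show "(\<lambda>L. M.variance (TD r L x) / D ^ (r * L)) \<longlonglongrightarrow> W r r * e"
        by (rule Lim_transform_eventually[OF lim])
      show "\<not> L2_tendsto M (\<lambda>L. TD r L x) (\<lambda>_. 0)"
      proof (rule not_L2_tendsto_0[OF main(3)[OF s r _ x] V_nonneg _ lim])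
        show "1 \<le> D ^ (r * L)" if "1 \<le> L" for L using D by (simp add: one_le_power)
        show "0 < W r r * e" using W e by simp
      qed
    qed
    moreover have "W r r * e > 0" using W e by simp
    ultimately show ?thesis by blast
  qed
  show ?thesis
    unfolding D_def[symmetric]
  proof (intro conjI impI allI ballI)
    show "L2_tendsto M (\<lambda>L. TD r L x) (\<lambda>_. 0)" "(\<lambda>L. M.variance (TD r L x)) \<in> O(\<lambda>L. D ^ L)"
      if "D < 1" "times_differentiable_near_1 s \<kappa>" "r \<in> {1..s}" "x \<in> sphere 0 1" for s r x
      using low[OF that] by auto
  qed (use exist sparse high P_true P_false in \<open>auto simp del: atLeastAtMost_iff\<close>)
qed

end
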